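(* Let $\Omega$ be a term order and let $J,J'\in\mathsf{S}^n_{p(t)}$ be two Borel adjacent strongly stable ideals such that the Borel maximum of $\mathfrak{J}\setminus\mathfrak{J}'$ is greater than the Borel maximum of $\mathfrak{J}'\setminus\mathfrak{J}$ with respect to $\Omega$. Then the point $[J']\in\mathbf{Hilb}^n_{p(t)}$ is contained in the closure $\overline{\mathbf{St}_J^{\Omega}}\subset\mathbf{Hilb}^n_{p(t)}$ of the Gröbner stratum of $J$ with respect to $\Omega$.
   Context: $\mathbb{K}$ is an algebraically closed field of characteristic $0$, $\mathbb{K}[\mathbf{x}]=\mathbb{K}[x_0,\dots,x_n]$ with the standard grading and variables ordered $x_0<\dots<x_n$; all term orders are assumed to satisfy $x_0<\dots<x_n$. $\mathbb{P}^n=\operatorname{Proj}\mathbb{K}[\mathbf{x}]$. Monomials are written $\mathbf{x}^{a}$, $a\in\mathbb{Z}_{\ge0}^{n+1}$; generalized monomials are $\mathbf{x}^a$ with $a\in\mathbb{Z}^{n+1}$. The Hilbert polynomial of an ideal $I$ means that of $\mathbb{K}[\mathbf{x}]/I$. $\mathbf{Hilb}^n_{p(t)}$ is the Hilbert scheme of closed subschemes of $\mathbb{P}^n$ with Hilbert polynomial $p(t)$; $[J]$ denotes the point of $\operatorname{Proj}(\mathbb{K}[\mathbf{x}]/J)$. Elementary moves on generalized monomials: $\mathsf{e}^+_i(\mathbf{x}^a)=\frac{x_{i+1}}{x_i}\mathbf{x}^a$ for $i<n$ (increasing) and $\mathsf{e}^-_j(\mathbf{x}^a)=\frac{x_{j-1}}{x_j}\mathbf{x}^a$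 for $j>0$ (decreasing). The Borel order $\ge_B$ on monomials of a given degree is the reflexive-transitive closure of the relations $\mathbf{x}^a>_B\mathbf{x}^b$ whenever $\mathbf{x}^a=\mathsf{e}^+_i(\mathbf{x}^b)$ for some $i$. A monomial ideal $J$ is strongly stable if $\mathbf{x}^a\ge_B\mathbf{x}^b$ and $\mathbf{x}^b\in J$ imply $\mathbf{x}^a\in J$. The Gotzmann number $r$ of $p(t)$ is the number of summands in its unique expression $p(t)=\sum_{i=1}^r\binom{t+a_i-i+1}{a_i}$ with $a_1\ge\dots\ge a_r\ge0$. $\mathsf{S}^n_{p(t)}$ is the set of ideals $J=J^{\mathrm{sat}}_{\ge r}$ (truncations in degree $r$) where $J^{\mathrm{sat}}$ is a saturated strongly stable ideal with Hilbert polynomial $p(t)$. For $J\in\mathsf{S}^n_{p(t)}$, $\mathfrak{J}$ is the set of monomials of degree $r$ in $J$ (so $J=(\mathfrak{J})$), and $\mathfrak{J}^{\mathsf c}$ its complement in the set of monomials of degree $r$. $J,J'\in\mathsf{S}^n_{p(t)}$ are Borel adjacent if (1) $\mathfrak{J}\setminus\mathfrak{J}'$ has a maximum $\mathbf{x}^a$ with respect to $\ge_B$ and $\mathfrak{J}'\setminus\mathfrak{J}$ has a maximum $\mathbf{x}^{a'}$ with respect to $\ge_B$ (the Borel maxima); and (2) there is a set $\mathcal{E}_{J,J'}$ consisting of the identity map and compositions of decreasing elementary moves such that $\mathfrak{J}\setminus\mathfrak{J}'=\{\mathsf{E}(\mathbf{x}^a):\mathsf{E}\in\mathcal{E}_{J,J'}\}$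 and $\mathfrak{J}'\setminus\mathfrak{J}=\{\mathsf{E}(\mathbf{x}^{a'}):\mathsf{E}\in\mathcal{E}_{J,J'}\}$. Gröbner stratum: for a $\mathbb{K}$-algebra $A$, a $(J,\Omega)$-marked set is a set of polynomials $\{\mathbf{f}_a=\mathbf{x}^a+\sum c_{a,b}\mathbf{x}^b : \mathbf{x}^a\in\mathfrak{J}\}$, $c_{a,b}\in A$, where the sum runs over $\mathbf{x}^b\in\mathfrak{J}^{\mathsf c}$ with $\mathbf{x}^b<_\Omega\mathbf{x}^a$; it is a $(J,\Omega)$-marked basis if for the ideal $(F)\subset A[\mathbf{x}]$ it generates and every $m\ge r$, the monomials of degree $m$ not in $J$ form an $A$-basis of $A[\mathbf{x}]_m/(F)_m$. The functor sending $A$ to the set of ideals of $A[\mathbf{x}]$ generated by a $(J,\Omega)$-marked basis is represented by a scheme $\mathbf{St}_J^\Omega$, the Gröbner stratum, which (via $I\mapsto\operatorname{Proj}A[\mathbf{x}]/I$) is a locally closed subscheme of $\mathbf{Hilb}^n_{p(t)}$. Its $\mathbb{K}$-points are the ideals generated by a $(J,\Omega)$-marked basis; such ideals have initial ideal $J$ with respect to $\Omega$. *)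

theory Defs
  imports
    "HOL-Library.Poly_Mapping"
    "HOL-Algebra.Ideal"
    "HOL-Analysis.Abstract_Topology"
    "HOL-Computational_Algebra.Polynomial"
    "Jordan_Normal_Form.Determinant"
begin

section \<open>Polynomials in \<open>x\<^sub>0, \<dots>, x\<^sub>n\<close>\<close>

text \<open>
  A monomial is its exponent vector, of type \<open>nat \<Rightarrow>\<^sub>0 nat\<close>; a polynomial is a finitely supported
  family of coefficients on monomials, with the convolution product of \<open>HOL-Library.Poly_Mapping\<close>.
  The bound on the indices of the variables is imposed by the carrier of the ring.
\<close>

type_synonym mon = "nat \<Rightarrow>\<^sub>0 nat"
type_synonym gmon = "nat \<Rightarrow>\<^sub>0 int"
type_synonym 'a mpol = "mon \<Rightarrow>\<^sub>0 'a"

definition mons :: "nat \<Rightarrow> mon set" where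
  "mons n = {a. Poly_Mapping.keys a \<subseteq> {..n}}"

definition mdeg :: "('v \<Rightarrow>\<^sub>0 nat) \<Rightarrow> nat" where
  "mdeg a = (\<Sum>i\<in>Poly_Mapping.keys a. Poly_Mapping.lookup a i)"

definition mons_deg :: "nat \<Rightarrow> nat \<Rightarrow> mon set" where
  "mons_deg n d = {a \<in> mons n. mdeg a = d}"

definition xpow :: "mon \<Rightarrow> 'a::comm_ring_1 mpol" where
  "xpow a = Poly_Mapping.single a 1"

definition scal :: "'a::comm_ring_1 \<Rightarrow> 'a mpol \<Rightarrow> 'a mpol" where
  "scal c f = Poly_Mapping.single 0 c * f"

definition mpoly_ring :: "nat \<Rightarrow> 'a::comm_ring_1 mpol ring" where
  "mpoly_ring n = \<lparr>carrier = {f. Poly_Mapping.keys f \<subseteq> mons n},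
     monoid.mult = (*), one = 1, ring.zero = 0, add = (+)\<rparr>"

definition homog_of_deg :: "nat \<Rightarrow> (('v \<Rightarrow>\<^sub>0 nat) \<Rightarrow>\<^sub>0 'a::zero) \<Rightarrow> bool" where
  "homog_of_deg d f \<longleftrightarrow> (\<forall>m\<in>Poly_Mapping.keys f. mdeg m = d)"

definition deg_part :: "'a::zero mpol set \<Rightarrow> nat \<Rightarrow> 'a mpol set" where
  "deg_part I d = {f \<in> I. homog_of_deg d f}"

definition hcomp :: "nat \<Rightarrow> 'a::comm_ring_1 mpol \<Rightarrow> 'a mpol" where
  "hcomp d f = (\<Sum>m\<in>{m \<in> Poly_Mapping.keys f. mdeg m = d}.
     Poly_Mapping.single m (Poly_Mapping.lookup f m))"

definition homog_ideal :: "nat \<Rightarrow> 'a::comm_ring_1 mpol set \<Rightarrow> bool" where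
  "homog_ideal n I \<longleftrightarrow> ideal I (mpoly_ring n) \<and> (\<forall>f\<in>I. \<forall>d. hcomp d f \<in> I)"

definition monomial_ideal :: "nat \<Rightarrow> 'a::comm_ring_1 mpol set \<Rightarrow> bool" where
  "monomial_ideal n I \<longleftrightarrow> ideal I (mpoly_ring n) \<and>
     I = genideal (mpoly_ring n) {xpow a | a. a \<in> mons n \<and> xpow a \<in> I}"

definition saturation :: "nat \<Rightarrow> 'a::comm_ring_1 mpol set \<Rightarrow> 'a mpol set" where
  "saturation n I = {f \<in> carrier (mpoly_ring n). \<exists>k. \<forall>a\<in>mons_deg n k. xpow a * f \<in> I}"

definition truncation :: "nat \<Rightarrow> 'a::zero mpol set \<Rightarrow> 'a mpol set" where
  "truncation r I = {f \<in> I. \<forall>m\<in>Poly_Mapping.keys f. r \<le> mdeg m}"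

text \<open>\<open>B\<close> is a finite subset of \<open>V\<close> whose classes form a basis of \<open>V/W\<close>; for \<open>W = {0}\<close> it is a
  finite basis of \<open>V\<close>.\<close>

definition basis_mod :: "'a::comm_ring_1 mpol set \<Rightarrow> 'a mpol set \<Rightarrow> 'a mpol set \<Rightarrow> bool" where
  "basis_mod V W B \<longleftrightarrow> finite B \<and> B \<subseteq> V \<and>
     (\<forall>f\<in>V. \<exists>!c. (\<forall>b. b \<notin> B \<longrightarrow> c b = 0) \<and> f - (\<Sum>b\<in>B. scal (c b) b) \<in> W)"

definition has_hilbert_poly :: "nat \<Rightarrow> 'a::field mpol set \<Rightarrow> rat poly \<Rightarrow> bool" where
  "has_hilbert_poly n I p \<longleftrightarrow> (\<forall>\<^sub>F t in sequentially.
     \<exists>B. basis_mod (deg_part (carrier (mpoly_ring n)) t) (deg_part I t) B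
         \<and> of_nat (card B) = poly p (of_nat t))"

definition is_gotzmann_number :: "rat poly \<Rightarrow> nat \<Rightarrow> bool" where
  "is_gotzmann_number p r \<longleftrightarrow> (\<exists>a :: nat \<Rightarrow> nat.
     (\<forall>i j. 1 \<le> i \<and> i \<le> j \<and> j \<le> r \<longrightarrow> a j \<le> a i) \<and>
     (\<forall>t. poly p t = (\<Sum>i = 1..r. (t + of_nat (a i) - of_nat i + 1) gchoose (a i))))"

definition term_order :: "nat \<Rightarrow> mon rel \<Rightarrow> bool" where
  "term_order n \<Omega> \<longleftrightarrow> linear_order_on (mons n) \<Omega> \<and>
     (\<forall>a\<in>mons n. (0, a) \<in> \<Omega>) \<and>
     (\<forall>a b c. (a, b) \<in> \<Omega> \<and> c \<in> mons n \<longrightarrow> (a + c, b + c) \<in> \<Omega>) \<and>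
     (\<forall>i<n. (Poly_Mapping.single i 1, Poly_Mapping.single (Suc i) 1) \<in> \<Omega>)"


section \<open>Strongly stable ideals and Borel adjacency\<close>

definition gen_mon :: "mon \<Rightarrow> gmon" where
  "gen_mon a = Poly_Mapping.map int a"

definition e_incr :: "nat \<Rightarrow> gmon \<Rightarrow> gmon" where
  "e_incr i a = a + Poly_Mapping.single (Suc i) 1 - Poly_Mapping.single i 1"

definition e_decr :: "nat \<Rightarrow> gmon \<Rightarrow> gmon" where
  "e_decr j a = a + Poly_Mapping.single (j - 1) 1 - Poly_Mapping.single j 1"

inductive_set decr_compositions :: "nat \<Rightarrow> (gmon \<Rightarrow> gmon) set" for n :: nat where
  id: "id \<in> decr_compositions n"
| comp: "E \<in> decr_compositions n \<Longrightarrow> 0 < j \<Longrightarrow> j \<le> n \<Longrightarrow> e_decr j \<circ> E \<in> decr_compositions n"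

definition borel_step :: "nat \<Rightarrow> mon \<Rightarrow> mon \<Rightarrow> bool" where
  "borel_step n a b \<longleftrightarrow> a \<in> mons n \<and> b \<in> mons n \<and> (\<exists>i<n. gen_mon a = e_incr i (gen_mon b))"

definition borel_ge :: "nat \<Rightarrow> mon \<Rightarrow> mon \<Rightarrow> bool" where
  "borel_ge n = (borel_step n)\<^sup>*\<^sup>*"

definition is_borel_max :: "nat \<Rightarrow> mon set \<Rightarrow> mon \<Rightarrow> bool" where
  "is_borel_max n M a \<longleftrightarrow> a \<in> M \<and> (\<forall>b\<in>M. borel_ge n a b)"

definition strongly_stable :: "nat \<Rightarrow> 'a::comm_ring_1 mpol set \<Rightarrow> bool" where
  "strongly_stable n J \<longleftrightarrow> monomial_ideal n J \<and>
     (\<forall>a\<in>mons n. \<forall>b\<in>mons n. borel_ge n a b \<and> xpow b \<in> J \<longrightarrow> xpow a \<in> J)"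

definition S_set :: "nat \<Rightarrow> rat poly \<Rightarrow> nat \<Rightarrow> 'a::field mpol set set" where
  "S_set n p r = {truncation r I | I.
     strongly_stable n I \<and> saturation n I = I \<and> has_hilbert_poly n I p}"

definition deg_mons_in :: "nat \<Rightarrow> nat \<Rightarrow> 'a::comm_ring_1 mpol set \<Rightarrow> mon set" where
  "deg_mons_in n d J = {a \<in> mons_deg n d. xpow a \<in> J}"

definition borel_adjacent ::
  "nat \<Rightarrow> nat \<Rightarrow> 'a::comm_ring_1 mpol set \<Rightarrow> 'a mpol set \<Rightarrow> bool" where
  "borel_adjacent n r J J' \<longleftrightarrow>
     (let D = deg_mons_in n r J - deg_mons_in n r J'; D' = deg_mons_in n r J' - deg_mons_in n r J
      in \<exists>a a' \<E>. is_borel_max n D a \<and> is_borel_max n D' a' \<and>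
           id \<in> \<E> \<and> \<E> \<subseteq> decr_compositions n \<and>
           gen_mon ` D = (\<lambda>E. E (gen_mon a)) ` \<E> \<and>
           gen_mon ` D' = (\<lambda>E. E (gen_mon a')) ` \<E>)"


section \<open>The Groebner stratum\<close>

text \<open>A marked set is given as a family indexed by the monomials of degree \<open>r\<close> in \<open>J\<close>.\<close>

definition marked_set ::
  "nat \<Rightarrow> nat \<Rightarrow> mon rel \<Rightarrow> 'a::comm_ring_1 mpol set \<Rightarrow> (mon \<Rightarrow> 'a mpol) \<Rightarrow> bool" where
  "marked_set n r \<Omega> J f \<longleftrightarrow> (\<forall>a\<in>deg_mons_in n r J.
     Poly_Mapping.lookup (f a) a = 1 \<and>
     (\<forall>b\<in>Poly_Mapping.keys (f a) - {a}. b \<in> mons_deg n r - deg_mons_in n r J \<and> (b, a) \<in> \<Omega>))"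

definition marked_ideal ::
  "nat \<Rightarrow> nat \<Rightarrow> 'a::comm_ring_1 mpol set \<Rightarrow> (mon \<Rightarrow> 'a mpol) \<Rightarrow> 'a mpol set" where
  "marked_ideal n r J f = genideal (mpoly_ring n) (f ` deg_mons_in n r J)"

definition marked_basis ::
  "nat \<Rightarrow> nat \<Rightarrow> mon rel \<Rightarrow> 'a::comm_ring_1 mpol set \<Rightarrow> (mon \<Rightarrow> 'a mpol) \<Rightarrow> bool" where
  "marked_basis n r \<Omega> J f \<longleftrightarrow> marked_set n r \<Omega> J f \<and>
     (\<forall>m\<ge>r. basis_mod (deg_part (carrier (mpoly_ring n)) m) (deg_part (marked_ideal n r J f) m)
              (xpow ` (mons_deg n m - deg_mons_in n m J)))"

text \<open>The ideals over the base field generated by a marked basis, i.e. the closed points of the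
  stratum.\<close>

definition groebner_stratum ::
  "nat \<Rightarrow> nat \<Rightarrow> mon rel \<Rightarrow> 'a::field mpol set \<Rightarrow> 'a mpol set set" where
  "groebner_stratum n r \<Omega> J = {marked_ideal n r J f | f. marked_basis n r \<Omega> J f}"


section \<open>The Hilbert scheme\<close>

text \<open>
  Over an algebraically closed field the closed points of the Hilbert scheme are the closed
  subschemes of projective space with Hilbert polynomial \<open>p\<close>, and these correspond bijectively to
  the saturated homogeneous ideals with Hilbert polynomial \<open>p\<close>.  An ideal \<open>I\<close> that need not be
  saturated determines the same subscheme as its saturation, hence the point \<open>hilb_point n I\<close>.
\<close>

definition Hilb :: "nat \<Rightarrow> rat poly \<Rightarrow> 'a::field mpol set set" where
  "Hilb n p = {I. homog_ideal n I \<and> saturation n I = I \<and> has_hilbert_poly n I p}"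

definition hilb_point :: "nat \<Rightarrow> 'a::field mpol set \<Rightarrow> 'a mpol set" where
  "hilb_point n I = saturation n I"

text \<open>
  By Gotzmann's theorems, for \<open>r\<close> the Gotzmann number of \<open>p\<close>, the map sending \<open>I\<close> to its part of
  degree \<open>r\<close> is a closed embedding of the Hilbert scheme into the Grassmannian of subspaces of
  codimension \<open>p(r)\<close> in the space of forms of degree \<open>r\<close>.  The Zariski topology is therefore the one
  induced by the Pluecker coordinates of the part of degree \<open>r\<close>: these are indexed by the sets \<open>S\<close>
  of monomials of degree \<open>r\<close> with as many elements as the subspace has dimensions, and the
  coordinate at \<open>S\<close> is the minor with columns \<open>S\<close> of the coefficient matrix of a basis \<open>ws\<close>.  Any
  fixed enumeration of \<open>S\<close> will do; the linear order used below is the library's order on finitely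
  supported functions and is unrelated to term orders.
\<close>

definition pluecker :: "nat \<Rightarrow> nat \<Rightarrow> 'a::comm_ring_1 mpol list \<Rightarrow> mon set \<Rightarrow> 'a" where
  "pluecker n r ws S =
     (if S \<subseteq> mons_deg n r \<and> card S = length ws
      then Determinant.det (mat (length ws) (length ws)
             (\<lambda>(i, j). Poly_Mapping.lookup (ws ! i) (sorted_list_of_set S ! j)))
      else 0)"

definition eval_poly :: "(('v \<Rightarrow>\<^sub>0 nat) \<Rightarrow>\<^sub>0 'a::comm_ring_1) \<Rightarrow> ('v \<Rightarrow> 'a) \<Rightarrow> 'a" where
  "eval_poly G v = (\<Sum>m\<in>Poly_Mapping.keys G. Poly_Mapping.lookup G m *
     (\<Prod>s\<in>Poly_Mapping.keys m. v s ^ Poly_Mapping.lookup m s))"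

text \<open>The points at which the form \<open>G\<close> does not vanish.  Another basis changes all Pluecker
  coordinates by a common nonzero factor, so for homogeneous \<open>G\<close> the choice of \<open>ws\<close> is immaterial.\<close>

definition hilb_nonvanishing ::
  "nat \<Rightarrow> rat poly \<Rightarrow> nat \<Rightarrow> ((mon set \<Rightarrow>\<^sub>0 nat) \<Rightarrow>\<^sub>0 'a::field) \<Rightarrow> 'a mpol set set" where
  "hilb_nonvanishing n p r G = {I \<in> Hilb n p. \<exists>ws. distinct ws \<and>
     basis_mod (deg_part I r) {0} (set ws) \<and> eval_poly G (pluecker n r ws) \<noteq> 0}"

definition hilb_topology :: "nat \<Rightarrow> rat poly \<Rightarrow> nat \<Rightarrow> 'a::field mpol set topology" where
  "hilb_topology n p r =
     topology_generated_by {hilb_nonvanishing n p r G | G. \<exists>d. homog_of_deg d G}"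

end

theory Submission
  imports Defs
begin

text \<open>
  Let \<open>A\<close> and \<open>A'\<close> be the sets of monomials in the saturations of \<open>J\<close> and \<open>J'\<close>.  Compositions of
  elementary moves are translations of exponent vectors, so Borel adjacency says that in degree \<open>r\<close>
  the set \<open>A' - A\<close> is the translate of \<open>A - A'\<close> by \<open>a' - a\<close>; write \<open>v'\<close> for the translate of \<open>v\<close>.
  For a scalar \<open>y\<close> let \<open>I\<^sub>y\<close> be spanned by the monomials of degree at least \<open>r\<close> in \<open>A \<inter> A'\<close> and the
  binomials \<open>v + y v'\<close> with \<open>v \<in> A - A'\<close> in these degrees.  Then \<open>I\<^sub>0 = J\<close>, and \<open>I\<^sub>y\<close> tends to \<open>J'\<close> as \<open>y\<close> tends to infinity.  A
  term order is invariant under translation, so \<open>v\<close> is always the leading term of \<open>v + y v'\<close>, and the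
  obvious generators of \<open>I\<^sub>y\<close> in degree \<open>r\<close> are a marked set.  It remains to see that every \<open>I\<^sub>y\<close> is a
  point of the stratum and that the limit exists in the Zariski topology.

  The crucial point for the first is that the translation maps \<open>A - A'\<close> onto \<open>A' - A\<close> in \<^emph>\<open>all\<close> degrees
  at least \<open>r\<close> (\<open>translate_all_degrees\<close>); given this, \<open>I\<^sub>y\<close> is visibly an ideal and the monomials
  outside \<open>A\<close> form a basis of each graded piece of the quotient.  A monomial of degree greater than \<open>r\<close>
  lies in \<open>A\<close> if and only if it does so after division by its least variable, so the extension to
  higher degrees is immediate once the translation preserves least variables
  (\<open>Min_keys_translate\<close>).  It cannot raise some of them and lower others, because the smallest index
  where \<open>a\<close> and \<open>a'\<close> differ decides the direction; and a change in one direction would make the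
  Hilbert functions of \<open>J\<close> and \<open>J'\<close> differ in all large degrees.

  This uses that \<open>J\<close> and \<open>J'\<close> are generated in degree \<open>r\<close>, which is Gotzmann's regularity theorem.  For
  strongly stable ideals it has a combinatorial proof by induction on the number of variables
  (\<open>gotzmann_regularity\<close>); it produces a Gotzmann representation of the Hilbert polynomial with the
  required bound on the degrees of generators, and such representations are unique
  (\<open>gotz_sum_inj\<close>).

  For the limit, put \<open>s = 1 / y\<close>.  The part of degree \<open>r\<close> of \<open>I\<^sub>y\<close> has a basis that is polynomial in \<open>s\<close>
  and specialises at \<open>s = 0\<close> to the monomials of \<open>J'\<close>.  A form in the Pluecker coordinates that does not
  vanish at \<open>J'\<close> therefore vanishes for finitely many \<open>s\<close> only, and every neighbourhood of \<open>J'\<close> contains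
  some \<open>I\<^sub>y\<close> (\<open>pencil_cofinite\<close>).
\<close>

section \<open>Monomials\<close>

abbreviation var :: "nat \<Rightarrow> mon" where
  "var i \<equiv> Poly_Mapping.single i 1"

lemma keys_add_mon: "Poly_Mapping.keys (a + b :: mon) = Poly_Mapping.keys a \<union> Poly_Mapping.keys b"
  by (auto simp: in_keys_iff lookup_add)

lemma mdeg_eq_sum:
  fixes a :: mon
  assumes "finite S" "Poly_Mapping.keys a \<subseteq> S"
  shows "mdeg a = sum (Poly_Mapping.lookup a) S"
  unfolding mdeg_def using assms by (intro sum.mono_neutral_left) (auto simp: in_keys_iff)

lemma mdeg_add [simp]: "mdeg (a + b :: mon) = mdeg a + mdeg b"
proof -
  let ?S = "Poly_Mapping.keys a \<union> Poly_Mapping.keys b"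
  have "mdeg (a + b) = sum (Poly_Mapping.lookup (a + b)) ?S"
    by (rule mdeg_eq_sum) (auto simp: keys_add_mon)
  also have "\<dots> = sum (Poly_Mapping.lookup a) ?S + sum (Poly_Mapping.lookup b) ?S"
    by (simp add: lookup_add sum.distrib)
  also have "\<dots> = mdeg a + mdeg b"
    by (simp add: mdeg_eq_sum[of ?S a] mdeg_eq_sum[of ?S b])
  finally show ?thesis .
qed

lemma mdeg_single [simp]: "mdeg (Poly_Mapping.single i k :: mon) = k"
  by (cases "k = 0") (simp_all add: mdeg_def)

lemma mdeg_0_iff [simp]: "mdeg (a :: mon) = 0 \<longleftrightarrow> a = 0"
  unfolding mdeg_def by (auto simp: in_keys_iff intro!: poly_mapping_eqI)

lemma mdeg_zero [simp]: "mdeg (0 :: mon) = 0"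
  by simp

lemma mon_split_var:
  fixes a :: mon
  assumes "i \<in> Poly_Mapping.keys a"
  obtains b where "a = b + var i"
proof -
  have "a = (a - var i) + var i"
    using assms by (intro poly_mapping_eqI) (auto simp: lookup_add lookup_minus lookup_single when_def in_keys_iff)
  then show ?thesis by (rule that)
qed

lemma mon_nonzero_obtains_var:
  fixes a :: mon
  assumes "a \<noteq> 0"
  obtains i where "i \<in> Poly_Mapping.keys a"
  using assms by fastforce

lemma single_Suc_mon: "(Poly_Mapping.single i (Suc j) :: mon) = Poly_Mapping.single i j + var i"
  by (simp flip: single_add)

text \<open>Strongly stable ideals are studied by induction on the number of variables, the smallest
  variable being removed at each step; hence monomials in the variables \<open>x\<^sub>k, \<dots>, x\<^sub>n\<close>.\<close>

definition mons_from :: "nat \<Rightarrow> nat \<Rightarrow> mon set" where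
  "mons_from k n = {a. Poly_Mapping.keys a \<subseteq> {k..n}}"

lemma mons_from_0: "mons_from 0 n = mons n"
  by (simp add: mons_from_def mons_def atLeast0AtMost)

lemma mons_from_add [simp]: "a + b \<in> mons_from k n \<longleftrightarrow> a \<in> mons_from k n \<and> b \<in> mons_from k n"
  by (auto simp: mons_from_def keys_add_mon)

lemma mons_from_zero [simp]: "0 \<in> mons_from k n"
  by (simp add: mons_from_def)

lemma mons_from_single [simp]:
  "k \<le> i \<Longrightarrow> i \<le> n \<Longrightarrow> Poly_Mapping.single i j \<in> mons_from k n"
  by (cases "j = 0") (auto simp: mons_from_def)

lemma mons_from_Suc_subset: "mons_from (Suc k) n \<subseteq> mons_from k n"
  by (auto simp: mons_from_def)

lemma finite_mons_from_mdeg: "finite {a \<in> mons_from k n. mdeg a = t}"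
proof -
  have "{a \<in> mons_from k n. mdeg a = t}
      \<subseteq> Poly_Mapping.Abs_poly_mapping ` {f. f ` {k..n} \<subseteq> {..t} \<and> (\<forall>x. x \<notin> {k..n} \<longrightarrow> f x = 0)}"
  proof
    fix a assume a: "a \<in> {a \<in> mons_from k n. mdeg a = t}"
    have "Poly_Mapping.lookup a i \<le> t" for i
    proof (cases "i \<in> Poly_Mapping.keys a")
      case True
      then show ?thesis using a member_le_sum[of i "Poly_Mapping.keys a" "Poly_Mapping.lookup a"]
        by (auto simp: mdeg_def)
    next
      case False
      then show ?thesis by (simp add: in_keys_iff)
    qed
    moreover have "Poly_Mapping.lookup a x = 0" if "x \<notin> {k..n}" for x
      using a that by (auto simp: mons_from_def in_keys_iff)
    ultimately show "a \<in> Poly_Mapping.Abs_poly_mapping ` {f. f ` {k..n} \<subseteq> {..t} \<and> (\<forall>x. x \<notin> {k..n} \<longrightarrow> f x = 0)}"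
      by (intro image_eqI[of _ _ "Poly_Mapping.lookup a"]) auto
  qed
  moreover have "finite {f. f ` {k..n} \<subseteq> {..t} \<and> (\<forall>x::nat. x \<notin> {k..n} \<longrightarrow> f x = (0::nat))}"
    by (rule finite_subset[OF _ finite_set_of_finite_funs[of "{k..n}" "{..t}" 0]])
      (auto simp: image_subset_iff)
  ultimately show ?thesis by (meson finite_imageI finite_subset)
qed

lemma finite_mons_deg: "finite (mons_deg n t)"
  using finite_mons_from_mdeg[of 0 n t] by (simp add: mons_deg_def mons_from_0)

section \<open>Gotzmann representations\<close>

text \<open>The sum of the binomial coefficients \<open>C(t - i + b\<^sub>i, b\<^sub>i)\<close> that occurs in the definition of the Gotzmann
  number, with the summands numbered from \<open>0\<close>.  Omitting those with \<open>i > t\<close> leaves the value for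
  large \<open>t\<close> unchanged, and it makes the step from \<open>bs\<close> to \<open>map Suc bs\<close> summation over \<open>t\<close> without an
  error term.\<close>

definition gotz_sum :: "nat list \<Rightarrow> nat \<Rightarrow> nat" where
  "gotz_sum bs t = (\<Sum>i | i < length bs \<and> i \<le> t. (t - i + bs ! i) choose (bs ! i))"

lemma gotz_sum_eq:
  "gotz_sum bs t = (\<Sum>i<length bs. if i \<le> t then (t - i + bs ! i) choose (bs ! i) else 0)"
  unfolding gotz_sum_def by (subst sum.inter_filter[symmetric]) (auto intro!: sum.cong)

lemma gotz_sum_all: "length bs \<le> Suc t \<Longrightarrow>
  gotz_sum bs t = (\<Sum>i<length bs. (t - i + bs ! i) choose (bs ! i))"
  unfolding gotz_sum_eq by (intro sum.cong) auto

lemma gotz_sum_map_Suc_0: "gotz_sum (map Suc bs) 0 = gotz_sum bs 0"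
  unfolding gotz_sum_eq by (auto intro!: sum.cong)

lemma gotz_sum_map_Suc_Suc:
  "gotz_sum (map Suc bs) (Suc t) = gotz_sum (map Suc bs) t + gotz_sum bs (Suc t)"
proof -
  have "(if i \<le> Suc t then (Suc t - i + Suc b) choose Suc b else 0) =
        (if i \<le> t then (t - i + Suc b) choose Suc b else 0) +
        (if i \<le> Suc t then (Suc t - i + b) choose b else 0)" for i b
    by (cases "i = Suc t") (auto simp: Suc_diff_le)
  note pascal = this
  show ?thesis
    unfolding gotz_sum_eq sum.distrib[symmetric] length_map
    by (rule sum.cong[OF refl]) (simp only: lessThan_iff nth_map pascal)
qed

lemma gotz_sum_append_zeros:
  "gotz_sum (bs @ replicate D 0) t = gotz_sum bs t + min D (Suc t - length bs)"
proof (induction D)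
  case 0
  show ?case by simp
next
  case (Suc D)
  have "gotz_sum (xs @ [0]) t = gotz_sum xs t + (if length xs \<le> t then 1 else 0)" for xs
    unfolding gotz_sum_eq by (auto simp: nth_append intro!: sum.cong)
  from this[of "bs @ replicate D 0"] Suc show ?case
    by (auto simp: replicate_append_same[symmetric] min_def)
qed

text \<open>Even if all entries are \<open>c - 1\<close>, the sum is only an initial segment of
  \<open>\<Sum>\<^bsub>i \<le> t\<^esub> C(t - i + c - 1, c - 1) = C(t + c, c)\<close>.  Hence a smaller entry cannot be compensated by the
  entries after it, which gives the uniqueness of representations.\<close>

lemma gotz_sum_less_of_hd_less:
  assumes "\<forall>b\<in>set bs. b < c" "length bs \<le> t"
  shows "gotz_sum bs t < (t + c) choose c"
proof (cases c)
  case 0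
  then show ?thesis using assms by (cases bs) (auto simp: gotz_sum_def)
next
  case (Suc d)
  have mono: "(m + b) choose b \<le> (m + d) choose d" if "b \<le> d" for m b
  proof -
    have "(m + b) choose b = (m + b) choose m" "(m + d) choose d = (m + d) choose m"
      using binomial_symmetric[of b "m + b"] binomial_symmetric[of d "m + d"] by simp_all
    then show ?thesis using that by (simp add: binomial_right_mono)
  qed
  have "gotz_sum bs t = (\<Sum>i<length bs. (t - i + bs ! i) choose (bs ! i))"
    using assms by (intro gotz_sum_all) auto
  also have "\<dots> \<le> (\<Sum>i<length bs. (t - i + d) choose d)"
    using assms Suc by (intro sum_mono mono) (auto simp: less_Suc_eq_le)
  also have "\<dots> < (\<Sum>i\<le>t. (t - i + d) choose d)"
    using assms by (intro sum_strict_mono2[where b = t]) (auto)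
  also have "\<dots> = (\<Sum>i\<le>t. (i + d) choose d)"
    by (rule sum.reindex_bij_witness[of _ "\<lambda>i. t - i" "\<lambda>i. t - i"]) auto
  also have "\<dots> = (t + c) choose c"
    unfolding Suc by (induction t) auto
  finally show ?thesis .
qed

lemma gotz_sum_Cons:
  "gotz_sum (b # bs) (Suc t) = (Suc t + b choose b) + gotz_sum bs t"
  unfolding gotz_sum_eq length_Cons sum.lessThan_Suc_shift by (auto intro!: sum.cong)

lemma gotz_sum_inj:
  assumes "sorted_wrt (\<ge>) as" "sorted_wrt (\<ge>) bs" "length as \<le> t" "length bs \<le> t"
    and "gotz_sum as t = gotz_sum bs t"
  shows "as = bs"
  using assms
proof (induction as arbitrary: bs t)
  case Nil
  have pos: "gotz_sum (b # cs) t > 0" for b cs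
    unfolding gotz_sum_eq length_Cons sum.lessThan_Suc_shift by simp
  show ?case using Nil pos by (cases bs) (auto simp: gotz_sum_def)
next
  case (Cons a as)
  then obtain s where t: "t = Suc s" by (cases t) auto
  show ?case
  proof (cases bs)
    case Nil
    then show ?thesis using Cons.prems unfolding t gotz_sum_Cons by (simp add: gotz_sum_def)
  next
    case (Cons b bs')
    have ineq: "gotz_sum (c # cs) t < gotz_sum (d # ds) t"
      if "c < d" "sorted_wrt (\<ge>) (c # cs)" "length (c # cs) \<le> t" for c d cs ds
    proof -
      have "gotz_sum (c # cs) t < (t + d) choose d"
        using that by (intro gotz_sum_less_of_hd_less) auto
      also have "\<dots> \<le> gotz_sum (d # ds) t"
        by (simp add: t gotz_sum_Cons)
      finally show ?thesis .
    qed
    have "a = b"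
      using ineq[of a b as bs'] ineq[of b a bs' as] Cons.prems(1-5) unfolding Cons
      by (metis linorder_neqE_nat order_less_irrefl)
    then show ?thesis
      using Cons.IH[of bs' s] Cons.prems unfolding Cons t gotz_sum_Cons by simp
  qed
qed

text \<open>From \<open>s\<close> on the sequence has no gaps: once it vanishes, it stays zero.  Its partial sums
  therefore grow at least by one per step until the total is reached.  This will control how the
  monomials that a section lacks to be saturated are distributed over the degrees.\<close>

lemma partial_sums_reach_total:
  fixes d :: "nat \<Rightarrow> nat"
  assumes down: "\<And>j. s \<le> j \<Longrightarrow> 0 < d (Suc j) \<Longrightarrow> 0 < d j"
    and zero: "\<And>j. N < j \<Longrightarrow> d j = 0"
  shows "min (sum d {..N}) (Suc t - s) \<le> sum d {..t}"
    and "s + sum d {..N} \<le> Suc t \<Longrightarrow> sum d {..t} = sum d {..N}"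
    and "s + sum d {..N} \<le> t \<Longrightarrow> d t = 0"
proof -
  have run: "0 < d i" if "s \<le> i" "i \<le> j" "0 < d j" for i j
    using that(2,1,3)
  proof (induction rule: inc_induct)
    case (step m)
    then have "0 < d (Suc m)" by simp
    then show ?case by (rule down[OF step.prems(1)])
  qed
  have block: "Suc j - s \<le> sum d {..j}" if "0 < d j" for j
  proof -
    have "Suc j - s = (\<Sum>i\<in>{s..j}. 1)" by simp
    also have "\<dots> \<le> (\<Sum>i\<in>{s..j}. d i)"
      using run[OF _ _ that] by (intro sum_mono) (auto simp: Suc_le_eq)
    also have "\<dots> \<le> sum d {..j}" by (intro sum_mono2) auto
    finally show ?thesis .
  qed
  have total: "sum d {..j} \<le> sum d {..N}" for j
  proof -
    have "sum d {..j} = sum d ({..j} \<inter> {..N})"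
      by (intro sum.mono_neutral_right) (use zero in force)+
    also have "\<dots> \<le> sum d {..N}" by (intro sum_mono2) auto
    finally show ?thesis .
  qed
  have main: "sum d {..t} = sum d {..N} \<or> Suc t - s \<le> sum d {..t}" for t
  proof (cases "\<exists>j>t. 0 < d j")
    case True
    then obtain j where j: "t < j" "0 < d j" by auto
    show ?thesis
    proof (cases "s \<le> t")
      case True
      then show ?thesis using run[of t j] j block[of t] by simp
    qed simp
  next
    case False
    have "sum d {..N} = sum d ({..t} \<inter> {..N})"
      by (intro sum.mono_neutral_right) (use False in force)+
    also have "\<dots> \<le> sum d {..t}" by (intro sum_mono2) auto
    finally show ?thesis using total[of t] by simp
  qed
  show "min (sum d {..N}) (Suc t - s) \<le> sum d {..t}"
    using main[of t] by auto
  show "sum d {..t} = sum d {..N}" if "s + sum d {..N} \<le> Suc t"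
    using main[of t] total[of t] that by auto
  show "d t = 0" if "s + sum d {..N} \<le> t"
    using block[of t] total[of t] that by (cases "d t = 0") auto
qed

section \<open>Regularity of saturated strongly stable sets\<close>

text \<open>The exponent sets of the strongly stable ideals in the variables \<open>x\<^sub>k, \<dots>, x\<^sub>n\<close>.\<close>

definition borel_set :: "nat \<Rightarrow> nat \<Rightarrow> mon set \<Rightarrow> bool" where
  "borel_set k n A \<longleftrightarrow> A \<subseteq> mons_from k n \<and>
     (\<forall>a\<in>A. \<forall>i\<in>{k..n}. a + var i \<in> A) \<and>
     (\<forall>a i. k \<le> i \<and> i < n \<and> a + var i \<in> A \<longrightarrow> a + var (Suc i) \<in> A)"

definition hilb_fun :: "nat \<Rightarrow> nat \<Rightarrow> mon set \<Rightarrow> nat \<Rightarrow> nat" where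
  "hilb_fun k n A t = card {a \<in> mons_from k n. mdeg a = t \<and> a \<notin> A}"

text \<open>For an up-closed \<open>A\<close> this says that minimal generators have degree at most \<open>s\<close>.\<close>

definition generated_upto :: "nat \<Rightarrow> nat \<Rightarrow> mon set \<Rightarrow> nat \<Rightarrow> bool" where
  "generated_upto k n A s \<longleftrightarrow>
     (\<forall>a\<in>A. s < mdeg a \<longrightarrow> (\<exists>b\<in>A. \<exists>i\<in>{k..n}. a = b + var i))"

lemma borel_set_exchange:
  assumes "borel_set k n A" "a + var i \<in> A" "k \<le> i" "i \<le> j" "j \<le> n"
  shows "a + var j \<in> A"
  using assms(4,5)
proof (induction rule: dec_induct)
  case base
  show ?case by fact
next
  case (step m)
  then show ?case using assms(1,3) by (auto simp: borel_set_def)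
qed

lemma mon_induct_var [consumes 1, case_names zero add]:
  assumes "u \<in> mons_from k n" "P 0"
    and "\<And>u i. u \<in> mons_from k n \<Longrightarrow> k \<le> i \<Longrightarrow> i \<le> n \<Longrightarrow> P u \<Longrightarrow> P (u + var i)"
  shows "P u"
  using assms(1)
proof (induction "mdeg u" arbitrary: u)
  case 0
  then show ?case using assms(2) by simp
next
  case (Suc m)
  then have "u \<noteq> 0" by auto
  then obtain i where i: "i \<in> Poly_Mapping.keys u" by (rule mon_nonzero_obtains_var)
  then obtain v where v: "u = v + var i" by (rule mon_split_var)
  have "i \<in> {k..n}" using i Suc.prems by (auto simp: mons_from_def)
  then show ?case using Suc v assms(3)[of v i] by auto
qed

lemma borel_set_add:
  assumes "borel_set k n A" "a \<in> A" "u \<in> mons_from k n"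
  shows "a + u \<in> A"
  using assms(3)
proof (induction rule: mon_induct_var)
  case zero
  show ?case using assms by simp
next
  case (add u i)
  have "(a + u) + var i \<in> A" using assms(1) add by (auto simp: borel_set_def)
  then show ?case by (simp add: add.assoc)
qed

text \<open>As \<open>x\<^sub>k\<close> is the least variable, its powers test saturation: if \<open>a\<close> times a power of \<open>x\<^sub>k\<close> is in the
  set, so is \<open>a\<close> times every other monomial of that degree.\<close>

lemma borel_set_replace_least:
  assumes A: "borel_set k n A" and "u \<in> mons_from k n"
  shows "a + Poly_Mapping.single k (mdeg u) \<in> A \<Longrightarrow> a + u \<in> A"
  using assms(2)
proof (induction arbitrary: a rule: mon_induct_var)
  case zero
  then show ?case by simp
next
  case (add u i)
  have "(a + var k) + Poly_Mapping.single k (mdeg u) \<in> A"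
    using add.prems by (simp add: single_Suc_mon[of k "mdeg u"] add_ac)
  then have "(a + u) + var k \<in> A" using add.IH[of "a + var k"] by (simp add: add_ac)
  then show ?case using borel_set_exchange[OF A, of "a + u" k i] add.hyps by (simp add: add_ac)
qed

lemma generated_upto_obtains:
  assumes "generated_upto k n A s" "A \<subseteq> mons_from k n" "a \<in> A" "s \<le> mdeg a"
  obtains b u where "b \<in> A" "mdeg b = s" "u \<in> mons_from k n" "a = b + u"
proof -
  have "\<exists>b u. b \<in> A \<and> mdeg b = s \<and> u \<in> mons_from k n \<and> a = b + u"
    using assms(3,4)
  proof (induction "mdeg a - s" arbitrary: a)
    case 0
    then show ?case by (intro exI[of _ a] exI[of _ 0]) auto
  next
    case (Suc m)
    then obtain c i where c: "c \<in> A" "i \<in> {k..n}" "a = c + var i"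
      using assms(1) unfolding generated_upto_def by (metis zero_less_Suc zero_less_diff)
    then have "m = mdeg c - s" "s \<le> mdeg c" using Suc.hyps(2) by simp_all
    then obtain b u where "b \<in> A" "mdeg b = s" "u \<in> mons_from k n" "c = b + u"
      using Suc.hyps(1) c by blast
    then show ?case using c by (intro exI[of _ b] exI[of _ "u + var i"]) (auto simp: add_ac)
  qed
  then show ?thesis using that by blast
qed

text \<open>A saturated set is a cone in the direction of \<open>x\<^sub>k\<close>, so its Hilbert function is summed up from
  that of its section without \<open>x\<^sub>k\<close>.\<close>

lemma hilb_fun_section:
  assumes A: "borel_set k n A" and sat: "\<And>a. a + var k \<in> A \<Longrightarrow> a \<in> A" and k: "k \<le> n"
  shows "hilb_fun k n A 0 = hilb_fun (Suc k) n (A \<inter> mons_from (Suc k) n) 0"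
    and "hilb_fun k n A (Suc t) = hilb_fun k n A t + hilb_fun (Suc k) n (A \<inter> mons_from (Suc k) n) (Suc t)"
proof -
  let ?A1 = "A \<inter> mons_from (Suc k) n"
  show "hilb_fun k n A 0 = hilb_fun (Suc k) n ?A1 0"
    unfolding hilb_fun_def by (rule arg_cong[of _ _ card]) auto
  let ?X = "{a \<in> mons_from k n. mdeg a = t \<and> a \<notin> A}"
  let ?Y = "{a \<in> mons_from (Suc k) n. mdeg a = Suc t \<and> a \<notin> ?A1}"
  have eq: "{a \<in> mons_from k n. mdeg a = Suc t \<and> a \<notin> A} = (\<lambda>a. a + var k) ` ?X \<union> ?Y" (is "?Z = _")
  proof (intro equalityI subsetI)
    fix a assume a: "a \<in> ?Z"
    show "a \<in> (\<lambda>a. a + var k) ` ?X \<union> ?Y"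
    proof (cases "k \<in> Poly_Mapping.keys a")
      case True
      then obtain b where b: "a = b + var k" by (rule mon_split_var)
      have "b \<in> ?X" using a b A k by (auto simp: borel_set_def)
      then show ?thesis using b by blast
    next
      case False
      then have "a \<in> mons_from (Suc k) n"
        using a by (auto simp: mons_from_def subset_iff) (metis Suc_leI nat_less_le)
      then show ?thesis using a by auto
    qed
  next
    fix a assume "a \<in> (\<lambda>a. a + var k) ` ?X \<union> ?Y"
    then show "a \<in> ?Z"
      using sat k mons_from_Suc_subset[of k n] by auto
  qed
  have "finite ?X"
    by (rule finite_subset[OF _ finite_mons_from_mdeg[of k n t]]) auto
  moreover have "finite ?Y"
    by (rule finite_subset[OF _ finite_mons_from_mdeg[of "Suc k" n "Suc t"]]) auto
  moreover have "(\<lambda>a. a + var k) ` ?X \<inter> ?Y = {}"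
    by (auto simp: mons_from_def keys_add_mon)
  ultimately have "card ?Z = card ((\<lambda>a. a + var k) ` ?X) + card ?Y"
    unfolding eq by (intro card_Un_disjoint) auto
  also have "card ((\<lambda>a. a + var k) ` ?X) = card ?X"
    by (intro card_image inj_onI) simp
  finally show "hilb_fun k n A (Suc t) = hilb_fun k n A t + hilb_fun (Suc k) n ?A1 (Suc t)"
    by (simp add: hilb_fun_def)
qed

text \<open>Let \<open>A1\<close> be the section of \<open>A\<close> without \<open>x\<^sub>k\<close> and \<open>A2\<close> its saturation, to which the induction hypothesis
  applies with a list \<open>bs\<close> of length \<open>s\<close>.  By \<open>hilb_fun_section\<close> the Hilbert function of \<open>A\<close> is obtained by
  summation from that of \<open>A1\<close>, so it exceeds \<open>gotz_sum (map Suc bs)\<close> by the partial sums of a sequence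
  \<open>d\<close>: the excess of the Hilbert function of \<open>A2\<close> over \<open>gotz_sum bs\<close> plus the number of monomials in
  \<open>A2 - A1\<close>.  Its total \<open>D\<close> is finite, and \<open>D\<close> zeros have to be appended to \<open>map Suc bs\<close>.  As \<open>A2\<close> is
  generated up to degree \<open>s\<close>, an element of \<open>A2 - A1\<close> has divisors in \<open>A2 - A1\<close> in all degrees down to \<open>s\<close>.
  So \<open>A2 - A1\<close>, having at most \<open>D\<close> elements in these degrees, ends before degree \<open>s + D\<close>, and from there
  on \<open>A1\<close> needs no generators either.  The inequality in all degrees is what keeps \<open>d\<close> nonnegative in the
  next step.\<close>

lemma gotzmann_regularity:
  assumes "k \<le> n" "borel_set k n A" "\<And>a. a + var k \<in> A \<Longrightarrow> a \<in> A"
  shows "\<exists>bs. sorted_wrt (\<ge>) bs \<and> (\<forall>t. gotz_sum bs t \<le> hilb_fun k n A t) \<and>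
    (\<forall>t. length bs \<le> Suc t \<longrightarrow> hilb_fun k n A t = gotz_sum bs t) \<and>
    generated_upto k n A (length bs)"
  using assms
proof (induction k arbitrary: A rule: inc_induct)
  case base
  have single: "a = Poly_Mapping.single n (mdeg a)" if "a \<in> mons_from n n" for a :: mon
    using that
  proof (induction rule: mon_induct_var)
    case (add u i)
    then have "i = n" by simp
    with add show ?case by (metis mdeg_add mdeg_single single_add)
  qed simp
  have all: "a \<in> A" if "b \<in> A" "a \<in> mons_from n n" for a b
  proof -
    have "Poly_Mapping.single n j \<in> A \<Longrightarrow> 0 \<in> A" for j
    proof (induction j)
      case (Suc j)
      then show ?case using base(2)[of "Poly_Mapping.single n j"] unfolding single_Suc_mon[of n j] by blast
    qed simp
    then have "0 \<in> A" using that(1) single[of b] base(1) by (metis borel_set_def subsetD)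
    then show ?thesis using borel_set_add[OF base(1), of 0 a] that by simp
  qed
  show ?case
  proof (cases "A = {}")
    case True
    have "{a \<in> mons_from n n. mdeg a = t \<and> a \<notin> A} = {Poly_Mapping.single n t}" for t
      using single True by auto
    then have "hilb_fun n n A t = 1" for t by (simp add: hilb_fun_def)
    then show ?thesis using True
      by (intro exI[of _ "[0]"]) (auto simp: gotz_sum_eq generated_upto_def)
  next
    case False
    then have A: "A = mons_from n n" using all base(1) by (auto simp: borel_set_def)
    have "\<exists>b\<in>A. a = b + var n" if a: "a \<in> A" "0 < mdeg a" for a
    proof -
      have "a \<noteq> 0" using a by auto
      then obtain i where i: "i \<in> Poly_Mapping.keys a" by (rule mon_nonzero_obtains_var)
      then have "i = n" using a A by (auto simp: mons_from_def)
      with i obtain b where "a = b + var n" using mon_split_var by metis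
      then show ?thesis using a A by auto
    qed
    moreover have "{a \<in> mons_from n n. mdeg a = t \<and> a \<notin> A} = {}" for t using A by auto
    then have "hilb_fun n n A t = 0" for t unfolding hilb_fun_def by (metis card.empty)
    ultimately show ?thesis
      by (intro exI[of _ "[]"]) (auto simp: gotz_sum_eq generated_upto_def)
  qed
next
  case (step k)
  have kn: "k < n" using step.hyps by simp
  define A1 where "A1 = A \<inter> mons_from (Suc k) n"
  \<comment> \<open>saturation with respect to \<open>x\<^bsub>k+1\<^esub>\<close>, the least variable of the section\<close>
  define A2 where "A2 = {a \<in> mons_from (Suc k) n. \<exists>j. a + Poly_Mapping.single (Suc k) j \<in> A1}"
  have A1: "borel_set (Suc k) n A1"
    using step.prems(1) unfolding A1_def borel_set_def by auto
  have A12: "A1 \<subseteq> A2"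
    unfolding A2_def by (auto simp: A1_def intro!: exI[of _ 0])
  have A2: "borel_set (Suc k) n A2"
    unfolding borel_set_def
  proof (intro conjI ballI allI impI)
    show "A2 \<subseteq> mons_from (Suc k) n" by (auto simp: A2_def)
  next
    fix a i assume "a \<in> A2" and i: "i \<in> {Suc k..n}"
    then obtain j where j: "a + Poly_Mapping.single (Suc k) j \<in> A1" "a \<in> mons_from (Suc k) n"
      by (auto simp: A2_def)
    then have "a + Poly_Mapping.single (Suc k) j + var i \<in> A1"
      using A1 i unfolding borel_set_def by blast
    with j show "a + var i \<in> A2" using \<open>i \<in> _\<close> by (auto simp: A2_def add_ac intro!: exI[of _ j])
  next
    fix a i assume i: "Suc k \<le> i \<and> i < n \<and> a + var i \<in> A2"
    then obtain j where "a + Poly_Mapping.single (Suc k) j + var i \<in> A1" "a \<in> mons_from (Suc k) n"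
      by (auto simp: A2_def add_ac)
    then have "a + Poly_Mapping.single (Suc k) j + var (Suc i) \<in> A1" using i A1 by (auto simp: borel_set_def)
    then show "a + var (Suc i) \<in> A2" using i \<open>a \<in> _\<close> by (auto simp: A2_def add_ac intro!: exI[of _ j])
  qed
  have A2_sat: "a \<in> A2" if "a + var (Suc k) \<in> A2" for a
    using that by (auto simp: A2_def add.assoc simp flip: single_add)
  from step.IH[OF A2 A2_sat] obtain bs where bs: "sorted_wrt (\<ge>) bs"
    and low: "\<And>t. gotz_sum bs t \<le> hilb_fun (Suc k) n A2 t"
    and eq: "\<And>t. length bs \<le> Suc t \<Longrightarrow> hilb_fun (Suc k) n A2 t = gotz_sum bs t"
    and gen: "generated_upto (Suc k) n A2 (length bs)"
    by blast
  define s where "s = length bs"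
  define c where "c t = card {a \<in> A2 - A1. mdeg a = t}" for t
  define d where "d t = (hilb_fun (Suc k) n A2 t - gotz_sum bs t) + c t" for t
  have fin: "finite {a \<in> A2 - A1. mdeg a = t}" for t
    by (rule finite_subset[OF _ finite_mons_from_mdeg[of "Suc k" n t]]) (auto simp: A2_def)
  have hf1: "hilb_fun (Suc k) n A1 t = gotz_sum bs t + d t" for t
  proof -
    have fin': "finite {a \<in> mons_from (Suc k) n. mdeg a = t \<and> a \<notin> A2}"
      by (rule finite_subset[OF _ finite_mons_from_mdeg[of "Suc k" n t]]) auto
    have "{a \<in> mons_from (Suc k) n. mdeg a = t \<and> a \<notin> A1} =
      {a \<in> mons_from (Suc k) n. mdeg a = t \<and> a \<notin> A2} \<union> {a \<in> A2 - A1. mdeg a = t}"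
      using A12 by (auto simp: A2_def)
    then have "hilb_fun (Suc k) n A1 t = hilb_fun (Suc k) n A2 t + c t"
      unfolding hilb_fun_def c_def using fin[of t] fin' by (subst card_Un_disjoint[symmetric]) auto
    then show ?thesis using low[of t] by (simp add: d_def)
  qed
  have sat: "\<And>a. a + var k \<in> A \<Longrightarrow> a \<in> A" by (rule step.prems(2))
  have H: "hilb_fun k n A t = gotz_sum (map Suc bs) t + sum d {..t}" for t
  proof (induction t)
    case 0
    show ?case using hilb_fun_section(1)[OF step.prems(1) sat] kn hf1[of 0]
      by (simp add: A1_def gotz_sum_map_Suc_0)
  next
    case (Suc t)
    show ?case using hilb_fun_section(2)[OF step.prems(1) sat, of t] kn hf1[of "Suc t"] Suc
      by (simp add: A1_def gotz_sum_map_Suc_Suc)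
  qed
  have d_c: "d t = c t" if "s \<le> Suc t" for t
    using eq[of t] that by (simp add: d_def s_def)
  have down: "0 < d j" if "s \<le> j" "0 < d (Suc j)" for j
  proof -
    have "0 < c (Suc j)" using that d_c[of "Suc j"] by simp
    then obtain a where a: "a \<in> A2" "a \<notin> A1" "mdeg a = Suc j"
      unfolding c_def by (metis (mono_tags, lifting) DiffE card.empty empty_Collect_eq less_irrefl)
    have "length bs < mdeg a" using a(3) that(1) by (simp add: s_def)
    then obtain b i where b: "b \<in> A2" "i \<in> {Suc k..n}" "a = b + var i"
      using gen a(1) unfolding generated_upto_def by blast
    have "b \<notin> A1" using a(2) b(2,3) A1 unfolding borel_set_def by blast
    moreover have "mdeg b = j" using a(3) b(3) by simp
    ultimately have "b \<in> {a \<in> A2 - A1. mdeg a = j}" using b(1) by simp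
    then have "0 < c j" using fin unfolding c_def card_gt_0_iff by blast
    then show ?thesis using d_c[of j] that by simp
  qed
  \<comment> \<open>\<open>A2\<close> has finitely many generators, so one power of \<open>x\<^bsub>k+1\<^esub>\<close> brings all of them into \<open>A1\<close>, and
    \<open>A2 - A1\<close> is finite.\<close>
  have "\<exists>M. \<forall>b\<in>A2. mdeg b = s \<longrightarrow> b + Poly_Mapping.single (Suc k) M \<in> A1"
  proof -
    let ?G = "{b \<in> A2. mdeg b = s}"
    have "finite ?G"
      by (rule finite_subset[OF _ finite_mons_from_mdeg[of "Suc k" n s]]) (auto simp: A2_def)
    obtain j where j: "\<And>b. b \<in> A2 \<Longrightarrow> b + Poly_Mapping.single (Suc k) (j b) \<in> A1"
      unfolding A2_def by atomize_elim (intro choice, auto)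
    have "b + Poly_Mapping.single (Suc k) (sum j ?G) \<in> A1" if "b \<in> ?G" for b
    proof -
      have "j b \<le> sum j ?G" using \<open>finite ?G\<close> that by (intro member_le_sum) auto
      then have "b + Poly_Mapping.single (Suc k) (sum j ?G)
          = (b + Poly_Mapping.single (Suc k) (j b)) + Poly_Mapping.single (Suc k) (sum j ?G - j b)"
        by (simp add: add.assoc flip: single_add)
      then show ?thesis using borel_set_add[OF A1 j] that kn by simp
    qed
    then show ?thesis by blast
  qed
  then obtain M where M: "\<And>b. b \<in> A2 \<Longrightarrow> mdeg b = s \<Longrightarrow> b + Poly_Mapping.single (Suc k) M \<in> A1"
    by blast
  define N where "N = s + M"
  have zero: "d j = 0" if "N < j" for j
  proof -
    have "a \<in> A1" if a: "a \<in> A2" "mdeg a = j" for a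
    proof -
      obtain b u where b: "b \<in> A2" "mdeg b = s" "u \<in> mons_from (Suc k) n" "a = b + u"
      proof (rule generated_upto_obtains[OF gen _ a(1)])
        show "A2 \<subseteq> mons_from (Suc k) n" by (auto simp: A2_def)
        show "length bs \<le> mdeg a" using a \<open>N < j\<close> by (simp add: N_def s_def)
      qed (use that in \<open>auto simp: s_def\<close>)
      have "M \<le> mdeg u" using b a \<open>N < j\<close> by (simp add: N_def)
      then have "b + Poly_Mapping.single (Suc k) (mdeg u)
          = (b + Poly_Mapping.single (Suc k) M) + Poly_Mapping.single (Suc k) (mdeg u - M)"
        by (simp add: add.assoc flip: single_add)
      then have "b + Poly_Mapping.single (Suc k) (mdeg u) \<in> A1"
        using borel_set_add[OF A1 M] b kn by simp
      then show ?thesis using borel_set_replace_least[OF A1 b(3)] b(4) by simp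
    qed
    then have "{a \<in> A2 - A1. mdeg a = j} = {}" by auto
    then have "c j = 0" unfolding c_def by (metis card.empty)
    then show ?thesis using d_c[of j] that by (simp add: N_def)
  qed
  define D where "D = sum d {..N}"
  note reach = partial_sums_reach_total[of s d N, OF down zero, folded D_def]
  let ?cs = "map Suc bs @ replicate D 0"
  have G: "gotz_sum ?cs t = gotz_sum (map Suc bs) t + min D (Suc t - s)" for t
    by (simp add: gotz_sum_append_zeros s_def)
  have "sorted_wrt (\<ge>) (replicate D (0::nat))" by (induction D) auto
  then have "sorted_wrt (\<ge>) ?cs" using bs by (simp add: sorted_wrt_append sorted_wrt_map)
  moreover have "gotz_sum ?cs t \<le> hilb_fun k n A t" for t
    using reach(1)[of t] by (simp add: G H)
  moreover have "hilb_fun k n A t = gotz_sum ?cs t" if "length ?cs \<le> Suc t" for t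
    using reach(2)[of t] that by (simp add: G H s_def)
  moreover have "generated_upto k n A (length ?cs)"
    unfolding generated_upto_def
  proof (intro ballI impI)
    fix a assume a: "a \<in> A" "length ?cs < mdeg a"
    show "\<exists>b\<in>A. \<exists>i\<in>{k..n}. a = b + var i"
    proof (cases "k \<in> Poly_Mapping.keys a")
      case True
      then obtain b where "a = b + var k" by (rule mon_split_var)
      then show ?thesis using a sat kn by (intro bexI[of _ b] bexI[of _ k]) auto
    next
      case False
      then have "a \<in> mons_from (Suc k) n"
        using a step.prems(1) by (auto simp: mons_from_def borel_set_def subset_iff)
          (metis Suc_leI nat_less_le)
      then have "a \<in> A2" using a A12 by (auto simp: A1_def)
      then obtain b i where b: "b \<in> A2" "i \<in> {Suc k..n}" "a = b + var i"
        using gen a(2) unfolding generated_upto_def by fastforce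
      have "b \<in> A1"
      proof (rule ccontr)
        assume "b \<notin> A1"
        then have "0 < c (mdeg b)" using b fin[of "mdeg b"] unfolding c_def card_gt_0_iff by auto
        moreover have "s + D \<le> mdeg b" using a b by (simp add: s_def)
        ultimately show False using reach(3)[of "mdeg b"] d_c[of "mdeg b"] by simp
      qed
      then show ?thesis using b by (intro bexI[of _ b] bexI[of _ i]) (auto simp: A1_def)
    qed
  qed
  ultimately show ?case by blast
qed

section \<open>Two strongly stable sets that differ by a translation\<close>

lemma borel_set_keys:
  assumes "borel_set k n A" "a \<in> A" "i \<in> Poly_Mapping.keys a"
  shows "k \<le> i" "i \<le> n"
  using assms unfolding borel_set_def mons_from_def
  by (metis (no_types, lifting) atLeastAtMost_iff mem_Collect_eq subset_eq)+

text \<open>A variable \<open>x\<^sub>j\<close> whose removal keeps the monomial in \<open>A\<close> exists because of its degree.  Removing the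
  least variable instead amounts to replacing \<open>x\<^sub>i\<close> by the larger \<open>x\<^sub>j\<close> in the result, which strong
  stability allows.\<close>

lemma borel_set_remove_least:
  assumes A: "borel_set k n A" and gen: "generated_upto k n A r"
    and w: "w + var i \<in> A" "r \<le> mdeg w" "\<And>j. j \<in> Poly_Mapping.keys w \<Longrightarrow> i \<le> j"
  shows "w \<in> A"
proof -
  obtain b j where b: "b \<in> A" "j \<in> {k..n}" "w + var i = b + var j"
    using gen w(1,2) unfolding generated_upto_def by fastforce
  show ?thesis
  proof (cases "i = j")
    case True
    then show ?thesis using b by simp
  next
    case False
    have "Poly_Mapping.keys w \<union> {i} = Poly_Mapping.keys b \<union> {j}"
      using arg_cong[OF b(3), of Poly_Mapping.keys] by (simp add: keys_add_mon)
    then have keys: "i \<in> Poly_Mapping.keys b" "j \<in> Poly_Mapping.keys w" using False by auto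
    from keys(1) obtain c where c: "b = c + var i" by (rule mon_split_var)
    have "w + var i = (c + var j) + var i" using b(3) c by (simp add: add_ac)
    then have "w = c + var j" by (rule add_right_imp_eq)
    moreover have "k \<le> i" using borel_set_keys[OF A b(1) keys(1)] by simp
    ultimately show ?thesis using borel_set_exchange[OF A, of c i j] b c w(3)[OF keys(2)] by auto
  qed
qed

text \<open>What Borel adjacency says about the exponent sets \<open>A\<close> and \<open>A'\<close> of two saturated strongly stable
  ideals with the same Hilbert polynomial.  The conditions are symmetric in \<open>(A, a)\<close> and \<open>(A', a')\<close>,
  so each result below yields a second one by exchanging them.\<close>

locale borel_pair =
  fixes n r :: nat and A A' :: "mon set" and a a' :: mon
  assumes borel: "borel_set 0 n A" "borel_set 0 n A'"
    and sat: "\<And>b. b + var 0 \<in> A \<Longrightarrow> b \<in> A" "\<And>b. b + var 0 \<in> A' \<Longrightarrow> b \<in> A'"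
    and gen: "generated_upto 0 n A r" "generated_upto 0 n A' r"
    and hilb: "\<forall>\<^sub>F t in sequentially. hilb_fun 0 n A t = hilb_fun 0 n A' t"
    and mdeg_a: "mdeg a = r" "mdeg a' = r" and a_neq: "a \<noteq> a'"
    and translate: "\<And>g. g \<in> A - A' \<Longrightarrow> mdeg g = r \<Longrightarrow> \<exists>g'\<in>A' - A. g' + a = g + a'"
      "\<And>g'. g' \<in> A' - A \<Longrightarrow> mdeg g' = r \<Longrightarrow> \<exists>g\<in>A - A'. g + a' = g' + a"
begin

lemma swap: "borel_pair n r A' A a' a"
proof (rule borel_pair.intro)
  show "\<forall>\<^sub>F t in sequentially. hilb_fun 0 n A' t = hilb_fun 0 n A t"
    using hilb by (simp add: eq_commute)
qed (fact borel sat gen mdeg_a a_neq[symmetric] translate)+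

lemma r_pos: "0 < r"
  using mdeg_a a_neq by (metis gr0I mdeg_0_iff)

lemma keys_nonempty: "r \<le> mdeg v \<Longrightarrow> Poly_Mapping.keys (v :: mon) \<noteq> {}"
  using r_pos by auto

lemma mdeg_translate: "v' + a = v + a' \<Longrightarrow> mdeg v' = mdeg v"
  using mdeg_a by (metis add_right_cancel mdeg_add)

lemma split_least:
  assumes "r \<le> mdeg v"
  obtains w where "v = w + var (Min (Poly_Mapping.keys v))"
    "\<And>j. j \<in> Poly_Mapping.keys w \<Longrightarrow> Min (Poly_Mapping.keys v) \<le> j"
proof -
  have "Min (Poly_Mapping.keys v) \<in> Poly_Mapping.keys v"
    using keys_nonempty[OF assms] by (intro Min_in) auto
  then obtain w where w: "v = w + var (Min (Poly_Mapping.keys v))" by (rule mon_split_var)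
  then have "Poly_Mapping.keys w \<subseteq> Poly_Mapping.keys v" by (metis keys_add_mon sup_ge1)
  then show ?thesis using Min_le[of "Poly_Mapping.keys v"] by (intro that[OF w]) auto
qed

text \<open>Multiplying by powers of the least variable of \<open>g\<close> never leads into \<open>A'\<close>, as that variable can be
  removed again.\<close>

lemma add_least_notin:
  assumes "g \<in> A - A'" "mdeg g = r"
  shows "g + Poly_Mapping.single (Min (Poly_Mapping.keys g)) m \<in> A - A'"
proof (induction m)
  case 0
  then show ?case using assms by simp
next
  case (Suc m)
  let ?l = "Min (Poly_Mapping.keys g)"
  let ?w = "g + Poly_Mapping.single ?l m"
  have "?l \<in> Poly_Mapping.keys g" using keys_nonempty[of g] assms(2) by (intro Min_in) auto
  then have "?l \<le> n" using borel_set_keys(2)[OF borel(1)] assms(1) by blast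
  then have "?w + var ?l \<in> A" using Suc borel by (auto simp: borel_set_def)
  moreover have "?w + var ?l \<notin> A'"
  proof
    assume "?w + var ?l \<in> A'"
    then have "?w \<in> A'"
      by (rule borel_set_remove_least[OF borel(2) gen(2)])
        (auto simp: assms keys_add_mon split: if_splits)
    then show False using Suc by simp
  qed
  ultimately show ?case unfolding single_Suc_mon[of _ m] by (simp add: add.assoc)
qed

text \<open>Suppose that the translation never raises the least variable.  Removing the least variable of an
  element of \<open>A' - A\<close>, translating back and multiplying by it again leads to \<open>A - A'\<close>, with the same least
  variable.  This gives an injection of \<open>A' - A\<close> into \<open>A - A'\<close> in every degree above \<open>r\<close>, which is onto
  where the Hilbert functions agree.  So it reaches \<open>g\<close> times a power of the least variable \<open>x\<^sub>l\<close> of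
  \<open>g\<close>; the preimage is \<open>g'\<close> times that power, and since it has the same least variable, \<open>g'\<close> contains
  no variable below \<open>x\<^sub>l\<close>.\<close>

lemma Min_keys_translate_aux:
  assumes lower: "\<And>v v' i. v' + a = v + a' \<Longrightarrow> i \<in> Poly_Mapping.keys v \<Longrightarrow> \<exists>j\<in>Poly_Mapping.keys v'. j \<le> i"
    and g: "g \<in> A - A'" "mdeg g = r" "g' + a = g + a'"
  shows "Min (Poly_Mapping.keys g') = Min (Poly_Mapping.keys g)"
proof -
  let ?min = "\<lambda>v. Min (Poly_Mapping.keys (v :: mon))"
  have pull_back: "\<exists>v\<in>A - A'. v' + a = v + a' \<and> (r < mdeg v' \<longrightarrow> ?min v = ?min v')"
    if "r \<le> mdeg v'" "v' \<in> A' - A" for v'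
    using that
  proof (induction "mdeg v' - r" arbitrary: v')
    case 0
    then have "mdeg v' = r" by simp
    with translate(2)[OF 0(3)] obtain g where "g \<in> A - A'" "g + a' = v' + a" by blast
    then show ?case using \<open>mdeg v' = r\<close> by (intro bexI[of _ g]) simp_all
  next
    case (Suc m)
    let ?i = "?min v'"
    obtain w' where w': "v' = w' + var ?i" and least: "\<And>j. j \<in> Poly_Mapping.keys w' \<Longrightarrow> ?i \<le> j"
      using split_least[of v'] Suc.prems by blast
    have "?i \<in> Poly_Mapping.keys v'" using keys_nonempty[of v'] Suc.prems by (intro Min_in) auto
    then have i: "?i \<le> n"
      using borel_set_keys(2)[OF borel(2)] Suc.prems by blast
    have "mdeg v' = mdeg w' + 1" using arg_cong[OF w', of mdeg] by simp
    then have deg: "r \<le> mdeg w'" "m = mdeg w' - r" using Suc.hyps(2) by simp_all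
    have "w' \<in> A'"
      by (rule borel_set_remove_least[OF borel(2) gen(2) _ deg(1) least])
        (use Suc.prems w' in auto)
    moreover have "w' \<notin> A"
      using Suc.prems w' i borel(1) by (metis DiffD2 atLeastAtMost_iff borel_set_def le0)
    ultimately obtain w where w: "w \<in> A - A'" "w' + a = w + a'"
      using Suc.hyps(1)[OF deg(2,1)] by auto
    let ?v = "w + var ?i"
    have least': "?i \<le> k" if "k \<in> Poly_Mapping.keys w" for k
      using lower[OF w(2) that] least by (meson order_trans)
    have "?v \<in> A" using w i borel(1) by (auto simp: borel_set_def)
    moreover have "?v \<notin> A'"
      using borel_set_remove_least[OF borel(2) gen(2) _ _ least'] w deg(1) mdeg_translate[OF w(2)] by auto
    moreover have "v' + a = ?v + a'" using w(2) w' by (metis add.assoc add.commute)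
    moreover have "?min ?v = ?i"
      by (rule Min_eqI) (auto simp: keys_add_mon least' split: if_splits)
    ultimately show ?case by (intro bexI[of _ ?v]) auto
  qed
  obtain t where t: "r < t" "hilb_fun 0 n A t = hilb_fun 0 n A' t"
    using eventually_conj[OF hilb eventually_gt_at_top[of r]]
    by (metis (mono_tags, lifting) eventually_happens' sequentially_bot)
  let ?U = "{v \<in> mons_from 0 n. mdeg v = t}"
  let ?T = "{v \<in> A - A'. mdeg v = t}" and ?T' = "{v \<in> A' - A. mdeg v = t}"
  have finU: "finite ?U" by (rule finite_mons_from_mdeg)
  have sub: "A \<subseteq> mons_from 0 n" "A' \<subseteq> mons_from 0 n" using borel by (auto simp: borel_set_def)
  have card_eq: "card ?T = card ?T'"
  proof -
    let ?C = "{v \<in> ?U. v \<notin> A \<and> v \<notin> A'}"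
    have fin: "finite ?T" "finite ?T'" "finite ?C"
      by (rule finite_subset[OF _ finU]; use sub in auto)+
    have "{v \<in> mons_from 0 n. mdeg v = t \<and> v \<notin> A'} = ?T \<union> ?C" using sub by auto
    moreover have "card (?T \<union> ?C) = card ?T + card ?C"
      using fin by (intro card_Un_disjoint) auto
    moreover have "{v \<in> mons_from 0 n. mdeg v = t \<and> v \<notin> A} = ?T' \<union> ?C" using sub by auto
    moreover have "card (?T' \<union> ?C) = card ?T' + card ?C"
      using fin by (intro card_Un_disjoint) auto
    ultimately have "hilb_fun 0 n A' t = card ?T + card ?C" "hilb_fun 0 n A t = card ?T' + card ?C"
      unfolding hilb_fun_def by metis+
    then show ?thesis using t by simp
  qed
  have "\<exists>v. v \<in> ?T \<and> v' + a = v + a' \<and> ?min v = ?min v'" if "v' \<in> ?T'" for v'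
  proof -
    have "r < mdeg v'" "v' \<in> A' - A" using that t(1) by auto
    with pull_back[of v'] obtain v where v: "v \<in> A - A'" "v' + a = v + a'" "?min v = ?min v'" by auto
    then show ?thesis using that mdeg_translate[OF v(2)] by (intro exI[of _ v]) simp
  qed
  then have "\<exists>f. \<forall>v'\<in>?T'. f v' \<in> ?T \<and> v' + a = f v' + a' \<and> ?min (f v') = ?min v'"
    by (intro bchoice ballI)
  then obtain f where f: "\<And>v'. v' \<in> ?T' \<Longrightarrow> f v' \<in> ?T \<and> v' + a = f v' + a' \<and> ?min (f v') = ?min v'"
    by (elim exE) (rule that, erule (1) bspec)
  have inj: "inj_on f ?T'" 
  proof (rule inj_onI)
    fix v w assume "v \<in> ?T'" "w \<in> ?T'" "f v = f w"
    then have "v + a = w + a" using f[of v] f[of w] by simp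
    then show "v = w" by simp
  qed
  moreover have "finite ?T" by (rule finite_subset[OF _ finU]) (use sub in auto)
  ultimately have onto: "f ` ?T' = ?T"
  proof (intro card_subset_eq)
    show "f ` ?T' \<subseteq> ?T" using f by blast
    show "card (f ` ?T') = card ?T" using card_eq card_image[OF inj] by simp
  qed
  let ?l = "?min g"
  let ?p = "Poly_Mapping.single ?l (t - r)"
  have "g + ?p \<in> ?T" using add_least_notin[OF g(1,2), of "t - r"] g(2) t(1) by auto
  then obtain v' where v': "v' \<in> ?T'" "v' + a = (g + ?p) + a'" "?min (g + ?p) = ?min v'"
  proof -
    have "g + ?p \<in> f ` ?T'" using onto \<open>g + ?p \<in> ?T\<close> by blast
    then obtain u where "u \<in> ?T'" "g + ?p = f u" by blast
    then show ?thesis using f[of u] that[of u] by simp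
  qed
  have "v' + a = (g' + ?p) + a" using v'(2) g(3) by (metis add.assoc add.commute)
  then have "v' = g' + ?p" by simp
  moreover have "?min (g + ?p) = ?l"
    using keys_nonempty[of g] g(2) by (intro Min_eqI) (auto simp: keys_add_mon split: if_splits)
  moreover have g'_ne: "Poly_Mapping.keys g' \<noteq> {}"
    using keys_nonempty[of g'] mdeg_translate[OF g(3)] g(2) by simp
  moreover have "Poly_Mapping.keys g' \<subseteq> Poly_Mapping.keys (g' + ?p)" by (simp add: keys_add_mon)
  ultimately have "?l \<le> ?min g'"
    using v'(3) Min_antimono[OF _ g'_ne finite_keys] by metis
  moreover have "?min g' \<le> ?l"
  proof -
    have "?l \<in> Poly_Mapping.keys g" using keys_nonempty[of g] g(2) by (intro Min_in) auto
    then obtain j where "j \<in> Poly_Mapping.keys g'" "j \<le> ?l" using lower[OF g(3)] by blast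
    then show ?thesis using Min_le[OF finite_keys, of j g'] by linarith
  qed
  ultimately show ?thesis by simp
qed

text \<open>The first exponent in which \<open>a\<close> and \<open>a'\<close> differ determines the direction in which least variables
  can move.\<close>

lemma lower_of_less:
  assumes "Poly_Mapping.lookup a k < Poly_Mapping.lookup a' k"
    and "\<And>i. i < k \<Longrightarrow> Poly_Mapping.lookup a i = Poly_Mapping.lookup a' i"
    and "v' + a = v + a'" "i \<in> Poly_Mapping.keys v"
  shows "\<exists>j\<in>Poly_Mapping.keys v'. j \<le> i"
proof -
  have eq: "Poly_Mapping.lookup v' j + Poly_Mapping.lookup a j = Poly_Mapping.lookup v j + Poly_Mapping.lookup a' j" for j
    using arg_cong[OF assms(3), of "\<lambda>f. Poly_Mapping.lookup f j"] by (simp add: lookup_add)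
  show ?thesis
  proof (cases "i < k")
    case True
    then have "i \<in> Poly_Mapping.keys v'" using eq[of i] assms(2)[of i] assms(4) by (simp add: in_keys_iff)
    then show ?thesis by blast
  next
    case False
    have "k \<in> Poly_Mapping.keys v'" using eq[of k] assms(1) by (simp add: in_keys_iff)
    then show ?thesis using False by (meson not_le_imp_less)
  qed
qed

lemma Min_keys_translate:
  assumes g: "g \<in> A - A'" "mdeg g = r" "g' \<in> A' - A" "g' + a = g + a'"
  shows "Min (Poly_Mapping.keys g') = Min (Poly_Mapping.keys g)"
proof -
  define k where "k = (LEAST k. Poly_Mapping.lookup a k \<noteq> Poly_Mapping.lookup a' k)"
  have "\<exists>k. Poly_Mapping.lookup a k \<noteq> Poly_Mapping.lookup a' k"
    using a_neq by (metis poly_mapping_eqI)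
  then have k: "Poly_Mapping.lookup a k \<noteq> Poly_Mapping.lookup a' k" unfolding k_def by (rule LeastI_ex)
  have lt: "Poly_Mapping.lookup a i = Poly_Mapping.lookup a' i" if "i < k" for i
    using not_less_Least[OF that[unfolded k_def]] by simp
  show ?thesis
  proof (cases "Poly_Mapping.lookup a k < Poly_Mapping.lookup a' k")
    case True
    then show ?thesis
      using Min_keys_translate_aux[OF _ g(1,2,4)] lower_of_less[OF True lt] by blast
  next
    case False
    interpret sw: borel_pair n r A' A a' a by (rule swap)
    have "Poly_Mapping.lookup a' k < Poly_Mapping.lookup a k" using False k by simp
    note sw.lower_of_less[OF this lt[symmetric]]
    then show ?thesis
      using sw.Min_keys_translate_aux[OF _ g(3) _ g(4)[symmetric]] mdeg_translate[OF g(4)] g(2) by metis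
  qed
qed

text \<open>Induction on the degree: as the least variables of \<open>w\<close> and its translate \<open>w'\<close> agree, multiplication
  by a variable not above them can be undone on both sides.\<close>

lemma translate_all_degrees:
  assumes "v \<in> A - A'" "r \<le> mdeg v"
  shows "\<exists>v'\<in>A' - A. v' + a = v + a' \<and> Min (Poly_Mapping.keys v') = Min (Poly_Mapping.keys v)"
  using assms
proof (induction "mdeg v - r" arbitrary: v)
  case 0
  then have "mdeg v = r" by simp
  with translate(1)[OF 0(2)] obtain g where g: "g \<in> A' - A" "g + a = v + a'" by blast
  then show ?case using Min_keys_translate[OF 0(2) \<open>mdeg v = r\<close> g] by blast
next
  case (Suc m)
  let ?i = "Min (Poly_Mapping.keys v)"
  obtain w where w: "v = w + var ?i" and least: "\<And>j. j \<in> Poly_Mapping.keys w \<Longrightarrow> ?i \<le> j"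
    using split_least[of v] Suc.prems by blast
  have "?i \<in> Poly_Mapping.keys v" using keys_nonempty[of v] Suc.prems by (intro Min_in) auto
  then have i: "?i \<le> n"
      using borel_set_keys(2)[OF borel(1)] Suc.prems by blast
  have "mdeg v = mdeg w + 1" using arg_cong[OF w, of mdeg] by simp
  then have deg: "r \<le> mdeg w" "m = mdeg w - r" using Suc.hyps(2) by simp_all
  have "w \<in> A"
    by (rule borel_set_remove_least[OF borel(1) gen(1) _ deg(1) least])
      (use Suc.prems w in auto)
  moreover have "w \<notin> A'"
    using Suc.prems w i borel(2) by (metis DiffD2 atLeastAtMost_iff borel_set_def le0)
  ultimately obtain w' where w': "w' \<in> A' - A" "w' + a = w + a'"
      "Min (Poly_Mapping.keys w') = Min (Poly_Mapping.keys w)"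
    using Suc.hyps(1)[OF deg(2) _ deg(1)] by blast
  let ?v' = "w' + var ?i"
  have deg': "r \<le> mdeg w'" using mdeg_translate[OF w'(2)] deg(1) by simp
  have "?i \<le> Min (Poly_Mapping.keys w')"
    using least keys_nonempty[OF deg(1)] unfolding w'(3) by (intro least Min_in) auto
  then have least': "?i \<le> k" if "k \<in> Poly_Mapping.keys w'" for k
    using that Min_le[OF finite_keys that] by linarith
  have "?v' \<in> A'" using w' i borel(2) by (auto simp: borel_set_def)
  moreover have "?v' \<notin> A"
    using borel_set_remove_least[OF borel(1) gen(1) _ deg' least'] w' by auto
  moreover have "?v' + a = v + a'" using w'(2) w by (metis add.assoc add.commute)
  moreover have "Min (Poly_Mapping.keys ?v') = ?i"
    by (rule Min_eqI) (auto simp: keys_add_mon least' split: if_splits)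
  ultimately show ?case by (intro bexI[of _ ?v']) auto
qed

text \<open>The difference of exponent vectors is truncated, so \<open>shift v\<close> is the translate of \<open>v\<close> only where
  \<open>a\<close> divides \<open>v + a'\<close>; on \<open>A - A'\<close> in degrees at least \<open>r\<close> it does.\<close>

definition shift :: "mon \<Rightarrow> mon" where
  "shift v = v + a' - a"

definition unshift :: "mon \<Rightarrow> mon" where
  "unshift v = v + a - a'"

lemma shift_eqI: "v' + a = v + a' \<Longrightarrow> shift v = v'"
  unfolding shift_def by (metis add_diff_cancel_right')

lemma unshift_eqI: "v' + a = v + a' \<Longrightarrow> unshift v' = v"
  unfolding unshift_def by simp

lemma shift:
  assumes "v \<in> A - A'" "r \<le> mdeg v"
  shows "shift v \<in> A' - A" "shift v + a = v + a'" "mdeg (shift v) = mdeg v" "unshift (shift v) = v"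
  using translate_all_degrees[OF assms] shift_eqI mdeg_translate unshift_eqI by metis+

lemma unshift:
  assumes "v' \<in> A' - A" "r \<le> mdeg v'"
  shows "unshift v' \<in> A - A'" "v' + a = unshift v' + a'" "mdeg (unshift v') = mdeg v'" "shift (unshift v') = v'"
proof -
  interpret sw: borel_pair n r A' A a' a by (rule swap)
  obtain v where v: "v \<in> A - A'" "v' + a = v + a'"
    using sw.translate_all_degrees[OF assms] by metis
  show "unshift v' \<in> A - A'" "v' + a = unshift v' + a'" "mdeg (unshift v') = mdeg v'" "shift (unshift v') = v'"
    using v unshift_eqI[OF v(2)] shift_eqI[OF v(2)] mdeg_translate[OF v(2)] by simp_all
qed

end

section \<open>Ideals of the polynomial ring\<close>

lemma lookup_single_mult_add:
  fixes f :: "'a::comm_ring_1 mpol"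
  shows "Poly_Mapping.lookup (Poly_Mapping.single u c * f) (u + v) = c * Poly_Mapping.lookup f v"
  by (simp add: lookup_mult lookup_single when_mult)

lemma lookup_xpow_mult_add [simp]:
  "Poly_Mapping.lookup (xpow u * f) (u + v) = Poly_Mapping.lookup f v"
  by (simp add: xpow_def lookup_single_mult_add)

lemma lookup_xpow_mult_notin:
  assumes "\<And>v. w \<noteq> u + v"
  shows "Poly_Mapping.lookup (xpow u * f) w = 0"
proof -
  have "w \<notin> Poly_Mapping.keys (xpow u * f)"
    using keys_mult[of "xpow u" f] assms by (auto simp: xpow_def split: if_splits)
  then show ?thesis by (simp add: in_keys_iff)
qed

lemma keys_xpow_mult:
  "Poly_Mapping.keys (xpow u * f) = (\<lambda>v. u + v) ` Poly_Mapping.keys f"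
proof (intro equalityI subsetI)
  fix w assume w: "w \<in> Poly_Mapping.keys (xpow u * f)"
  then obtain v where "w = u + v" using lookup_xpow_mult_notin[of w u f] by (auto simp: in_keys_iff)
  then show "w \<in> (\<lambda>v. u + v) ` Poly_Mapping.keys f" using w by (auto simp: in_keys_iff)
qed (auto simp: in_keys_iff)

lemma lookup_scal [simp]: "Poly_Mapping.lookup (scal c f) v = c * Poly_Mapping.lookup f v"
  using lookup_single_mult_add[of 0 c f v] by (simp add: scal_def)

lemma lookup_xpow: "Poly_Mapping.lookup (xpow u :: 'a::comm_ring_1 mpol) v = (if v = u then 1 else 0)"
  by (auto simp: xpow_def lookup_single when_def)

lemma keys_xpow [simp]: "Poly_Mapping.keys (xpow u :: 'a::field mpol) = {u}"
  by (simp add: xpow_def)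

lemma inj_xpow: "inj (xpow :: mon \<Rightarrow> 'a::field mpol)"
  by (rule injI) (metis keys_xpow singleton_inject)

lemma xpow_add: "xpow (u + v) = xpow u * xpow v"
  by (simp add: xpow_def mult_single)

lemma xpow_0 [simp]: "xpow 0 = 1"
  by (simp add: xpow_def)

lemma vector_space_scal: "vector_space (scal :: 'a::field \<Rightarrow> 'a mpol \<Rightarrow> 'a mpol)"
  by unfold_locales (auto intro!: poly_mapping_eqI simp: lookup_add algebra_simps)

lemma lookup_sum_scal_xpow:
  assumes "finite S"
  shows "Poly_Mapping.lookup (\<Sum>u\<in>S. scal (F u) (xpow u)) v = (if v \<in> S then F v else 0)"
proof -
  have "Poly_Mapping.lookup (\<Sum>u\<in>S. scal (F u) (xpow u)) v = (\<Sum>u\<in>S. if v = u then F u else 0)"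
    unfolding lookup_sum by (intro sum.cong) (auto simp: lookup_xpow)
  then show ?thesis using assms by simp
qed

lemma xpow_mult_scal: "xpow u * scal c f = scal c (xpow u * f)"
  by (simp add: scal_def mult.left_commute)

lemma poly_expansion: "f = (\<Sum>u\<in>Poly_Mapping.keys f. scal (Poly_Mapping.lookup f u) (xpow u))"
  by (rule poly_mapping_eqI) (auto simp: lookup_sum_scal_xpow in_keys_iff)

lemma zero_mons [simp]: "0 \<in> mons n"
  by (simp add: mons_def)

lemma mons_add: "a \<in> mons n \<Longrightarrow> b \<in> mons n \<Longrightarrow> a + b \<in> mons n"
  by (auto simp: mons_def keys_add_mon)

lemma carrier_mpoly [simp]: "f \<in> carrier (mpoly_ring n) \<longleftrightarrow> Poly_Mapping.keys f \<subseteq> mons n"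
  by (simp add: mpoly_ring_def)

lemma mpoly_ring_ops [simp]:
  "x \<otimes>\<^bsub>mpoly_ring n\<^esub> y = x * y" "x \<oplus>\<^bsub>mpoly_ring n\<^esub> y = x + y"
  "\<zero>\<^bsub>mpoly_ring n\<^esub> = 0" "\<one>\<^bsub>mpoly_ring n\<^esub> = 1"
  by (simp_all add: mpoly_ring_def)

lemma cring_mpoly_ring: "cring (mpoly_ring n :: 'a::comm_ring_1 mpol ring)"
proof (rule cringI)
  have add: "Poly_Mapping.keys (f + g) \<subseteq> mons n"
    if "Poly_Mapping.keys f \<subseteq> mons n" "Poly_Mapping.keys g \<subseteq> mons n" for f g :: "'a mpol"
    using keys_add[of f g] that by blast
  have mult: "Poly_Mapping.keys (f * g) \<subseteq> mons n"
    if "Poly_Mapping.keys f \<subseteq> mons n" "Poly_Mapping.keys g \<subseteq> mons n" for f g :: "'a mpol"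
    using keys_mult[of f g] that by (auto intro: mons_add)
  have uminus: "Poly_Mapping.keys (- f) = Poly_Mapping.keys f" for f :: "'a mpol"
    by (auto simp: in_keys_iff)
  have one: "Poly_Mapping.keys (1 :: 'a mpol) \<subseteq> mons n"
    by (auto simp: in_keys_iff lookup_one when_def split: if_splits)
  show "abelian_group (mpoly_ring n :: 'a mpol ring)"
  proof (rule abelian_groupI)
    fix f :: "'a mpol" assume "f \<in> carrier (mpoly_ring n)"
    then show "\<exists>g\<in>carrier (mpoly_ring n). g \<oplus>\<^bsub>mpoly_ring n\<^esub> f = \<zero>\<^bsub>mpoly_ring n\<^esub>"
      by (intro bexI[of _ "- f"]) (auto simp: uminus)
  qed (auto simp: add add_ac dest: add)
  show "comm_monoid (mpoly_ring n :: 'a mpol ring)"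
    by (rule comm_monoidI) (auto simp: mult_ac one dest: mult)
qed (auto simp: algebra_simps)

text \<open>Every polynomial is a combination of monomials, so closure under multiplication need only be checked
  for scalars and monomials.\<close>

lemma ideal_mpoly_ringI:
  fixes I :: "'a::comm_ring_1 mpol set"
  assumes sub: "\<And>f. f \<in> I \<Longrightarrow> Poly_Mapping.keys f \<subseteq> mons n"
    and zero: "0 \<in> I" and add: "\<And>f g. f \<in> I \<Longrightarrow> g \<in> I \<Longrightarrow> f + g \<in> I"
    and scal: "\<And>c f. f \<in> I \<Longrightarrow> scal c f \<in> I"
    and mult: "\<And>u f. u \<in> mons n \<Longrightarrow> f \<in> I \<Longrightarrow> xpow u * f \<in> I"
  shows "ideal I (mpoly_ring n)"
proof -
  interpret R: cring "mpoly_ring n :: 'a mpol ring" by (rule cring_mpoly_ring)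
  have sum: "(\<Sum>x\<in>S. F x) \<in> I" if "\<And>x. x \<in> S \<Longrightarrow> F x \<in> I" for S :: "mon set" and F
    using that by (induction S rule: infinite_finite_induct) (auto intro: zero add)
  have left: "g * f \<in> I" if "f \<in> I" "Poly_Mapping.keys g \<subseteq> mons n" for f g
  proof -
    have "g * f = (\<Sum>u\<in>Poly_Mapping.keys g. scal (Poly_Mapping.lookup g u) (xpow u * f))"
      by (subst (1) poly_expansion[of g]) (simp add: sum_distrib_right scal_def mult.assoc)
    also have "\<dots> \<in> I" using that by (intro sum scal mult) auto
    finally show ?thesis .
  qed
  have "scal (- 1) f = - f" for f :: "'a mpol"
    by (rule poly_mapping_eqI) simp
  then have uminus: "- f \<in> I" if "f \<in> I" for f using scal[OF that, of "- 1"] by simp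
  have "\<ominus>\<^bsub>mpoly_ring n\<^esub> f = - f" if "f \<in> I" for f
    using sub[OF that] sub[OF uminus[OF that]] by (intro R.minus_equality) auto
  then have "subgroup I (add_monoid (mpoly_ring n))"
    using sub zero add uminus by (intro R.add.subgroupI) auto
  then show ?thesis
    using left by (intro idealI R.ring_axioms) (auto simp: mult.commute[of _ "_ :: 'a mpol"])
qed

lemma
  fixes I :: "'a::comm_ring_1 mpol set"
  assumes I: "ideal I (mpoly_ring n)"
  shows ideal_keys: "f \<in> I \<Longrightarrow> Poly_Mapping.keys f \<subseteq> mons n"
    and ideal_zero: "0 \<in> I"
    and ideal_add: "f \<in> I \<Longrightarrow> g \<in> I \<Longrightarrow> f + g \<in> I"
    and ideal_mult: "f \<in> I \<Longrightarrow> Poly_Mapping.keys g \<subseteq> mons n \<Longrightarrow> g * f \<in> I"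
  using ideal.Icarr[OF I] additive_subgroup.zero_closed[OF ideal.axioms(1)[OF I]]
    additive_subgroup.a_closed[OF ideal.axioms(1)[OF I]] ideal.I_l_closed[OF I]
  by auto

lemma ideal_scal: "ideal I (mpoly_ring n) \<Longrightarrow> f \<in> I \<Longrightarrow> scal c f \<in> I"
  unfolding scal_def by (rule ideal_mult) (auto simp: mons_def split: if_splits)

lemma ideal_xpow_mult: "ideal I (mpoly_ring n) \<Longrightarrow> f \<in> I \<Longrightarrow> u \<in> mons n \<Longrightarrow> xpow u * f \<in> I"
  by (rule ideal_mult) (auto simp: xpow_def split: if_splits)

lemma ideal_sum:
  "ideal I (mpoly_ring n) \<Longrightarrow> (\<And>x. x \<in> S \<Longrightarrow> F x \<in> I) \<Longrightarrow> sum F S \<in> I"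
  by (induction S rule: infinite_finite_induct) (auto intro: ideal_zero ideal_add)

lemma monomial_ideal_eq:
  fixes I :: "'a::field mpol set"
  assumes "monomial_ideal n I"
  shows "I = {f. Poly_Mapping.keys f \<subseteq> {a \<in> mons n. xpow a \<in> I}}"
proof -
  interpret R: cring "mpoly_ring n :: 'a mpol ring" by (rule cring_mpoly_ring)
  let ?A = "{a \<in> mons n. xpow a \<in> I}"
  let ?M = "{f :: 'a mpol. Poly_Mapping.keys f \<subseteq> ?A}"
  have I: "ideal I (mpoly_ring n)"
    and gen: "I = genideal (mpoly_ring n) {xpow a | a. a \<in> mons n \<and> xpow a \<in> I}"
    using assms by (auto simp: monomial_ideal_def)
  have up: "u + a \<in> ?A" if "a \<in> ?A" "u \<in> mons n" for a u
    using that by (auto simp: xpow_add mons_add ideal_xpow_mult[OF I])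
  have "ideal ?M (mpoly_ring n)"
  proof (rule ideal_mpoly_ringI)
    fix f g :: "'a mpol" assume "f \<in> ?M" "g \<in> ?M"
    then show "f + g \<in> ?M" using keys_add[of f g] by blast
  next
    fix c and f :: "'a mpol" assume "f \<in> ?M"
    then show "scal c f \<in> ?M" by (auto simp: in_keys_iff subset_iff)
  next
    fix u and f :: "'a mpol" assume "u \<in> mons n" "f \<in> ?M"
    then show "xpow u * f \<in> ?M" using up by (auto simp: keys_xpow_mult)
  qed auto
  moreover have "{xpow a | a. a \<in> mons n \<and> xpow a \<in> I} \<subseteq> ?M" by auto
  ultimately have "I \<subseteq> ?M" by (subst gen) (rule R.genideal_minimal)
  moreover have "?M \<subseteq> I"
  proof
    fix f assume f: "f \<in> ?M"
    show "f \<in> I"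
      by (subst poly_expansion[of f]) (intro ideal_sum[OF I] ideal_scal[OF I], use f in auto)
  qed
  ultimately show ?thesis by blast
qed

lemma borel_geI:
  assumes "a + var i \<in> mons n" "i < n"
  shows "borel_ge n (a + var (Suc i)) (a + var i)"
proof -
  have "borel_step n (a + var (Suc i)) (a + var i)"
    unfolding borel_step_def
  proof (intro conjI exI[of _ i])
    show "a + var (Suc i) \<in> mons n" using assms by (auto simp: mons_def keys_add_mon)
    show "gen_mon (a + var (Suc i)) = e_incr i (gen_mon (a + var i))"
      by (rule poly_mapping_eqI)
        (simp add: gen_mon_def e_incr_def lookup_add lookup_minus lookup_single Poly_Mapping.map.rep_eq when_def)
  qed (use assms in auto)
  then show ?thesis by (simp add: borel_ge_def)
qed

text \<open>For the second statement: by strong stability \<open>x\<^sub>0 a \<in> A\<close> implies \<open>x\<^sub>i a \<in> A\<close> for all \<open>i\<close>, so \<open>a\<close> belongs to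
  the saturation.\<close>

lemma strongly_stable_borel_set:
  fixes I :: "'a::field mpol set"
  assumes "strongly_stable n I" "saturation n I = I"
  defines "A \<equiv> {a \<in> mons n. xpow a \<in> I}"
  shows "borel_set 0 n A" "\<And>a. a + var 0 \<in> A \<Longrightarrow> a \<in> A"
proof -
  have I: "ideal I (mpoly_ring n)" using assms by (auto simp: strongly_stable_def monomial_ideal_def)
  have up: "a + u \<in> A" if "a \<in> A" "u \<in> mons n" for a u
    using that ideal_xpow_mult[OF I, of "xpow a" u] by (auto simp: A_def mons_add xpow_add[symmetric] add.commute)
  have var_mons: "var i \<in> mons n" if "i \<le> n" for i using that by (simp add: mons_def)
  have exch: "a + var (Suc i) \<in> A" if "i < n" "a + var i \<in> A" for a i
  proof -
    have "a + var (Suc i) \<in> mons n" using that by (auto simp: A_def mons_def keys_add_mon)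
    then show ?thesis using assms(1) borel_geI[of a i n] that
      unfolding strongly_stable_def A_def by blast
  qed
  show bs: "borel_set 0 n A"
    unfolding borel_set_def using up var_mons exch by (auto simp: A_def mons_from_0)
  fix a assume a: "a + var 0 \<in> A"
  have "\<exists>k. \<forall>b\<in>mons_deg n k. xpow b * xpow a \<in> I"
  proof (intro exI[of _ 1] ballI)
    fix b assume b: "b \<in> mons_deg n 1"
    then have "b \<noteq> 0" by (auto simp: mons_deg_def)
    then obtain i where i: "i \<in> Poly_Mapping.keys b" by (rule mon_nonzero_obtains_var)
    then obtain c where c: "b = c + var i" by (rule mon_split_var)
    have "c = 0" using b c by (simp add: mons_deg_def)
    moreover have "i \<le> n" using b i by (auto simp: mons_deg_def mons_def)
    ultimately have "a + b \<in> A" using borel_set_exchange[OF bs a, of i] c by simp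
    then show "xpow b * xpow a \<in> I" by (simp add: A_def xpow_add[symmetric] add.commute)
  qed
  moreover have am: "a \<in> mons n" using a by (auto simp: A_def mons_def keys_add_mon)
  ultimately have "xpow a \<in> saturation n I" by (auto simp: saturation_def)
  then show "a \<in> A" using assms(2) am by (simp add: A_def)
qed

lemma lookup_hcomp: "Poly_Mapping.lookup (hcomp d f) v = (if mdeg v = d then Poly_Mapping.lookup f v else 0)"
proof -
  have "hcomp d f = (\<Sum>m\<in>{m \<in> Poly_Mapping.keys f. mdeg m = d}. scal (Poly_Mapping.lookup f m) (xpow m))"
    unfolding hcomp_def by (intro sum.cong) (auto simp: scal_def xpow_def mult_single)
  then show ?thesis by (auto simp: lookup_sum_scal_xpow in_keys_iff)
qed

lemma keys_hcomp: "Poly_Mapping.keys (hcomp d f) = {m \<in> Poly_Mapping.keys f. mdeg m = d}"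
  by (auto simp: in_keys_iff lookup_hcomp split: if_splits)

lemma hcomp_xpow_mult: "hcomp (mdeg u + d) (xpow u * f) = xpow u * hcomp d f"
proof (rule poly_mapping_eqI)
  fix w
  show "Poly_Mapping.lookup (hcomp (mdeg u + d) (xpow u * f)) w = Poly_Mapping.lookup (xpow u * hcomp d f) w"
  proof (cases "\<exists>v. w = u + v")
    case True
    then show ?thesis by (auto simp: lookup_hcomp)
  next
    case False
    then show ?thesis by (simp add: lookup_hcomp lookup_xpow_mult_notin)
  qed
qed

subsection \<open>Saturation\<close>

lemma mons_deg_split:
  assumes "b \<in> mons_deg n (k + l)"
  obtains c u where "c \<in> mons_deg n k" "u \<in> mons_deg n l" "b = c + u"
proof -
  have "generated_upto 0 n (mons_from 0 n) k"
    unfolding generated_upto_def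
  proof (intro ballI impI)
    fix a assume a: "a \<in> mons_from 0 n" "k < mdeg a"
    then have "a \<noteq> 0" by auto
    then obtain i where i: "i \<in> Poly_Mapping.keys a" by (rule mon_nonzero_obtains_var)
    then obtain c where "a = c + var i" by (rule mon_split_var)
    then show "\<exists>b\<in>mons_from 0 n. \<exists>i\<in>{0..n}. a = b + var i" using a i
      by (intro bexI[of _ c] bexI[of _ i]) (auto simp: mons_from_def keys_add_mon)
  qed
  then show ?thesis
    using assms that
    by (elim generated_upto_obtains[of 0 n _ k b]) (auto simp: mons_deg_def mons_from_0)
qed

lemma saturationE:
  assumes "f \<in> saturation n I"
  obtains k where "Poly_Mapping.keys f \<subseteq> mons n" "\<And>b. b \<in> mons_deg n k \<Longrightarrow> xpow b * f \<in> I"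
proof -
  obtain k where "Poly_Mapping.keys f \<subseteq> mons n" "\<forall>b\<in>mons_deg n k. xpow b * f \<in> I"
    using assms by (auto simp: saturation_def)
  then show ?thesis using that[of k] by blast
qed

lemma saturationI:
  "Poly_Mapping.keys f \<subseteq> mons n \<Longrightarrow> (\<And>b. b \<in> mons_deg n k \<Longrightarrow> xpow b * f \<in> I) \<Longrightarrow> f \<in> saturation n I"
  unfolding saturation_def by auto

lemma subset_saturation: "ideal I (mpoly_ring n) \<Longrightarrow> I \<subseteq> saturation n I"
  by (auto simp: saturation_def mons_deg_def dest: ideal_keys intro!: exI[of _ 0])

lemma saturation_mono_exponent:
  assumes I: "ideal I (mpoly_ring n)" and "k \<le> l" "\<And>b. b \<in> mons_deg n k \<Longrightarrow> xpow b * f \<in> I"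
    and "b \<in> mons_deg n l"
  shows "xpow b * f \<in> I"
proof -
  obtain c u where "c \<in> mons_deg n k" "u \<in> mons_deg n (l - k)" "b = c + u"
    using mons_deg_split[of b n k "l - k"] assms by auto
  then show ?thesis using assms(3)[of c] ideal_xpow_mult[OF I, of "xpow c * f" u]
    by (simp add: xpow_add mult_ac mons_deg_def)
qed

lemma ideal_saturation:
  assumes I: "ideal I (mpoly_ring n)"
  shows "ideal (saturation n I) (mpoly_ring n)"
proof (rule ideal_mpoly_ringI)
  fix f g assume f: "f \<in> saturation n I" and g: "g \<in> saturation n I"
  obtain k where f: "Poly_Mapping.keys f \<subseteq> mons n" and k: "\<And>b. b \<in> mons_deg n k \<Longrightarrow> xpow b * f \<in> I"
    using saturationE[OF f] by blast
  obtain l where g: "Poly_Mapping.keys g \<subseteq> mons n" and l: "\<And>b. b \<in> mons_deg n l \<Longrightarrow> xpow b * g \<in> I"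
    using saturationE[OF g] by blast
  have "xpow b * (f + g) \<in> I" if "b \<in> mons_deg n (max k l)" for b
    unfolding distrib_left
    by (intro ideal_add[OF I] saturation_mono_exponent[OF I _ k that] saturation_mono_exponent[OF I _ l that]) auto
  then show "f + g \<in> saturation n I"
    using f g keys_add[of f g] by (intro saturationI[of _ n "max k l"]) auto
next
  fix c f assume f: "f \<in> saturation n I"
  obtain k where "Poly_Mapping.keys f \<subseteq> mons n" and k: "\<And>b. b \<in> mons_deg n k \<Longrightarrow> xpow b * f \<in> I"
    using saturationE[OF f] by blast
  moreover have "Poly_Mapping.keys (scal c f) \<subseteq> Poly_Mapping.keys f" by (auto simp: in_keys_iff)
  moreover have "xpow b * scal c f \<in> I" if "b \<in> mons_deg n k" for b
    using ideal_scal[OF I k[OF that]] by (simp add: xpow_mult_scal)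
  ultimately show "scal c f \<in> saturation n I" by (intro saturationI[of _ n k]) auto
next
  fix u f assume u: "u \<in> mons n" and f: "f \<in> saturation n I"
  obtain k where "Poly_Mapping.keys f \<subseteq> mons n" and k: "\<And>b. b \<in> mons_deg n k \<Longrightarrow> xpow b * f \<in> I"
    using saturationE[OF f] by blast
  moreover have "xpow b * (xpow u * f) \<in> I" if "b \<in> mons_deg n k" for b
    using ideal_xpow_mult[OF I k[OF that] u] by (simp add: mult.left_commute)
  ultimately show "xpow u * f \<in> saturation n I"
    using u by (intro saturationI[of _ n k]) (auto simp: keys_xpow_mult intro: mons_add)
qed (auto simp: saturation_def ideal_zero[OF I])

text \<open>Finitely many monomials of degree \<open>k\<close> each come with an exponent that brings their product with \<open>f\<close>
  into \<open>I\<close>; the sum of these exponents serves all of them.\<close>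

lemma saturation_idem:
  assumes I: "ideal I (mpoly_ring n)"
  shows "saturation n (saturation n I) = saturation n I"
proof (intro equalityI subset_saturation ideal_saturation I subsetI)
  fix f assume "f \<in> saturation n (saturation n I)"
  then obtain k where f: "Poly_Mapping.keys f \<subseteq> mons n"
    and k: "\<And>a. a \<in> mons_deg n k \<Longrightarrow> \<exists>l. \<forall>b\<in>mons_deg n l. xpow b * (xpow a * f) \<in> I"
    by (auto simp: saturation_def)
  from k have "\<exists>l. \<forall>a\<in>mons_deg n k. \<forall>b\<in>mons_deg n (l a). xpow b * (xpow a * f) \<in> I"
    by (intro bchoice ballI)
  then obtain l where l: "\<And>a b. a \<in> mons_deg n k \<Longrightarrow> b \<in> mons_deg n (l a) \<Longrightarrow> xpow b * (xpow a * f) \<in> I"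
    by blast
  let ?L = "sum l (mons_deg n k)"
  have "xpow b * f \<in> I" if b: "b \<in> mons_deg n (k + ?L)" for b
  proof -
    obtain a c where ac: "a \<in> mons_deg n k" "c \<in> mons_deg n ?L" "b = a + c"
      using b by (rule mons_deg_split)
    have "l a \<le> ?L" using ac finite_mons_deg by (intro member_le_sum) auto
    from saturation_mono_exponent[OF I this l[OF ac(1)] ac(2)]
    show ?thesis by (simp add: ac(3) xpow_add mult_ac)
  qed
  then show "f \<in> saturation n I" using f by (intro saturationI[of _ n "k + ?L"]) auto
qed

lemma homog_ideal_saturation:
  assumes "homog_ideal n I"
  shows "homog_ideal n (saturation n I)"
proof -
  have I: "ideal I (mpoly_ring n)" and hcomp: "\<And>f d. f \<in> I \<Longrightarrow> hcomp d f \<in> I"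
    using assms by (auto simp: homog_ideal_def)
  have "hcomp d f \<in> saturation n I" if f_sat: "f \<in> saturation n I" for f d
  proof -
    obtain k where k: "\<And>b. b \<in> mons_deg n k \<Longrightarrow> xpow b * f \<in> I" and f: "Poly_Mapping.keys f \<subseteq> mons n"
      using saturationE[OF f_sat] by blast
    have "xpow b * hcomp d f \<in> I" if "b \<in> mons_deg n k" for b
      using hcomp[OF k[OF that], of "mdeg b + d"] by (simp add: hcomp_xpow_mult)
    then show ?thesis using f by (intro saturationI[of _ n k]) (auto simp: keys_hcomp)
  qed
  then show ?thesis using ideal_saturation[OF I] by (simp add: homog_ideal_def)
qed

lemma saturation_truncation:
  assumes I: "ideal I (mpoly_ring n)" and sat: "saturation n I = I"
  shows "saturation n (truncation r I) = I"
proof (intro equalityI subsetI)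
  fix f assume "f \<in> saturation n (truncation r I)"
  then have "f \<in> saturation n I" by (auto simp: saturation_def truncation_def)
  then show "f \<in> I" by (simp add: sat)
next
  fix f assume f: "f \<in> I"
  then have "\<forall>a\<in>mons_deg n r. xpow a * f \<in> truncation r I"
    by (auto simp: truncation_def keys_xpow_mult mons_deg_def ideal_xpow_mult[OF I])
  then show "f \<in> saturation n (truncation r I)"
    using ideal_keys[OF I f] by (auto simp: saturation_def)
qed

subsection \<open>Bases modulo a subspace\<close>

text \<open>Each element of \<open>C\<close> is congruent modulo \<open>W\<close> to a combination \<open>h x\<close> of elements of \<open>B\<close>.  A linear relation
  among the \<open>h x\<close> puts the same combination of \<open>C\<close> into \<open>W\<close>, where the uniqueness of coefficients makes it
  trivial; so the \<open>h x\<close> are independent vectors in the span of \<open>B\<close>.\<close>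

lemma basis_mod_card_le:
  fixes V W :: "'a::field mpol set"
  assumes V: "0 \<in> V" and W: "0 \<in> W" "\<And>f g. f \<in> W \<Longrightarrow> g \<in> W \<Longrightarrow> f + g \<in> W" "\<And>c f. f \<in> W \<Longrightarrow> scal c f \<in> W"
    and B: "basis_mod V W B" and C: "basis_mod V W C"
  shows "card C \<le> card B"
proof -
  interpret vs: vector_space "scal :: 'a \<Rightarrow> 'a mpol \<Rightarrow> 'a mpol" by (rule vector_space_scal)
  have fin: "finite B" "finite C" and CV: "C \<subseteq> V" using B C by (auto simp: basis_mod_def)
  have indep: "d x = 0" if "(\<Sum>x\<in>C. scal (d x) x) \<in> W" "x \<in> C" for d x
  proof -
    let ?d = "\<lambda>x. if x \<in> C then - d x else 0"
    have "(\<Sum>x\<in>C. scal (?d x) x) = - (\<Sum>x\<in>C. scal (d x) x)"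
      unfolding sum_negf[symmetric] by (intro sum.cong) auto
    then have d: "0 - (\<Sum>x\<in>C. scal (?d x) x) \<in> W" using that(1) by simp
    have uniq: "c = c'" if "\<forall>b. b \<notin> C \<longrightarrow> c b = 0" "0 - (\<Sum>b\<in>C. scal (c b) b) \<in> W"
        "\<forall>b. b \<notin> C \<longrightarrow> c' b = 0" "0 - (\<Sum>b\<in>C. scal (c' b) b) \<in> W" for c c'
      using C V that unfolding basis_mod_def by blast
    have "?d = (\<lambda>_. 0)"
      by (rule uniq[OF _ d]) (use W in auto)
    then have "?d x = 0" by (rule fun_cong)
    then show ?thesis using that by simp
  qed
  have "\<forall>x\<in>C. \<exists>c. x - (\<Sum>b\<in>B. scal (c b) b) \<in> W"
    using B CV unfolding basis_mod_def by blast
  then have "\<exists>c. \<forall>x\<in>C. x - (\<Sum>b\<in>B. scal (c x b) b) \<in> W" by (rule bchoice)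
  then obtain c where c: "\<And>x. x \<in> C \<Longrightarrow> x - (\<Sum>b\<in>B. scal (c x b) b) \<in> W" by blast
  define h where "h x = (\<Sum>b\<in>B. scal (c x b) b)" for x
  have h: "x - h x \<in> W" if "x \<in> C" for x using c[OF that] by (simp add: h_def)
  have Wsum: "sum F S \<in> W" if "\<And>x. x \<in> S \<Longrightarrow> F x \<in> W" for F and S :: "'a mpol set"
    using that by (induction S rule: infinite_finite_induct) (auto intro: W)
  have lin: "(\<Sum>x\<in>C. scal (d x) x) \<in> W" if "(\<Sum>x\<in>C. scal (d x) (h x)) = 0" for d
  proof -
    have "(\<Sum>x\<in>C. scal (d x) x) = (\<Sum>x\<in>C. scal (d x) (x - h x))"
      using that by (simp add: vs.scale_right_diff_distrib sum_subtractf)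
    then show ?thesis using Wsum[of C] W(3)[OF h] by simp
  qed
  have inj: "inj_on h C"
  proof (rule inj_onI, rule ccontr)
    fix x y assume xy: "x \<in> C" "y \<in> C" "h x = h y" "x \<noteq> y"
    define d where "d z = (if z = x then 1 else if z = y then - 1 else 0 :: 'a)" for z
    have "(\<Sum>z\<in>C. scal (d z) (h z)) = (\<Sum>z\<in>{x, y}. scal (d z) (h z))"
      using xy fin by (intro sum.mono_neutral_right) (auto simp: d_def)
    also have "\<dots> = 0" using xy by (simp add: d_def)
    finally have "d x = 0" using indep[OF lin] xy by blast
    then show False by (simp add: d_def)
  qed
  have "vs.independent (h ` C)"
  proof
    assume "vs.dependent (h ` C)"
    then obtain u where u: "\<exists>v\<in>h ` C. u v \<noteq> 0" "(\<Sum>v\<in>h ` C. scal (u v) v) = 0"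
      using fin by (auto simp: vs.dependent_finite)
    have "(\<Sum>x\<in>C. scal (u (h x)) (h x)) = 0" using u(2) inj by (simp add: sum.reindex)
    then show False using indep[OF lin[of "\<lambda>x. u (h x)"]] u(1) by auto
  qed
  moreover have "h ` C \<subseteq> vs.span B"
  proof (rule image_subsetI)
    show "h x \<in> vs.span B" for x
      unfolding h_def by (rule vs.span_sum) (rule vs.span_scale, rule vs.span_base)
  qed
  ultimately have "card (h ` C) \<le> card B" using vs.independent_span_bound[OF fin(1)] by blast
  then show ?thesis using inj by (simp add: card_image)
qed

lemma basis_mod_card_eq:
  fixes V W :: "'a::field mpol set"
  assumes "0 \<in> V" "0 \<in> W" "\<And>f g. f \<in> W \<Longrightarrow> g \<in> W \<Longrightarrow> f + g \<in> W" "\<And>c f. f \<in> W \<Longrightarrow> scal c f \<in> W"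
    and "basis_mod V W B" "basis_mod V W C"
  shows "card B = card C"
  using basis_mod_card_le[OF assms(1-4)] assms(5,6) by (meson le_antisym)

lemma basis_mod_xpow:
  fixes V W :: "'a::field mpol set"
  assumes "finite C" "xpow ` C \<subseteq> V"
    and reduce: "\<And>f. f \<in> V \<Longrightarrow> \<exists>g. Poly_Mapping.keys g \<subseteq> C \<and> f - g \<in> W"
    and diff: "\<And>f g. f \<in> W \<Longrightarrow> g \<in> W \<Longrightarrow> f - g \<in> W"
    and unique: "\<And>g. g \<in> W \<Longrightarrow> Poly_Mapping.keys g \<subseteq> C \<Longrightarrow> g = 0"
  shows "basis_mod V W (xpow ` C)"
  unfolding basis_mod_def
proof (intro conjI ballI)
  fix f assume f: "f \<in> V"
  have sum_eq: "(\<Sum>b\<in>xpow ` C. scal (c b) b) = (\<Sum>u\<in>C. scal (c (xpow u)) (xpow u))" for c :: "'a mpol \<Rightarrow> 'a"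
    by (subst sum.reindex) (auto intro: inj_on_subset[OF inj_xpow])
  obtain g where g: "Poly_Mapping.keys g \<subseteq> C" "f - g \<in> W" using reduce[OF f] by blast
  show "\<exists>!c. (\<forall>b. b \<notin> xpow ` C \<longrightarrow> c b = 0) \<and> f - (\<Sum>b\<in>xpow ` C. scal (c b) b) \<in> W"
  proof (rule ex1I)
    let ?c = "\<lambda>b. if b \<in> xpow ` C then Poly_Mapping.lookup g (inv_into UNIV xpow b) else 0"
    have "(\<Sum>b\<in>xpow ` C. scal (?c b) b) = g"
      unfolding sum_eq using assms(1) g(1)
      by (intro poly_mapping_eqI) (auto simp: lookup_sum_scal_xpow inv_f_f[OF inj_xpow] in_keys_iff)
    then show "(\<forall>b. b \<notin> xpow ` C \<longrightarrow> ?c b = 0) \<and> f - (\<Sum>b\<in>xpow ` C. scal (?c b) b) \<in> W"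
      using g by auto
    fix c assume c: "(\<forall>b. b \<notin> xpow ` C \<longrightarrow> c b = 0) \<and> f - (\<Sum>b\<in>xpow ` C. scal (c b) b) \<in> W"
    let ?g = "\<Sum>u\<in>C. scal (c (xpow u)) (xpow u)"
    have lookup: "Poly_Mapping.lookup ?g v = (if v \<in> C then c (xpow v) else 0)" for v
      using assms(1) by (simp add: lookup_sum_scal_xpow)
    have "f - ?g \<in> W" using c by (simp add: sum_eq)
    then have "?g - g \<in> W" using diff[OF g(2), of "f - ?g"] by simp
    moreover have "Poly_Mapping.keys (?g - g) \<subseteq> C"
      using g(1) by (auto simp: in_keys_iff lookup_minus lookup split: if_splits)
    ultimately have "?g = g" using unique by fastforce
    then have "c (xpow v) = Poly_Mapping.lookup g v" if "v \<in> C" for v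
      using lookup[of v] that by simp
    then have "c b = ?c b" if "b \<in> xpow ` C" for b
      using that by (auto simp: inv_f_f[OF inj_xpow])
    then show "c = ?c" using c by (intro ext) (metis (full_types))
  qed
qed (use assms in auto)

text \<open>The coefficients at the monomials of \<open>G\<close> are coordinates dual to the vectors \<open>w g\<close>.\<close>

lemma basis_mod_zero:
  fixes V :: "'a::field mpol set" and w :: "mon \<Rightarrow> 'a mpol"
  assumes "finite G" "w ` G \<subseteq> V"
    and dual: "\<And>g h. g \<in> G \<Longrightarrow> h \<in> G \<Longrightarrow> Poly_Mapping.lookup (w g) h = (if h = g then 1 else 0)"
    and span: "\<And>f. f \<in> V \<Longrightarrow> f = (\<Sum>g\<in>G. scal (Poly_Mapping.lookup f g) (w g))"
  shows "inj_on w G" "basis_mod V {0} (w ` G)"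
proof -
  show inj: "inj_on w G"
    by (rule inj_onI) (metis dual zero_neq_one)
  show "basis_mod V {0} (w ` G)"
    unfolding basis_mod_def
  proof (intro conjI ballI)
    fix f assume f: "f \<in> V"
    have sum_eq: "(\<Sum>b\<in>w ` G. scal (c b) b) = (\<Sum>g\<in>G. scal (c (w g)) (w g))" for c :: "'a mpol \<Rightarrow> 'a"
      using inj by (simp add: sum.reindex)
    show "\<exists>!c. (\<forall>b. b \<notin> w ` G \<longrightarrow> c b = 0) \<and> f - (\<Sum>b\<in>w ` G. scal (c b) b) \<in> {0}"
    proof (rule ex1I)
      let ?c = "\<lambda>b. if b \<in> w ` G then Poly_Mapping.lookup f (the_inv_into G w b) else 0"
      have "(\<Sum>b\<in>w ` G. scal (?c b) b) = (\<Sum>g\<in>G. scal (Poly_Mapping.lookup f g) (w g))"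
        unfolding sum_eq by (intro sum.cong) (auto simp: the_inv_into_f_f[OF inj])
      then show "(\<forall>b. b \<notin> w ` G \<longrightarrow> ?c b = 0) \<and> f - (\<Sum>b\<in>w ` G. scal (?c b) b) \<in> {0}"
        using span[OF f] by simp
      fix c assume c: "(\<forall>b. b \<notin> w ` G \<longrightarrow> c b = 0) \<and> f - (\<Sum>b\<in>w ` G. scal (c b) b) \<in> {0}"
      have "Poly_Mapping.lookup f h = c (w h)" if "h \<in> G" for h
      proof -
        have "f = (\<Sum>g\<in>G. scal (c (w g)) (w g))" using c by (simp add: sum_eq)
        then have "Poly_Mapping.lookup f h = (\<Sum>g\<in>G. c (w g) * Poly_Mapping.lookup (w g) h)"
          by (simp add: lookup_sum)
        also have "\<dots> = (\<Sum>g\<in>G. if h = g then c (w g) else 0)"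
          using that by (intro sum.cong) (auto simp: dual)
        finally show ?thesis using that assms(1) by simp
      qed
      then have "c b = ?c b" if "b \<in> w ` G" for b
        using that by (auto simp: the_inv_into_f_f[OF inj])
      then show "c = ?c" using c by (intro ext) (metis (full_types))
    qed
  qed (use assms in auto)
qed

subsection \<open>Monomial ideals and their Hilbert polynomials\<close>

definition supported_on :: "mon set \<Rightarrow> 'a::zero mpol set" where
  "supported_on A = {f. Poly_Mapping.keys f \<subseteq> A}"

lemma deg_part_iff:
  "f \<in> deg_part I t \<longleftrightarrow> f \<in> I \<and> (\<forall>v\<in>Poly_Mapping.keys f. mdeg v = t)"
  by (simp add: deg_part_def homog_of_deg_def)

lemma keys_scal_subset: "Poly_Mapping.keys (scal c f) \<subseteq> Poly_Mapping.keys f"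
  by (auto simp: in_keys_iff)

lemma basis_mod_supported_on:
  fixes A :: "mon set"
  assumes "A \<subseteq> mons n"
  shows "basis_mod (deg_part (carrier (mpoly_ring n :: 'a::field mpol ring)) t) (deg_part (supported_on A) t)
    (xpow ` {a \<in> mons n. mdeg a = t \<and> a \<notin> A})"
proof (rule basis_mod_xpow)
  show "finite {a \<in> mons n. mdeg a = t \<and> a \<notin> A}"
    by (rule finite_subset[OF _ finite_mons_deg[of n t]]) (auto simp: mons_deg_def)
  fix f :: "'a mpol" assume f: "f \<in> deg_part (carrier (mpoly_ring n)) t"
  let ?g = "\<Sum>u\<in>Poly_Mapping.keys f - A. scal (Poly_Mapping.lookup f u) (xpow u)"
  have g: "Poly_Mapping.lookup ?g v = (if v \<in> A then 0 else Poly_Mapping.lookup f v)" for v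
    by (simp add: lookup_sum_scal_xpow in_keys_iff)
  show "\<exists>g. Poly_Mapping.keys g \<subseteq> {a \<in> mons n. mdeg a = t \<and> a \<notin> A} \<and> f - g \<in> deg_part (supported_on A) t"
    using f by (intro exI[of _ ?g])
      (auto simp: deg_part_iff supported_on_def in_keys_iff g lookup_minus subset_iff split: if_splits)
next
  fix f g :: "'a mpol" assume "f \<in> deg_part (supported_on A) t" "g \<in> deg_part (supported_on A) t"
  then show "f - g \<in> deg_part (supported_on A) t"
    using keys_diff[of f g] unfolding deg_part_iff supported_on_def by blast
next
  fix g :: "'a mpol"
  assume g: "g \<in> deg_part (supported_on A) t" "Poly_Mapping.keys g \<subseteq> {a \<in> mons n. mdeg a = t \<and> a \<notin> A}"
  then have "Poly_Mapping.keys g = {}" unfolding deg_part_iff supported_on_def by blast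
  then show "g = 0" by simp
qed (auto simp: deg_part_iff)

lemma card_xpow_image: "card (xpow ` C :: 'a::field mpol set) = card C"
  by (intro card_image inj_on_subset[OF inj_xpow]) auto

lemma hilb_fun_of_hilbert_poly:
  assumes A: "A \<subseteq> mons n" and p: "has_hilbert_poly n (supported_on A :: 'a::field mpol set) p"
  shows "\<forall>\<^sub>F t in sequentially. of_nat (hilb_fun 0 n A t) = poly p (of_nat t)"
  using p unfolding has_hilbert_poly_def
proof (rule eventually_mono)
  fix t
  let ?V = "deg_part (carrier (mpoly_ring n :: 'a mpol ring)) t"
  let ?W = "deg_part (supported_on A :: 'a mpol set) t"
  assume "\<exists>B. basis_mod ?V ?W B \<and> of_nat (card B) = poly p (of_nat t)"
  then obtain B where B: "basis_mod ?V ?W B" "of_nat (card B) = poly p (of_nat t)" by blast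
  have "card B = card (xpow ` {a \<in> mons n. mdeg a = t \<and> a \<notin> A} :: 'a mpol set)"
  proof (rule basis_mod_card_eq[OF _ _ _ _ B(1) basis_mod_supported_on[OF A]])
    fix f g :: "'a mpol" assume "f \<in> ?W" "g \<in> ?W"
    then show "f + g \<in> ?W"
      using keys_add[of f g] unfolding deg_part_iff supported_on_def by blast
  next
    fix c and f :: "'a mpol" assume "f \<in> ?W"
    then show "scal c f \<in> ?W"
      using keys_scal_subset[of c f] unfolding deg_part_iff supported_on_def by blast
  qed (auto simp: deg_part_iff supported_on_def)
  then show "of_nat (hilb_fun 0 n A t) = poly p (of_nat t)"
    using B(2) by (simp add: card_xpow_image hilb_fun_def mons_from_0)
qed

text \<open>At integers \<open>t \<ge> r\<close> all upper entries of the generalised binomial coefficients are natural numbers.\<close>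

lemma gotzmann_number_sum:
  assumes "is_gotzmann_number p r"
  obtains as where "length as = r" "sorted_wrt (\<ge>) as"
    "\<And>t. r \<le> t \<Longrightarrow> poly p (of_nat t) = of_nat (gotz_sum as t)"
proof -
  obtain a :: "nat \<Rightarrow> nat" where mono: "\<And>i j. 1 \<le> i \<Longrightarrow> i \<le> j \<Longrightarrow> j \<le> r \<Longrightarrow> a j \<le> a i"
    and p: "\<And>t. poly p t = (\<Sum>i = 1..r. (t + of_nat (a i) - of_nat i + 1) gchoose (a i))"
    using assms unfolding is_gotzmann_number_def by blast
  let ?as = "map (\<lambda>i. a (Suc i)) [0..<r]"
  have "poly p (of_nat t) = of_nat (gotz_sum ?as t)" if t: "r \<le> t" for t
  proof -
    have "poly p (of_nat t) = (\<Sum>i<r. (of_nat t + of_nat (a (Suc i)) - of_nat (Suc i) + 1) gchoose (a (Suc i)))"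
      unfolding p One_nat_def by (rule sum.atLeast1_atMost_eq)
    also have "\<dots> = (\<Sum>i<r. of_nat ((t - i + a (Suc i)) choose a (Suc i)))"
    proof (rule sum.cong[OF refl])
      fix i assume "i \<in> {..<r}"
      then have "of_nat t + of_nat (a (Suc i)) - of_nat (Suc i) + 1 = (of_nat (t - i + a (Suc i)) :: rat)"
        using t by (simp add: of_nat_diff)
      then show "(of_nat t + of_nat (a (Suc i)) - of_nat (Suc i) + 1) gchoose (a (Suc i)) =
          (of_nat ((t - i + a (Suc i)) choose a (Suc i)) :: rat)"
        by (simp only: binomial_gbinomial)
    qed
    also have "\<dots> = of_nat (gotz_sum ?as t)"
      using t by (subst gotz_sum_all) (auto simp: of_nat_sum)
    finally show ?thesis .
  qed
  moreover have "sorted_wrt (\<ge>) ?as"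
    unfolding sorted_wrt_iff_nth_less using mono by auto
  ultimately show ?thesis by (intro that[of ?as]) auto
qed

text \<open>The representation found by induction on the variables must be that of the Hilbert polynomial,
  so its length is the Gotzmann number.\<close>

lemma generated_upto_gotzmann_number:
  assumes "borel_set 0 n A" "\<And>a. a + var 0 \<in> A \<Longrightarrow> a \<in> A"
    and p: "\<forall>\<^sub>F t in sequentially. of_nat (hilb_fun 0 n A t) = poly p (of_nat t)"
    and r: "is_gotzmann_number p r"
  shows "generated_upto 0 n A r"
proof -
  obtain bs where bs: "sorted_wrt (\<ge>) bs" "\<And>t. length bs \<le> Suc t \<Longrightarrow> hilb_fun 0 n A t = gotz_sum bs t"
      "generated_upto 0 n A (length bs)"
    using gotzmann_regularity[of 0 n A] assms(1,2) by blast
  obtain as where as: "length as = r" "sorted_wrt (\<ge>) as"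
      "\<And>t. r \<le> t \<Longrightarrow> poly p (of_nat t) = of_nat (gotz_sum as t)"
    using gotzmann_number_sum[OF r] by blast
  have "\<forall>\<^sub>F t in sequentially. of_nat (hilb_fun 0 n A t) = poly p (of_nat t) \<and> max r (length bs) \<le> t"
    using p eventually_ge_at_top[of "max r (length bs)"] by (rule eventually_conj)
  then obtain t where t: "of_nat (hilb_fun 0 n A t) = poly p (of_nat t)" "max r (length bs) \<le> t"
    using eventually_happens'[OF sequentially_bot] by blast
  then have "gotz_sum as t = gotz_sum bs t" using as(3)[of t] bs(2)[of t] by simp
  then have "as = bs" using t as bs by (intro gotz_sum_inj[of _ _ t]) auto
  then show ?thesis using bs(3) as(1) by simp
qed

lemma S_set_obtains:
  fixes J :: "'a::field mpol set"
  assumes J: "J \<in> S_set n p r" and r: "is_gotzmann_number p r"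
  obtains A where "borel_set 0 n A" "\<And>a. a + var 0 \<in> A \<Longrightarrow> a \<in> A" "generated_upto 0 n A r"
    "\<forall>\<^sub>F t in sequentially. of_nat (hilb_fun 0 n A t) = poly p (of_nat t)"
    "\<And>m. r \<le> m \<Longrightarrow> deg_mons_in n m J = {g \<in> A. mdeg g = m}"
    "hilb_point n J = supported_on A" "supported_on A \<in> (Hilb n p :: 'a mpol set set)"
proof -
  obtain I where JI: "J = truncation r I" and I: "strongly_stable n I" "saturation n I = I" "has_hilbert_poly n I p"
    using J by (auto simp: S_set_def)
  have ideal: "ideal I (mpoly_ring n)" and mono: "monomial_ideal n I"
    using I by (auto simp: strongly_stable_def monomial_ideal_def)
  define A where "A = {a \<in> mons n. xpow a \<in> I}"
  have IA: "I = supported_on A"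
    using monomial_ideal_eq[OF mono] by (simp add: supported_on_def A_def)
  note bs = strongly_stable_borel_set[OF I(1,2), folded A_def]
  have hp: "\<forall>\<^sub>F t in sequentially. of_nat (hilb_fun 0 n A t) = poly p (of_nat t)"
  proof (rule hilb_fun_of_hilbert_poly)
    show "A \<subseteq> mons n" by (auto simp: A_def)
    show "has_hilbert_poly n (supported_on A :: 'a mpol set) p" using I(3) by (simp only: IA)
  qed
  have "homog_ideal n I"
    using ideal unfolding homog_ideal_def by (auto simp: IA supported_on_def keys_hcomp)
  then have "supported_on A \<in> (Hilb n p :: 'a mpol set set)" using I(2,3) IA by (simp add: Hilb_def)
  moreover have "hilb_point n J = supported_on A"
    using saturation_truncation[OF ideal I(2)] by (simp add: hilb_point_def JI IA)
  moreover have "deg_mons_in n m J = {g \<in> A. mdeg g = m}" if "r \<le> m" for m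
    using that by (auto simp: deg_mons_in_def mons_deg_def JI truncation_def A_def)
  ultimately show ?thesis
    using that bs generated_upto_gotzmann_number[OF bs hp r] hp by blast
qed

section \<open>The family of ideals joining the two points\<close>

context borel_pair
begin

text \<open>The ideal \<open>I\<^sub>y\<close>, given by conditions on coefficients instead of generators: membership in it is
  then decided coefficient by coefficient.\<close>

definition fam :: "'b::field \<Rightarrow> 'b mpol set" where
  "fam y = {f. Poly_Mapping.keys f \<subseteq> {v \<in> A \<union> A'. r \<le> mdeg v} \<and>
     (\<forall>v\<in>A - A'. r \<le> mdeg v \<longrightarrow> Poly_Mapping.lookup f (shift v) = y * Poly_Mapping.lookup f v)}"

definition fam_gen :: "'b::field \<Rightarrow> mon \<Rightarrow> 'b mpol" where
  "fam_gen y g = xpow g + (if g \<in> A - A' then scal y (xpow (shift g)) else 0)"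

lemma A_mons: "A \<subseteq> mons n" "A' \<subseteq> mons n"
  using borel by (auto simp: borel_set_def mons_from_0)

lemma A_add: "v \<in> A \<Longrightarrow> u \<in> mons n \<Longrightarrow> v + u \<in> A" "v \<in> A' \<Longrightarrow> u \<in> mons n \<Longrightarrow> v + u \<in> A'"
  using borel_set_add[OF borel(1)] borel_set_add[OF borel(2)] by (auto simp: mons_from_0)

lemma famI:
  assumes "\<And>v. Poly_Mapping.lookup f v \<noteq> 0 \<Longrightarrow> v \<in> A \<union> A' \<and> r \<le> mdeg v"
    and "\<And>v. v \<in> A - A' \<Longrightarrow> r \<le> mdeg v \<Longrightarrow> Poly_Mapping.lookup f (shift v) = y * Poly_Mapping.lookup f v"
  shows "f \<in> fam y"
  using assms unfolding fam_def by (auto simp: in_keys_iff)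

lemma
  assumes "f \<in> fam y"
  shows fam_support: "Poly_Mapping.lookup f v \<noteq> 0 \<Longrightarrow> v \<in> A \<union> A' \<and> r \<le> mdeg v"
    and fam_shift: "v \<in> A - A' \<Longrightarrow> r \<le> mdeg v \<Longrightarrow> Poly_Mapping.lookup f (shift v) = y * Poly_Mapping.lookup f v"
  using assms unfolding fam_def by (auto simp: in_keys_iff subset_iff)

lemma fam_diff:
  assumes "f \<in> fam y" "g \<in> fam y"
  shows "f - g \<in> fam y"
proof (rule famI)
  fix v assume "Poly_Mapping.lookup (f - g) v \<noteq> 0"
  then have "Poly_Mapping.lookup f v \<noteq> 0 \<or> Poly_Mapping.lookup g v \<noteq> 0" by (auto simp: lookup_minus)
  then show "v \<in> A \<union> A' \<and> r \<le> mdeg v" using fam_support assms by blast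
next
  fix v assume "v \<in> A - A'" "r \<le> mdeg v"
  then show "Poly_Mapping.lookup (f - g) (shift v) = y * Poly_Mapping.lookup (f - g) v"
    using assms by (simp add: lookup_minus fam_shift algebra_simps)
qed

lemma shift_add:
  assumes "w \<in> A - A'" "r \<le> mdeg w"
  shows "shift (u + w) = u + shift w"
  using shift(2)[OF assms] by (intro shift_eqI) (simp add: add.assoc)

text \<open>That \<open>fam y\<close> is closed under multiplication rests on the translation being a bijection between \<open>A - A'\<close>
  and \<open>A' - A\<close> in all degrees: the two coefficients linked by the translation come from two
  coefficients of \<open>f\<close> that are linked in the same way.\<close>

lemma fam_xpow_mult:
  assumes u: "u \<in> mons n" and f: "f \<in> fam y"
  shows "xpow u * f \<in> fam y"
proof (rule famI)
  fix v assume v: "Poly_Mapping.lookup (xpow u * f) v \<noteq> 0"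
  then obtain w where w: "v = u + w" using lookup_xpow_mult_notin by blast
  then have "w \<in> A \<union> A' \<and> r \<le> mdeg w" using v by (intro fam_support[OF f]) simp
  then show "v \<in> A \<union> A' \<and> r \<le> mdeg v"
    using A_add u w by (auto simp: add.commute[of u])
next
  fix v assume v: "v \<in> A - A'" "r \<le> mdeg v"
  show "Poly_Mapping.lookup (xpow u * f) (shift v) = y * Poly_Mapping.lookup (xpow u * f) v"
  proof (cases "\<exists>w. v = u + w \<and> w \<in> A \<and> r \<le> mdeg w")
    case True
    then obtain w where w: "v = u + w" "w \<in> A" "r \<le> mdeg w" by blast
    have "w \<notin> A'" using v(1) w(1) A_add(2) u by (auto simp: add.commute[of u])
    then show ?thesis
      using w fam_shift[OF f, of w] shift_add[of w u] by simp
  next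
    case False
    \<comment> \<open>Both coefficients vanish: a contribution to the left-hand one would come from an element of
      \<open>A' - A\<close>, whose translate back divides \<open>v\<close> with quotient \<open>u\<close>.\<close>
    have "Poly_Mapping.lookup (xpow u * f) v = 0"
    proof (rule ccontr)
      assume nz: "Poly_Mapping.lookup (xpow u * f) v \<noteq> 0"
      then obtain w where w: "v = u + w" using lookup_xpow_mult_notin by blast
      then have "w \<in> A \<union> A' \<and> r \<le> mdeg w" using nz by (intro fam_support[OF f]) simp
      moreover have "w \<notin> A'" using v(1) w A_add(2) u by (auto simp: add.commute[of u])
      ultimately show False using False w by blast
    qed
    moreover have "Poly_Mapping.lookup (xpow u * f) (shift v) = 0"
    proof (rule ccontr)
      assume nz: "Poly_Mapping.lookup (xpow u * f) (shift v) \<noteq> 0"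
      then obtain w' where w': "shift v = u + w'" using lookup_xpow_mult_notin by blast
      then have "w' \<in> A \<union> A' \<and> r \<le> mdeg w'" using nz by (intro fam_support[OF f]) simp
      moreover have "w' \<notin> A" using shift(1)[OF v] w' A_add(1) u by (auto simp: add.commute[of u])
      ultimately have w'_in: "w' \<in> A' - A" "r \<le> mdeg w'" by auto
      have "v + a' = (u + unshift w') + a'"
        using shift(2)[OF v] unshift(2)[OF w'_in] w' by (metis add.assoc)
      then have "v = u + unshift w'" by simp
      then show False using False unshift(1,3)[OF w'_in] w'_in(2) by auto
    qed
    ultimately show ?thesis by simp
  qed
qed

lemma fam_ideal: "ideal (fam y) (mpoly_ring n)"
proof (rule ideal_mpoly_ringI)
  fix f assume "f \<in> fam y"
  then show "Poly_Mapping.keys f \<subseteq> mons n" using A_mons by (auto simp: fam_def)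
next
  fix f g assume fg: "f \<in> fam y" "g \<in> fam y"
  have "0 - g \<in> fam y" by (rule fam_diff[OF _ fg(2)]) (auto simp: fam_def)
  then have "f - (0 - g) \<in> fam y" by (rule fam_diff[OF fg(1)])
  then show "f + g \<in> fam y" by simp
next
  fix c f assume f: "f \<in> fam y"
  show "scal c f \<in> fam y"
    by (rule famI) (use fam_support[OF f] fam_shift[OF f] in auto)
qed (simp add: fam_def, rule fam_xpow_mult)

lemma fam_gen_lookup:
  assumes "g \<in> A" "r \<le> mdeg g"
  shows "Poly_Mapping.lookup (fam_gen y g) v =
    (if v = g then 1 else if g \<in> A - A' \<and> v = shift g then y else 0)"
proof -
  have "shift g \<noteq> g" if "g \<in> A - A'" using shift(1)[OF that assms(2)] assms(1) by auto
  then show ?thesis by (auto simp: fam_gen_def lookup_add lookup_xpow)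
qed

lemma fam_gen_mem:
  assumes "g \<in> A" "r \<le> mdeg g"
  shows "fam_gen y g \<in> fam y"
proof (rule famI)
  fix v assume "Poly_Mapping.lookup (fam_gen y g) v \<noteq> 0"
  then have "v = g \<or> g \<in> A - A' \<and> v = shift g"
    by (auto simp: fam_gen_lookup[OF assms] split: if_splits)
  then show "v \<in> A \<union> A' \<and> r \<le> mdeg v"
    using assms shift(1,3)[of g] by auto
next
  fix v assume v: "v \<in> A - A'" "r \<le> mdeg v"
  have "shift v \<noteq> g" using shift(1)[OF v] assms(1) by auto
  moreover have "v \<noteq> shift g" if "g \<in> A - A'" using shift(1)[OF that assms(2)] v(1) by auto
  moreover have "v = g" if "g \<in> A - A'" "shift v = shift g"
    using shift(4)[OF v] shift(4)[OF that(1) assms(2)] unfolding that(2) by (rule subst)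
  ultimately show "Poly_Mapping.lookup (fam_gen y g) (shift v) = y * Poly_Mapping.lookup (fam_gen y g) v"
    using v by (auto simp: fam_gen_lookup[OF assms])
qed

text \<open>Removing the least variable stays in \<open>A\<close> and in \<open>A'\<close> simultaneously.\<close>

lemma generated_upto_Int: "generated_upto 0 n (A \<inter> A') r"
  unfolding generated_upto_def
proof (intro ballI impI)
  fix v assume v: "v \<in> A \<inter> A'" "r < mdeg v"
  let ?i = "Min (Poly_Mapping.keys v)"
  obtain w where w: "v = w + var ?i" and least: "\<And>j. j \<in> Poly_Mapping.keys w \<Longrightarrow> ?i \<le> j"
    using split_least[of v] v(2) by (metis less_imp_le)
  have "mdeg v = mdeg w + 1" using arg_cong[OF w, of mdeg] by simp
  then have deg: "r \<le> mdeg w" using v(2) by simp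
  have "w \<in> A"
    by (rule borel_set_remove_least[OF borel(1) gen(1) _ deg least]) (use v w in auto)
  moreover have "w \<in> A'"
    by (rule borel_set_remove_least[OF borel(2) gen(2) _ deg least]) (use v w in auto)
  moreover have "?i \<in> Poly_Mapping.keys v" using keys_nonempty[of v] v(2) by (intro Min_in) auto
  then have "?i \<in> {0..n}" using borel_set_keys(2)[OF borel(1), of v] v(1) by auto
  ultimately show "\<exists>b\<in>A \<inter> A'. \<exists>i\<in>{0..n}. v = b + var i" using w by blast
qed

text \<open>The generator \<open>g\<close> dividing \<open>v\<close> must be taken in \<open>A'\<close> whenever \<open>v\<close> is, for otherwise the translate of \<open>g\<close>
  would contribute a second term.\<close>

lemma obtain_generator:
  assumes v: "v \<in> A" "r \<le> mdeg v"
  obtains g u where "g \<in> A" "mdeg g = r" "u \<in> mons n" "v = g + u" "fam_gen y v = xpow u * fam_gen y g"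
proof -
  obtain g u where g: "g \<in> A" "mdeg g = r" "u \<in> mons n" "v = g + u" "g \<in> A' \<longleftrightarrow> v \<in> A'"
  proof (cases "v \<in> A'")
    case True
    obtain g u where "g \<in> A \<inter> A'" "mdeg g = r" "u \<in> mons_from 0 n" "v = g + u"
      using generated_upto_obtains[OF generated_upto_Int _ _ v(2)] v True A_mons
      by (metis IntI inf.coboundedI1 mons_from_0)
    then show ?thesis using that True by (auto simp: mons_from_0)
  next
    case False
    obtain g u where gu: "g \<in> A" "mdeg g = r" "u \<in> mons_from 0 n" "v = g + u"
      using generated_upto_obtains[OF gen(1) _ v] A_mons by (metis mons_from_0)
    moreover have "g \<notin> A'" using A_add(2)[of g u] gu False by (auto simp: mons_from_0)
    ultimately show ?thesis using that False by (auto simp: mons_from_0)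
  qed
  have "shift v = shift g + u" if "g \<notin> A'"
    using shift_add[of g u] that g by (simp add: add.commute)
  then have "fam_gen y v = xpow u * fam_gen y g"
    using g v by (auto simp: fam_gen_def distrib_left xpow_mult_scal xpow_add[symmetric] add.commute)
  then show ?thesis using that g by blast
qed

text \<open>The coefficients at \<open>A\<close> determine an element of \<open>fam y\<close>, and \<open>fam_gen y v\<close> has the single monomial \<open>v\<close> in
  \<open>A\<close>.\<close>

lemma fam_expansion:
  assumes f: "f \<in> fam y"
  shows "f = (\<Sum>v\<in>Poly_Mapping.keys f \<inter> A. scal (Poly_Mapping.lookup f v) (fam_gen y v))"
proof (rule poly_mapping_eqI)
  fix w
  let ?K = "Poly_Mapping.keys f \<inter> A"
  have K: "v \<in> A" "r \<le> mdeg v" if "v \<in> ?K" for v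
    using that fam_support[OF f, of v] by (auto simp: in_keys_iff)
  have "Poly_Mapping.lookup (\<Sum>v\<in>?K. scal (Poly_Mapping.lookup f v) (fam_gen y v)) w =
      (\<Sum>v\<in>?K. Poly_Mapping.lookup f v * (if w = v then 1 else if v \<in> A - A' \<and> w = shift v then y else 0))"
    unfolding lookup_sum using K by (intro sum.cong) (auto simp: fam_gen_lookup)
  also have "\<dots> = Poly_Mapping.lookup f w"
  proof (cases "w \<in> A")
    case True
    have "(\<Sum>v\<in>?K. Poly_Mapping.lookup f v * (if w = v then 1 else if v \<in> A - A' \<and> w = shift v then y else 0))
        = (\<Sum>v\<in>?K. if w = v then Poly_Mapping.lookup f v else 0)"
      using True K shift(1) by (intro sum.cong) auto
    then show ?thesis using True by (simp add: in_keys_iff)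
  next
    case False
    show ?thesis
    proof (cases "w \<in> A' \<and> r \<le> mdeg w")
      case True
      with False have w: "w \<in> A' - A" "r \<le> mdeg w" by auto
      let ?v = "unshift w"
      have v: "?v \<in> A - A'" "r \<le> mdeg ?v" "shift ?v = w" using unshift[OF w] w by auto
      have "(\<Sum>v\<in>?K. Poly_Mapping.lookup f v * (if w = v then 1 else if v \<in> A - A' \<and> w = shift v then y else 0))
          = (\<Sum>v\<in>?K. if ?v = v then Poly_Mapping.lookup f v * y else 0)"
      proof (rule sum.cong[OF refl])
        fix v assume vK: "v \<in> ?K"
        then have "w \<noteq> v" using False by auto
        moreover have "v \<in> A - A' \<and> w = shift v \<longleftrightarrow> ?v = v"
          using v shift(4)[of v] K[OF vK] by auto
        ultimately show "Poly_Mapping.lookup f v * (if w = v then 1 else if v \<in> A - A' \<and> w = shift v then y else 0)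
            = (if ?v = v then Poly_Mapping.lookup f v * y else 0)" by auto
      qed
      also have "\<dots> = Poly_Mapping.lookup f ?v * y"
        using v(1) by (auto simp: in_keys_iff)
      also have "\<dots> = Poly_Mapping.lookup f w" using fam_shift[OF f v(1,2)] v(3) by (simp add: mult.commute)
      finally show ?thesis .
    next
      case no: False
      then have "Poly_Mapping.lookup f w = 0" using fam_support[OF f, of w] False by auto
      moreover have "(\<Sum>v\<in>?K. Poly_Mapping.lookup f v *
          (if w = v then 1 else if v \<in> A - A' \<and> w = shift v then y else 0)) = 0"
      proof (rule sum.neutral, rule ballI)
        fix v assume vK: "v \<in> ?K"
        have "w \<noteq> v" using K[OF vK] False by auto
        moreover have "w \<noteq> shift v" if "v \<in> A - A'"
          using shift(1,3)[OF that] K[OF vK] no by auto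
        ultimately show "Poly_Mapping.lookup f v *
            (if w = v then 1 else if v \<in> A - A' \<and> w = shift v then y else 0) = 0" by auto
      qed
      ultimately show ?thesis by simp
    qed
  qed
  finally show "Poly_Mapping.lookup f w = Poly_Mapping.lookup (\<Sum>v\<in>?K. scal (Poly_Mapping.lookup f v) (fam_gen y v)) w"
    by simp
qed

lemma genideal_fam_gen:
  fixes y :: "'b::field"
  shows "genideal (mpoly_ring n) (fam_gen y ` {g \<in> A. mdeg g = r}) = fam y"
proof -
  interpret R: cring "mpoly_ring n :: 'b mpol ring" by (rule cring_mpoly_ring)
  let ?S = "fam_gen y ` {g \<in> A. mdeg g = r}"
  have sub: "?S \<subseteq> fam y" using fam_gen_mem by auto
  have carrier: "?S \<subseteq> carrier (mpoly_ring n)"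
  proof
    fix f assume "f \<in> ?S"
    then show "f \<in> carrier (mpoly_ring n)"
      unfolding carrier_mpoly by (rule ideal_keys[OF fam_ideal[of y] subsetD[OF sub]])
  qed
  note I = R.genideal_ideal[OF carrier]
  have gen: "fam_gen y v \<in> genideal (mpoly_ring n) ?S" if v: "v \<in> A" "r \<le> mdeg v" for v
  proof -
    obtain g u where g: "g \<in> A" "mdeg g = r" "u \<in> mons n" "v = g + u"
        "fam_gen y v = xpow u * fam_gen y g"
      by (rule obtain_generator[OF v])
    have "fam_gen y g \<in> genideal (mpoly_ring n) ?S"
      using g(1,2) by (intro subsetD[OF R.genideal_self[OF carrier]]) blast
    then show ?thesis unfolding g(5) by (rule ideal_xpow_mult[OF I _ g(3)])
  qed
  have "f \<in> genideal (mpoly_ring n) ?S" if f: "f \<in> fam y" for f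
  proof -
    have "(\<Sum>v\<in>Poly_Mapping.keys f \<inter> A. scal (Poly_Mapping.lookup f v) (fam_gen y v))
        \<in> genideal (mpoly_ring n) ?S"
    proof (intro ideal_sum[OF I] ideal_scal[OF I] gen)
      fix v assume v: "v \<in> Poly_Mapping.keys f \<inter> A"
      then show "v \<in> A" by simp
      show "r \<le> mdeg v" using v fam_support[OF f, of v] by (simp add: in_keys_iff)
    qed
    then show ?thesis using fam_expansion[OF f] by simp
  qed
  then show ?thesis using R.genideal_minimal[OF fam_ideal sub] by blast
qed

lemma homog_ideal_fam: "homog_ideal n (fam y)"
proof -
  have "hcomp d f \<in> fam y" if f: "f \<in> fam y" for f d
  proof (rule famI)
    fix v assume "Poly_Mapping.lookup (hcomp d f) v \<noteq> 0"
    then show "v \<in> A \<union> A' \<and> r \<le> mdeg v"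
      using fam_support[OF f, of v] by (auto simp: lookup_hcomp split: if_splits)
  next
    fix v assume "v \<in> A - A'" "r \<le> mdeg v"
    then show "Poly_Mapping.lookup (hcomp d f) (shift v) = y * Poly_Mapping.lookup (hcomp d f) v"
      using shift(3)[of v] fam_shift[OF f] by (simp add: lookup_hcomp)
  qed
  then show ?thesis using fam_ideal by (simp add: homog_ideal_def)
qed

text \<open>Modulo \<open>fam y\<close> the monomials of \<open>A \<inter> A'\<close> vanish and one of \<open>A - A'\<close> equals \<open>- y\<close> times its
  translate, which is not in \<open>A\<close>.\<close>

lemma basis_mod_fam:
  fixes y :: "'b::field"
  assumes m: "r \<le> m"
  shows "basis_mod (deg_part (carrier (mpoly_ring n)) m) (deg_part (fam y) m)
    (xpow ` {v \<in> mons n. mdeg v = m \<and> v \<notin> A})"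
proof (rule basis_mod_xpow)
  show "finite {v \<in> mons n. mdeg v = m \<and> v \<notin> A}"
    by (rule finite_subset[OF _ finite_mons_deg[of n m]]) (auto simp: mons_deg_def)
  fix f :: "'b mpol" assume f: "f \<in> deg_part (carrier (mpoly_ring n)) m"
  let ?C = "{v \<in> mons n. mdeg v = m \<and> v \<notin> A}"
  let ?c = "\<lambda>v. Poly_Mapping.lookup f v - (if v \<in> A' then y * Poly_Mapping.lookup f (unshift v) else 0)"
  let ?g = "\<Sum>v\<in>?C. scal (?c v) (xpow v)"
  have fin: "finite ?C" by fact
  have g: "Poly_Mapping.lookup ?g v = (if v \<in> ?C then ?c v else 0)" for v
    by (rule lookup_sum_scal_xpow[OF fin])
  have f_deg: "v \<in> mons n \<and> mdeg v = m" if "Poly_Mapping.lookup f v \<noteq> 0" for v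
    using f that by (auto simp: deg_part_iff in_keys_iff subset_iff)
  have g_deg: "v \<in> mons n \<and> mdeg v = m" if "Poly_Mapping.lookup ?g v \<noteq> 0" for v
    using that unfolding g by (auto split: if_splits)
  have "f - ?g \<in> fam y"
  proof (rule famI)
    fix v assume "Poly_Mapping.lookup (f - ?g) v \<noteq> 0"
    then show "v \<in> A \<union> A' \<and> r \<le> mdeg v"
      using f_deg[of v] g m by (auto simp: lookup_minus split: if_splits)
  next
    fix v assume v: "v \<in> A - A'" "r \<le> mdeg v"
    have sv: "shift v \<in> mons n" "shift v \<in> A'" "shift v \<notin> A" "mdeg (shift v) = mdeg v" "unshift (shift v) = v"
      using shift[OF v] A_mons by auto
    show "Poly_Mapping.lookup (f - ?g) (shift v) = y * Poly_Mapping.lookup (f - ?g) v"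
    proof (cases "mdeg v = m")
      case True
      then show ?thesis using v sv by (simp add: lookup_minus g)
    next
      case False
      then have "Poly_Mapping.lookup f (shift v) = 0" "Poly_Mapping.lookup f v = 0"
        using f_deg[of "shift v"] f_deg[of v] sv by auto
      then show ?thesis using False sv by (simp add: lookup_minus g)
    qed
  qed
  moreover have "mdeg v = m" if "v \<in> Poly_Mapping.keys (f - ?g)" for v
  proof -
    have "Poly_Mapping.lookup f v \<noteq> 0 \<or> Poly_Mapping.lookup ?g v \<noteq> 0"
      using that unfolding in_keys_iff lookup_minus by (metis diff_0_right)
    then show ?thesis using f_deg g_deg by blast
  qed
  moreover have "Poly_Mapping.keys ?g \<subseteq> ?C"
  proof
    fix v assume "v \<in> Poly_Mapping.keys ?g"
    then show "v \<in> ?C" unfolding in_keys_iff g by (metis (no_types, lifting))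
  qed
  ultimately show "\<exists>g. Poly_Mapping.keys g \<subseteq> ?C \<and> f - g \<in> deg_part (fam y) m"
    unfolding deg_part_iff by blast
next
  fix f g :: "'b mpol" assume "f \<in> deg_part (fam y) m" "g \<in> deg_part (fam y) m"
  then show "f - g \<in> deg_part (fam y) m"
    using fam_diff[of f y g] keys_diff[of f g] unfolding deg_part_iff by blast
next
  fix g :: "'b mpol" assume g: "g \<in> deg_part (fam y) m" "Poly_Mapping.keys g \<subseteq> {v \<in> mons n. mdeg v = m \<and> v \<notin> A}"
  then have gf: "g \<in> fam y" by (simp add: deg_part_iff)
  have zero: "Poly_Mapping.lookup g v = 0" if "v \<in> A" for v
    using g(2) that by (auto simp: in_keys_iff subset_iff)
  show "g = 0"
  proof (rule poly_mapping_eqI, rule ccontr)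
    fix v assume "Poly_Mapping.lookup g v \<noteq> Poly_Mapping.lookup 0 v"
    then have nz: "Poly_Mapping.lookup g v \<noteq> 0" by simp
    then have v: "v \<in> A' - A" "r \<le> mdeg v" using fam_support[OF gf] zero by auto
    have "Poly_Mapping.lookup g (shift (unshift v)) = y * Poly_Mapping.lookup g (unshift v)"
      using unshift[OF v] v(2) by (intro fam_shift[OF gf]) auto
    then show False using nz zero unshift(1,4)[OF v] by simp
  qed
qed (auto simp: deg_part_iff)

text \<open>Multiplication by \<open>x\<^sub>0\<close> does not change membership in \<open>A\<close> and \<open>A'\<close>, so the part in degrees at least
  \<open>r\<close> is already saturated.\<close>

lemma saturation_fam:
  assumes f: "f \<in> saturation n (fam y)" and deg: "\<And>v. v \<in> Poly_Mapping.keys f \<Longrightarrow> r \<le> mdeg v"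
  shows "f \<in> fam y"
proof -
  obtain k where k: "\<And>b. b \<in> mons_deg n k \<Longrightarrow> xpow b * f \<in> fam y"
    using saturationE[OF f] by blast
  let ?x = "Poly_Mapping.single 0 k :: mon"
  have x: "?x \<in> mons n" by (cases "k = 0") (auto simp: mons_def)
  then have xf: "xpow ?x * f \<in> fam y" by (intro k) (simp add: mons_deg_def)
  have cancel: "v + Poly_Mapping.single 0 j \<in> A \<Longrightarrow> v \<in> A" "v + Poly_Mapping.single 0 j \<in> A' \<Longrightarrow> v \<in> A'" for v j
  proof (induction j)
    case (Suc j)
    { case 1 then show ?case using Suc.IH(1) sat(1) unfolding single_Suc_mon[of 0 j] by (simp add: add.assoc[symmetric]) }
    { case 2 then show ?case using Suc.IH(2) sat(2) unfolding single_Suc_mon[of 0 j] by (simp add: add.assoc[symmetric]) }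
  qed simp_all
  show ?thesis
  proof (rule famI)
    fix v assume v: "Poly_Mapping.lookup f v \<noteq> 0"
    then have "?x + v \<in> A \<union> A'" using fam_support[OF xf, of "?x + v"] by simp
    then show "v \<in> A \<union> A' \<and> r \<le> mdeg v"
      using cancel[of v k] deg[of v] v by (auto simp: add.commute in_keys_iff)
  next
    fix v assume v: "v \<in> A - A'" "r \<le> mdeg v"
    have "?x + v \<in> A - A'" using v cancel(2)[of v k] A_add(1)[OF _ x] by (auto simp: add.commute)
    then have "Poly_Mapping.lookup (xpow ?x * f) (shift (?x + v)) = y * Poly_Mapping.lookup (xpow ?x * f) (?x + v)"
      using v by (intro fam_shift[OF xf]) auto
    then show "Poly_Mapping.lookup f (shift v) = y * Poly_Mapping.lookup f v"
      by (simp add: shift_add[OF v])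
  qed
qed

lemma deg_part_saturation_fam:
  assumes "r \<le> m"
  shows "deg_part (saturation n (fam y)) m = deg_part (fam y) m"
  using assms saturation_fam[of _ y] subset_saturation[OF fam_ideal[of y]] by (auto simp: deg_part_iff)

lemma saturation_fam_Hilb:
  assumes p: "\<forall>\<^sub>F t in sequentially. of_nat (hilb_fun 0 n A t) = poly p (of_nat t)"
  shows "saturation n (fam y) \<in> Hilb n p"
proof -
  have "has_hilbert_poly n (saturation n (fam y)) p"
    unfolding has_hilbert_poly_def
    using eventually_conj[OF p eventually_ge_at_top[of r]]
  proof (rule eventually_mono)
    fix t assume "of_nat (hilb_fun 0 n A t) = poly p (of_nat t) \<and> r \<le> t"
    then show "\<exists>B. basis_mod (deg_part (carrier (mpoly_ring n)) t) (deg_part (saturation n (fam y)) t) B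
        \<and> of_nat (card B) = poly p (of_nat t)"
      using basis_mod_fam[of t y] deg_part_saturation_fam[of t y]
      by (intro exI[of _ "xpow ` {v \<in> mons n. mdeg v = t \<and> v \<notin> A}"])
        (simp add: card_xpow_image hilb_fun_def mons_from_0)
  qed
  then show ?thesis
    using homog_ideal_saturation[OF homog_ideal_fam[of y]] saturation_idem[OF fam_ideal[of y]]
    by (simp add: Hilb_def)
qed

end

section \<open>Pluecker coordinates along the family\<close>

subsection \<open>Polynomial functions of one variable\<close>

definition poly_fun :: "('a::comm_ring_1 \<Rightarrow> 'a) \<Rightarrow> bool" where
  "poly_fun F \<longleftrightarrow> (\<exists>P. \<forall>s. F s = poly P s)"

lemma poly_fun_const: "poly_fun (\<lambda>s. c)"
  unfolding poly_fun_def by (intro exI[of _ "[:c:]"]) simp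

lemma poly_fun_id: "poly_fun (\<lambda>s. s)"
  unfolding poly_fun_def by (intro exI[of _ "[:0, 1:]"]) simp

lemma poly_fun_add: "poly_fun F \<Longrightarrow> poly_fun G \<Longrightarrow> poly_fun (\<lambda>s. F s + G s)"
  unfolding poly_fun_def by (metis poly_add)

lemma poly_fun_mult: "poly_fun F \<Longrightarrow> poly_fun G \<Longrightarrow> poly_fun (\<lambda>s. F s * G s)"
  unfolding poly_fun_def by (metis poly_mult)

lemma poly_fun_power: "poly_fun F \<Longrightarrow> poly_fun (\<lambda>s. F s ^ k)"
  by (induction k) (auto intro: poly_fun_const poly_fun_mult)

lemma poly_fun_sum: "(\<And>x. x \<in> S \<Longrightarrow> poly_fun (F x)) \<Longrightarrow> poly_fun (\<lambda>s. \<Sum>x\<in>S. F x s)"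
  by (induction S rule: infinite_finite_induct) (auto intro: poly_fun_const poly_fun_add)

lemma poly_fun_prod: "(\<And>x. x \<in> S \<Longrightarrow> poly_fun (F x)) \<Longrightarrow> poly_fun (\<lambda>s. \<Prod>x\<in>S. F x s)"
  by (induction S rule: infinite_finite_induct) (auto intro: poly_fun_const poly_fun_mult)

lemma poly_fun_finite_roots:
  fixes F :: "'a::field \<Rightarrow> 'a"
  assumes "poly_fun F" "F s\<^sub>0 \<noteq> 0"
  shows "finite {s. F s = 0}"
proof -
  obtain P where P: "\<And>s. F s = poly P s" using assms(1) by (auto simp: poly_fun_def)
  then have "P \<noteq> 0" using assms(2) by auto
  then show ?thesis using poly_roots_finite by (simp add: P)
qed

lemma pluecker_eq_sum:
  assumes "S \<subseteq> mons_deg n r" "card S = length ws"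
  shows "pluecker n r ws S = (\<Sum>p | p permutes {0..<length ws}. signof p *
    (\<Prod>i = 0..<length ws. Poly_Mapping.lookup (ws ! i) (sorted_list_of_set S ! p i)))"
proof -
  let ?N = "length ws"
  have "pluecker n r ws S = Determinant.det (mat ?N ?N (\<lambda>(i, j). Poly_Mapping.lookup (ws ! i) (sorted_list_of_set S ! j)))"
    using assms by (simp add: pluecker_def)
  also have "\<dots> = (\<Sum>p | p permutes {0..<?N}. signof p *
      (\<Prod>i = 0..<?N. mat ?N ?N (\<lambda>(i, j). Poly_Mapping.lookup (ws ! i) (sorted_list_of_set S ! j)) $$ (i, p i)))"
    by (rule det_def') simp
  also have "\<dots> = (\<Sum>p | p permutes {0..<?N}. signof p *
      (\<Prod>i = 0..<?N. Poly_Mapping.lookup (ws ! i) (sorted_list_of_set S ! p i)))"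
    by (intro sum.cong arg_cong2[of _ _ _ _ "(*)"] prod.cong refl)
      (auto dest: permutes_in_image)
  finally show ?thesis .
qed

lemma poly_fun_pluecker:
  fixes w :: "'a::comm_ring_1 \<Rightarrow> mon \<Rightarrow> 'a mpol"
  assumes "\<And>g v. poly_fun (\<lambda>s. Poly_Mapping.lookup (w s g) v)"
  shows "poly_fun (\<lambda>s. pluecker n r (map (w s) gs) S)"
proof (cases "S \<subseteq> mons_deg n r \<and> card S = length gs")
  case True
  then have "pluecker n r (map (w s) gs) S = (\<Sum>p | p permutes {0..<length gs}. signof p *
    (\<Prod>i = 0..<length gs. Poly_Mapping.lookup (w s (gs ! i)) (sorted_list_of_set S ! p i)))" for s
    by (subst pluecker_eq_sum) (auto intro!: sum.cong prod.cong)
  then show ?thesis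
    by (simp only:) (intro poly_fun_sum poly_fun_mult poly_fun_const poly_fun_prod assms)
next
  case False
  then have "pluecker n r (map (w s) gs) S = 0" for s by (auto simp: pluecker_def)
  then show ?thesis by (simp add: poly_fun_const)
qed

lemma poly_fun_eval_poly:
  assumes "\<And>x. poly_fun (\<lambda>s. v s x)"
  shows "poly_fun (\<lambda>s. eval_poly G (v s))"
  unfolding eval_poly_def
  by (intro poly_fun_sum poly_fun_mult poly_fun_const poly_fun_prod poly_fun_power assms)

lemma eval_poly_scale:
  assumes "homog_of_deg d G"
  shows "eval_poly G (\<lambda>x. c * v x) = c ^ d * eval_poly G v"
  unfolding eval_poly_def sum_distrib_left
proof (rule sum.cong[OF refl])
  fix m assume "m \<in> Poly_Mapping.keys G"
  then have d: "d = (\<Sum>x\<in>Poly_Mapping.keys m. Poly_Mapping.lookup m x)"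
    using assms by (auto simp: homog_of_deg_def mdeg_def)
  show "Poly_Mapping.lookup G m * (\<Prod>x\<in>Poly_Mapping.keys m. (c * v x) ^ Poly_Mapping.lookup m x) =
      c ^ d * (Poly_Mapping.lookup G m * (\<Prod>x\<in>Poly_Mapping.keys m. v x ^ Poly_Mapping.lookup m x))"
    unfolding d power_mult_distrib prod.distrib power_sum by (simp add: mult_ac)
qed

text \<open>A set \<open>S\<close> different from \<open>G\<close> but of the same size contains a monomial outside \<open>G\<close>, whose column in the
  coefficient matrix is zero.  So a space spanned by monomials, such as a graded piece of a monomial
  ideal, has only one nonzero Pluecker coordinate.\<close>

lemma pluecker_coordinate_subspace:
  assumes "finite G" "\<And>w. w \<in> set ws \<Longrightarrow> Poly_Mapping.keys w \<subseteq> G" "length ws = card G" "S \<noteq> G"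
  shows "pluecker n r ws S = 0"
proof (cases "S \<subseteq> mons_deg n r \<and> card S = length ws")
  case True
  have finS: "finite S" using True finite_mons_deg finite_subset by blast
  have "\<not> S \<subseteq> G" using card_subset_eq[OF assms(1)] True assms(3,4) by auto
  then obtain h where h: "h \<in> S" "h \<notin> G" by blast
  then obtain j where j: "j < length ws" "sorted_list_of_set S ! j = h"
    using finS True by (metis in_set_conv_nth length_sorted_list_of_set set_sorted_list_of_set)
  have zero: "Poly_Mapping.lookup (ws ! i) h = 0" if "i < length ws" for i
    using assms(2)[of "ws ! i"] that h(2) by (auto simp: in_keys_iff subset_iff)
  have "(\<Prod>i = 0..<length ws. Poly_Mapping.lookup (ws ! i) (sorted_list_of_set S ! p i)) = 0"
    if p: "p permutes {0..<length ws}" for p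
  proof -
    have "j \<in> p ` {0..<length ws}" using permutes_image[OF p] j(1) by simp
    then obtain i where "i < length ws" "p i = j" by auto
    then show ?thesis using zero[of i] j(2) by (intro prod_zero) auto
  qed
  then show ?thesis using True by (simp add: pluecker_eq_sum)
qed (auto simp: pluecker_def)

lemma pluecker_xpow:
  fixes G :: "mon set"
  assumes "finite G" "G \<subseteq> mons_deg n r"
  shows "pluecker n r (map xpow (sorted_list_of_set G)) G = (1 :: 'a::comm_ring_1)"
proof -
  let ?gs = "sorted_list_of_set G"
  let ?N = "length ?gs"
  have "mat ?N ?N (\<lambda>(i, j). Poly_Mapping.lookup (map xpow ?gs ! i) (?gs ! j)) = (1\<^sub>m ?N :: 'a mat)"
    by (rule eq_matI) (auto simp: lookup_xpow nth_eq_iff_index_eq)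
  then show ?thesis using assms by (simp add: pluecker_def)
qed

subsection \<open>The closure relation\<close>

context borel_pair
begin

text \<open>The family in the coordinate \<open>s = 1 / y\<close> of its parameter line, extended by \<open>J'\<close> to \<open>s = 0\<close>.\<close>

definition pencil :: "'b::field \<Rightarrow> 'b mpol set" where
  "pencil s = (if s = 0 then supported_on A' else saturation n (fam (inverse s)))"

definition pencil_gen :: "'b::field \<Rightarrow> mon \<Rightarrow> 'b mpol" where
  "pencil_gen s g = xpow g + (if g \<in> A' - A then scal s (xpow (unshift g)) else 0)"

lemma poly_fun_pencil_gen: "poly_fun (\<lambda>s. Poly_Mapping.lookup (pencil_gen s g) v)"
  unfolding pencil_gen_def lookup_add
  by (cases "g \<in> A' - A")
    (auto intro!: poly_fun_add poly_fun_mult poly_fun_const poly_fun_id)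

lemma pencil_gen_0: "pencil_gen 0 g = xpow g"
  by (rule poly_mapping_eqI) (simp add: pencil_gen_def lookup_add)

lemma pencil_gen_lookup:
  assumes "g \<in> A'" "r \<le> mdeg g"
  shows "Poly_Mapping.lookup (pencil_gen s g) v =
    (if v = g then 1 else if g \<in> A' - A \<and> v = unshift g then s else 0)"
proof -
  have "unshift g \<noteq> g" if "g \<in> A' - A" using unshift(1)[OF that assms(2)] assms(1) by auto
  then show ?thesis by (auto simp: pencil_gen_def lookup_add lookup_xpow)
qed

lemma pencil_gen_mem:
  fixes s :: "'b::field"
  assumes g: "g \<in> A'" "mdeg g = r"
  shows "pencil_gen s g \<in> deg_part (pencil s) r"
proof -
  have deg: "mdeg v = r" if "v \<in> Poly_Mapping.keys (pencil_gen s g)" for v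
    using that g unshift(3)[of g] by (auto simp: in_keys_iff pencil_gen_lookup split: if_splits)
  have "pencil_gen s g \<in> pencil s"
  proof (cases "s = 0")
    case True
    then show ?thesis using g by (simp add: pencil_def pencil_gen_0 supported_on_def)
  next
    case False
    let ?y = "inverse s"
    have "pencil_gen s g \<in> fam ?y"
    proof (cases "g \<in> A")
      case True
      then have "pencil_gen s g = fam_gen ?y g" using g by (simp add: pencil_gen_def fam_gen_def)
      then show ?thesis using fam_gen_mem[OF True] g by simp
    next
      case notA: False
      let ?v = "unshift g"
      have v: "?v \<in> A - A'" "mdeg ?v = r" "shift ?v = g" using unshift[of g] g notA by auto
      have "pencil_gen s g = scal s (fam_gen ?y ?v)"
        using v g notA False
        by (intro poly_mapping_eqI) (simp add: pencil_gen_def fam_gen_def lookup_add algebra_simps)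
      then show ?thesis using fam_gen_mem[of ?v ?y] v ideal_scal[OF fam_ideal] by auto
    qed
    then show ?thesis
      using subset_saturation[OF fam_ideal[of ?y]] False by (auto simp: pencil_def)
  qed
  then show ?thesis using deg by (simp add: deg_part_iff)
qed

lemma
  fixes s :: "'b::field"
  assumes f: "f \<in> deg_part (pencil s) r"
  shows pencil_support: "Poly_Mapping.lookup f v \<noteq> 0 \<Longrightarrow> v \<in> A \<union> A' \<and> mdeg v = r"
    and pencil_unshift: "g \<in> A' - A \<Longrightarrow> mdeg g = r \<Longrightarrow>
      Poly_Mapping.lookup f (unshift g) = s * Poly_Mapping.lookup f g"
proof -
  have deg: "mdeg v = r" if "Poly_Mapping.lookup f v \<noteq> 0" for v
    using f that by (simp add: deg_part_iff in_keys_iff)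
  have *: "(Poly_Mapping.lookup f v \<noteq> 0 \<longrightarrow> v \<in> A \<union> A') \<and>
    (g \<in> A' - A \<and> mdeg g = r \<longrightarrow> Poly_Mapping.lookup f (unshift g) = s * Poly_Mapping.lookup f g)" for v g
  proof (cases "s = 0")
    case True
    then have "Poly_Mapping.keys f \<subseteq> A'" using f by (simp add: deg_part_iff pencil_def supported_on_def)
    then have zero: "Poly_Mapping.lookup f u = 0" if "u \<notin> A'" for u
      using that by (auto simp: in_keys_iff subset_iff)
    then show ?thesis using unshift(1)[of g] True by auto
  next
    case False
    then have ff: "f \<in> fam (inverse s)"
      using f saturation_fam[of f "inverse s"] by (auto simp: deg_part_iff pencil_def)
    have "Poly_Mapping.lookup f (unshift g) = s * Poly_Mapping.lookup f g" if "g \<in> A' - A" "mdeg g = r"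
      using fam_shift[OF ff, of "unshift g"] unshift[of g] that False by (simp add: field_simps)
    then show ?thesis using fam_support[OF ff, of v] by blast
  qed
  show "Poly_Mapping.lookup f v \<noteq> 0 \<Longrightarrow> v \<in> A \<union> A' \<and> mdeg v = r" using * deg by blast
  show "g \<in> A' - A \<Longrightarrow> mdeg g = r \<Longrightarrow> Poly_Mapping.lookup f (unshift g) = s * Poly_Mapping.lookup f g"
    using * by blast
qed

abbreviation gens' :: "mon set" where
  "gens' \<equiv> {g \<in> A'. mdeg g = r}"

lemma gens': "finite gens'" "gens' \<subseteq> mons_deg n r"
proof -
  show sub: "gens' \<subseteq> mons_deg n r" using A_mons by (auto simp: mons_deg_def)
  show "finite gens'" by (rule finite_subset[OF sub finite_mons_deg])
qed

text \<open>An element of \<open>pencil s\<close> of degree \<open>r\<close> is determined by its coefficients at \<open>A'\<close>, also for \<open>s = 0\<close>, where those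
  at \<open>A - A'\<close> vanish.\<close>

lemma pencil_basis:
  fixes s :: "'b::field"
  shows "inj_on (pencil_gen s) gens'" "basis_mod (deg_part (pencil s) r) {0} (pencil_gen s ` gens')"
proof -
  have dual: "Poly_Mapping.lookup (pencil_gen s g) h = (if h = g then 1 else 0)"
    if "g \<in> gens'" "h \<in> gens'" for g h
    using that unshift(1)[of g] by (auto simp: pencil_gen_lookup)
  have span: "f = (\<Sum>g\<in>gens'. scal (Poly_Mapping.lookup f g) (pencil_gen s g))"
    if f: "f \<in> deg_part (pencil s) r" for f
  proof (rule poly_mapping_eqI)
    fix v
    have "Poly_Mapping.lookup (\<Sum>g\<in>gens'. scal (Poly_Mapping.lookup f g) (pencil_gen s g)) v =
      (\<Sum>g\<in>gens'. Poly_Mapping.lookup f g * (if v = g then 1 else if g \<in> A' - A \<and> v = unshift g then s else 0))"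
      unfolding lookup_sum by (intro sum.cong) (auto simp: pencil_gen_lookup)
    also have "\<dots> = Poly_Mapping.lookup f v"
    proof (cases "v \<in> A'")
      case True
      have "(\<Sum>g\<in>gens'. Poly_Mapping.lookup f g * (if v = g then 1 else if g \<in> A' - A \<and> v = unshift g then s else 0))
        = (\<Sum>g\<in>gens'. if v = g then Poly_Mapping.lookup f g else 0)"
        using True unshift(1) by (intro sum.cong) auto
      then show ?thesis using True gens'(1) pencil_support[OF f, of v] by auto
    next
      case notA': False
      show ?thesis
      proof (cases "v \<in> A \<and> mdeg v = r")
        case True
        with notA' have v: "v \<in> A - A'" "r \<le> mdeg v" by auto
        let ?g = "shift v"
        have g: "?g \<in> A' - A" "mdeg ?g = r" "unshift ?g = v" using shift[OF v] True by auto
        have "(\<Sum>g\<in>gens'. Poly_Mapping.lookup f g * (if v = g then 1 else if g \<in> A' - A \<and> v = unshift g then s else 0))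
          = (\<Sum>g\<in>gens'. if ?g = g then Poly_Mapping.lookup f g * s else 0)"
        proof (rule sum.cong[OF refl])
          fix h assume h: "h \<in> gens'"
          then have "v \<noteq> h" using notA' by auto
          moreover have "h \<in> A' - A \<and> v = unshift h \<longleftrightarrow> ?g = h"
            using g unshift(4)[of h] h by auto
          ultimately show "Poly_Mapping.lookup f h * (if v = h then 1 else if h \<in> A' - A \<and> v = unshift h then s else 0)
            = (if ?g = h then Poly_Mapping.lookup f h * s else 0)" by auto
        qed
        also have "\<dots> = Poly_Mapping.lookup f ?g * s" using g gens'(1) by simp
        also have "\<dots> = Poly_Mapping.lookup f v"
          using pencil_unshift[OF f g(1,2)] g(3) by (simp add: mult.commute)
        finally show ?thesis .
      next
        case no: False
        have "Poly_Mapping.lookup f v = 0" using pencil_support[OF f, of v] notA' no by auto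
        moreover have "(\<Sum>g\<in>gens'. Poly_Mapping.lookup f g *
            (if v = g then 1 else if g \<in> A' - A \<and> v = unshift g then s else 0)) = 0"
        proof (rule sum.neutral, rule ballI)
          fix h assume h: "h \<in> gens'"
          have "v \<noteq> h" using h notA' by auto
          moreover have "v \<noteq> unshift h" if "h \<in> A' - A"
            using unshift(1,3)[OF that] h no by auto
          ultimately show "Poly_Mapping.lookup f h *
              (if v = h then 1 else if h \<in> A' - A \<and> v = unshift h then s else 0) = 0" by auto
        qed
        ultimately show ?thesis by simp
      qed
    qed
    finally show "Poly_Mapping.lookup f v =
        Poly_Mapping.lookup (\<Sum>g\<in>gens'. scal (Poly_Mapping.lookup f g) (pencil_gen s g)) v" by simp
  qed
  have mem: "pencil_gen s ` gens' \<subseteq> deg_part (pencil s) r" using pencil_gen_mem by auto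
  note basis = basis_mod_zero[OF gens'(1) mem dual span]
  show "inj_on (pencil_gen s) gens'" "basis_mod (deg_part (pencil s) r) {0} (pencil_gen s ` gens')"
    by (rule basis; assumption)+
qed

definition pencil_list :: "'b::field \<Rightarrow> 'b mpol list" where
  "pencil_list s = map (pencil_gen s) (sorted_list_of_set gens')"

lemma pencil_list: "distinct (pencil_list s)" "set (pencil_list s) = pencil_gen s ` gens'"
  using pencil_basis(1)[of s] gens'(1) by (simp_all add: pencil_list_def distinct_map)

text \<open>Two bases of the same space have proportional Pluecker coordinates.  At \<open>s = 0\<close> this is elementary,
  because the space is spanned by monomials and only one coordinate is different from zero.\<close>

lemma eval_poly_pencil_0:
  fixes G :: "(mon set \<Rightarrow>\<^sub>0 nat) \<Rightarrow>\<^sub>0 'b::field"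
  assumes G: "homog_of_deg d G"
    and ws: "distinct ws" "basis_mod (deg_part (pencil 0) r) {0} (set ws)"
    and nz: "eval_poly G (pluecker n r ws) \<noteq> 0"
  shows "eval_poly G (pluecker n r (pencil_list 0)) \<noteq> 0"
proof -
  have "card (set ws) = card (pencil_gen (0::'b) ` gens')"
    by (rule basis_mod_card_eq[OF _ _ _ _ ws(2) pencil_basis(2)])
      (auto simp: deg_part_iff pencil_def supported_on_def scal_def)
  then have len: "length ws = card gens'"
    using pencil_basis(1)[of "0::'b"] by (simp add: distinct_card[OF ws(1)] card_image)
  have keys: "Poly_Mapping.keys w \<subseteq> gens'" if "w \<in> set ws" for w
  proof -
    have "w \<in> deg_part (pencil 0) r" using ws(2) that by (auto simp: basis_mod_def)
    then show ?thesis by (auto simp: deg_part_iff pencil_def supported_on_def)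
  qed
  have keys0: "Poly_Mapping.keys w \<subseteq> gens'" if "w \<in> set (pencil_list (0::'b))" for w
    using that by (auto simp: pencil_list pencil_gen_0)
  have len0: "length (pencil_list (0::'b)) = card gens'" by (simp add: pencil_list_def)
  have "pluecker n r (pencil_list (0::'b)) gens' = 1"
    unfolding pencil_list_def pencil_gen_0 by (rule pluecker_xpow[OF gens'])
  then have "pluecker n r ws S = pluecker n r ws gens' * pluecker n r (pencil_list 0) S" for S
    by (cases "S = gens'")
      (simp_all add: pluecker_coordinate_subspace[OF gens'(1) keys len] pluecker_coordinate_subspace[OF gens'(1) keys0 len0])
  then have "pluecker n r ws = (\<lambda>S. pluecker n r ws gens' * pluecker n r (pencil_list 0) S)" by (rule ext)
  then have "eval_poly G (pluecker n r ws) = pluecker n r ws gens' ^ d * eval_poly G (pluecker n r (pencil_list 0))"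
    using eval_poly_scale[OF G] by metis
  then show ?thesis using nz by auto
qed

text \<open>A homogeneous form in the Pluecker coordinates of \<open>pencil s\<close> is a polynomial in \<open>s\<close>, so if it does not
  vanish at \<open>s = 0\<close>, it has finitely many zeros.  Open sets are built from such nonvanishing loci by
  finite intersections and arbitrary unions.\<close>

lemma pencil_cofinite:
  fixes T :: "'b::field mpol set set"
  assumes Hilb: "\<And>s :: 'b. pencil s \<in> Hilb n p"
    and T: "openin (hilb_topology n p r) T" "pencil 0 \<in> T"
  shows "finite {s. pencil s \<notin> T}"
proof -
  have "generate_topology_on {hilb_nonvanishing n p r G | G. \<exists>d. homog_of_deg d G} T"
    using T(1) unfolding hilb_topology_def openin_topology_generated_by_iff .
  then show ?thesis using T(2)
  proof (induction rule: generate_topology_on.induct)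
    case Empty
    then show ?case by simp
  next
    case (Int a b)
    then have "finite ({s. pencil s \<notin> a} \<union> {s. pencil s \<notin> b})" by simp
    moreover have "{s. pencil s \<notin> a \<inter> b} = {s. pencil s \<notin> a} \<union> {s. pencil s \<notin> b}" by auto
    ultimately show ?case by simp
  next
    case (UN K)
    then obtain k where k: "k \<in> K" "pencil 0 \<in> k" by auto
    have "{s. pencil s \<notin> \<Union> K} \<subseteq> {s. pencil s \<notin> k}" using k by auto
    then show ?case using UN.IH[OF k] finite_subset by blast
  next
    case (Basis U)
    then obtain G d where U: "U = hilb_nonvanishing n p r G" and G: "homog_of_deg d G" by blast
    obtain ws where ws: "distinct ws" "basis_mod (deg_part (pencil 0) r) {0} (set ws)"
        "eval_poly G (pluecker n r ws) \<noteq> 0"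
      using Basis.prems unfolding U hilb_nonvanishing_def by blast
    let ?F = "\<lambda>s. eval_poly G (pluecker n r (pencil_list s))"
    have "poly_fun ?F"
      unfolding pencil_list_def by (intro poly_fun_eval_poly poly_fun_pluecker poly_fun_pencil_gen)
    moreover have "?F 0 \<noteq> 0" by (rule eval_poly_pencil_0[OF G ws])
    ultimately have "finite {s. ?F s = 0}" by (rule poly_fun_finite_roots)
    moreover have "pencil s \<in> U" if "?F s \<noteq> 0" for s
      unfolding U hilb_nonvanishing_def using Hilb[of s] that pencil_list[of s] pencil_basis(2)[of s] by auto
    then have "{s. pencil s \<notin> U} \<subseteq> {s. ?F s = 0}" by blast
    ultimately show ?case by (rule rev_finite_subset)
  qed
qed

lemma pencil_0_topspace:
  assumes "pencil (0::'b::field) \<in> Hilb n p"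
  shows "pencil (0::'b) \<in> topspace (hilb_topology n p r)"
proof -
  let ?G = "Poly_Mapping.single 0 1 :: (mon set \<Rightarrow>\<^sub>0 nat) \<Rightarrow>\<^sub>0 'b"
  have "eval_poly ?G v = 1" for v by (simp add: eval_poly_def)
  then have "pencil 0 \<in> hilb_nonvanishing n p r ?G"
    unfolding hilb_nonvanishing_def using assms pencil_list[of "0::'b"] pencil_basis(2)[of "0::'b"] by auto
  moreover have "homog_of_deg 0 ?G" by (simp add: homog_of_deg_def mdeg_def)
  ultimately show ?thesis unfolding hilb_topology_def by auto
qed

lemma pencil_0_in_closure:
  fixes X :: "'b::field_char_0 mpol set set"
  assumes "\<And>s :: 'b. pencil s \<in> Hilb n p" and X: "\<And>s :: 'b. s \<noteq> 0 \<Longrightarrow> pencil s \<in> X"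
  shows "pencil 0 \<in> hilb_topology n p r closure_of X"
  unfolding in_closure_of
proof (intro conjI allI impI)
  show "pencil (0::'b) \<in> topspace (hilb_topology n p r)" by (rule pencil_0_topspace) (rule assms)
  fix T :: "'b mpol set set" assume T: "pencil 0 \<in> T \<and> openin (hilb_topology n p r) T"
  then have "finite (insert 0 {s :: 'b. pencil s \<notin> T})"
    using pencil_cofinite[OF assms(1)] by blast
  then obtain s where "s \<notin> insert 0 {s :: 'b. pencil s \<notin> T}"
    using ex_new_if_finite[OF infinite_UNIV_char_0] by blast
  then show "\<exists>y. y \<in> X \<and> y \<in> T" using X by auto
qed

lemma fam_in_stratum:
  fixes J :: "'b::field mpol set"
  assumes J: "\<And>m. r \<le> m \<Longrightarrow> deg_mons_in n m J = {g \<in> A. mdeg g = m}"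
    and smaller: "\<And>g. g \<in> A - A' \<Longrightarrow> mdeg g = r \<Longrightarrow> (shift g, g) \<in> \<Omega>"
  shows "fam y \<in> groebner_stratum n r \<Omega> J"
proof -
  have fam: "marked_ideal n r J (fam_gen y) = fam y"
    by (simp add: marked_ideal_def J genideal_fam_gen)
  have "marked_set n r \<Omega> J (fam_gen y)"
    unfolding marked_set_def
  proof (intro ballI conjI)
    fix g assume "g \<in> deg_mons_in n r J"
    then have g: "g \<in> A" "mdeg g = r" by (auto simp: J)
    show "Poly_Mapping.lookup (fam_gen y g) g = 1" using g by (simp add: fam_gen_lookup)
    fix b assume "b \<in> Poly_Mapping.keys (fam_gen y g) - {g}"
    then have b: "g \<in> A - A'" "b = shift g"
      using g by (auto simp: in_keys_iff fam_gen_lookup split: if_splits)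
    then show "b \<in> mons_deg n r - deg_mons_in n r J" "(b, g) \<in> \<Omega>"
      using shift(1,3)[of g] g A_mons smaller by (auto simp: J mons_deg_def)
  qed
  moreover have "mons_deg n m - deg_mons_in n m J = {v \<in> mons n. mdeg v = m \<and> v \<notin> A}" if "r \<le> m" for m
    by (auto simp: J[OF that] mons_deg_def)
  ultimately have "marked_basis n r \<Omega> J (fam_gen y)"
    unfolding marked_basis_def fam using basis_mod_fam[of _ y] by simp
  then show ?thesis unfolding groebner_stratum_def using fam by blast
qed

end

section \<open>Borel adjacency and term orders\<close>

lemma gen_mon_add: "gen_mon (a + b) = gen_mon a + gen_mon b"
  by (rule poly_mapping_eqI) (simp add: gen_mon_def lookup_add Poly_Mapping.map.rep_eq when_def)

lemma gen_mon_inj: "gen_mon a = gen_mon b \<Longrightarrow> a = b"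
proof (rule poly_mapping_eqI)
  fix i assume "gen_mon a = gen_mon b"
  then have "Poly_Mapping.lookup (gen_mon a) i = Poly_Mapping.lookup (gen_mon b) i" by simp
  then show "Poly_Mapping.lookup a i = Poly_Mapping.lookup b i"
    by (auto simp: gen_mon_def Poly_Mapping.map.rep_eq when_def split: if_splits)
qed

text \<open>An increasing move raises the weighted degree in which \<open>x\<^sub>i\<close> has weight \<open>i\<close> by one.\<close>

lemma borel_ge_antisym:
  assumes "borel_ge n a b" "borel_ge n b a"
  shows "a = b"
proof -
  define wt where "wt = (\<lambda>a :: mon. \<Sum>i\<le>n. i * Poly_Mapping.lookup a i)"
  have wt_add: "wt (a + b) = wt a + wt b" for a b
    by (simp add: wt_def lookup_add distrib_left sum.distrib)
  have wt_var: "wt (var i) = i" if "i \<le> n" for i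
  proof -
    have "wt (var i) = (\<Sum>j\<le>n. if i = j then j else 0)"
      unfolding wt_def by (intro sum.cong) (auto simp: lookup_single when_def)
    then show ?thesis using that by simp
  qed
  have step: "wt b < wt a" if step: "borel_step n a b" for a b
  proof -
    obtain i where i: "i < n" "gen_mon a = e_incr i (gen_mon b)" using step by (auto simp: borel_step_def)
    have gv: "gen_mon (var j) = Poly_Mapping.single j 1" for j
      by (rule poly_mapping_eqI) (simp add: gen_mon_def lookup_single Poly_Mapping.map.rep_eq when_def)
    have "gen_mon (a + var i) = gen_mon (b + var (Suc i))"
      unfolding gen_mon_add gv i(2) e_incr_def by simp
    then have "wt (a + var i) = wt (b + var (Suc i))" using gen_mon_inj by metis
    then show ?thesis using i(1) by (simp add: wt_add wt_var del: One_nat_def)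
  qed
  have "a = b \<or> wt b < wt a" if "borel_ge n a b" for a b
    using that unfolding borel_ge_def by (induction rule: rtranclp_induct) (auto dest: step)
  from this[OF assms(1)] this[OF assms(2)] show ?thesis by auto
qed

lemma is_borel_max_unique: "is_borel_max n M a \<Longrightarrow> is_borel_max n M b \<Longrightarrow> a = b"
  unfolding is_borel_max_def using borel_ge_antisym by blast

lemma decr_compositions_translation:
  assumes "E \<in> decr_compositions n"
  shows "\<exists>t. \<forall>x. E x = x + t"
  using assms
proof induction
  case id
  show ?case by (intro exI[of _ 0]) simp
next
  case (comp E j)
  then obtain t where "\<And>x. E x = x + t" by blast
  then show ?case
    by (intro exI[of _ "t + Poly_Mapping.single (j - 1) 1 - Poly_Mapping.single j 1"])
      (simp add: e_decr_def algebra_simps)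
qed

text \<open>One composition of moves leads from \<open>a\<close> to \<open>g\<close> and from \<open>a'\<close> to an element of \<open>D'\<close>; being a translation,
  it preserves the difference \<open>a' - a\<close>.\<close>

lemma borel_adjacent_translate:
  assumes images: "gen_mon ` D = (\<lambda>E. E (gen_mon a)) ` \<E>" "gen_mon ` D' = (\<lambda>E. E (gen_mon a')) ` \<E>"
    and E: "\<E> \<subseteq> decr_compositions n" and g: "g \<in> D"
  shows "\<exists>g'\<in>D'. g' + a = g + a'"
proof -
  have "gen_mon g \<in> (\<lambda>E. E (gen_mon a)) ` \<E>" unfolding images(1)[symmetric] using g by (rule imageI)
  then obtain F where F: "F \<in> \<E>" "gen_mon g = F (gen_mon a)" by blast
  have "F (gen_mon a') \<in> gen_mon ` D'" unfolding images(2) using F(1) by (rule imageI)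
  then obtain g' where g': "g' \<in> D'" "gen_mon g' = F (gen_mon a')" by (elim imageE) simp
  obtain t where t: "\<And>x. F x = x + t" using decr_compositions_translation F(1) E by blast
  have "gen_mon (g' + a) = gen_mon (g + a')"
    unfolding gen_mon_add F(2) g'(2) t by (simp add: add_ac)
  then show ?thesis using g'(1) gen_mon_inj by blast
qed

text \<open>The two differences \<open>g' - g\<close> and \<open>a' - a\<close> agree, and the order of two monomials depends only on their
  difference.\<close>

lemma term_order_translate:
  assumes \<Omega>: "term_order n \<Omega>" and less: "(a', a) \<in> \<Omega>" "a' \<noteq> a"
    and g: "g \<in> mons n" "g' \<in> mons n" "g' + a = g + a'"
  shows "(g', g) \<in> \<Omega>"
proof (rule ccontr)
  assume "(g', g) \<notin> \<Omega>"
  have lin: "linear_order_on (mons n) \<Omega>"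
    and add: "\<And>a b c. (a, b) \<in> \<Omega> \<Longrightarrow> c \<in> mons n \<Longrightarrow> (a + c, b + c) \<in> \<Omega>"
    using \<Omega> by (auto simp: term_order_def)
  have "g \<noteq> g'" using g(3) less(2) by auto
  then have "(g, g') \<in> \<Omega>" using lin g \<open>(g', g) \<notin> \<Omega>\<close>
    by (auto simp: linear_order_on_def total_on_def)
  moreover have "a' \<in> mons n"
    using lin less(1) by (auto simp: linear_order_on_def partial_order_on_def preorder_on_def refl_on_def)
  ultimately have "(g + a', g' + a') \<in> \<Omega>" by (intro add)
  moreover have "(g' + a', g + a') \<in> \<Omega>"
    using add[OF less(1) g(2)] g(3) by (simp add: add.commute)
  ultimately have "g + a' = g' + a'"
    using lin unfolding linear_order_on_def partial_order_on_def antisym_def by blast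
  then show False using g(3) less(2) by (metis add.commute add_right_imp_eq add_left_imp_eq)
qed

theorem proposition4p4:
  fixes n r :: nat and p :: "rat poly" and \<Omega> :: "mon rel"
    and J J' :: "'k::{alg_closed_field, field_char_0} mpol set"
  assumes "is_gotzmann_number p r"
    and "term_order n \<Omega>"
    and "J \<in> S_set n p r" and "J' \<in> S_set n p r"
    and "borel_adjacent n r J J'"
    and "is_borel_max n (deg_mons_in n r J - deg_mons_in n r J') a"
    and "is_borel_max n (deg_mons_in n r J' - deg_mons_in n r J) a'"
    and "(a', a) \<in> \<Omega>" and "a' \<noteq> a"
  shows "hilb_point n J' \<in>
    hilb_topology n p r closure_of (hilb_point n ` groebner_stratum n r \<Omega> J)"
proof -
  obtain A where A: "borel_set 0 n A" "\<And>b. b + var 0 \<in> A \<Longrightarrow> b \<in> A" "generated_upto 0 n A r"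
      "\<forall>\<^sub>F t in sequentially. of_nat (hilb_fun 0 n A t) = poly p (of_nat t)"
      "\<And>m. r \<le> m \<Longrightarrow> deg_mons_in n m J = {g \<in> A. mdeg g = m}"
      "hilb_point n J = supported_on A" "supported_on A \<in> (Hilb n p :: 'k mpol set set)"
    by (rule S_set_obtains[OF assms(3,1)]) blast
  obtain A' where A': "borel_set 0 n A'" "\<And>b. b + var 0 \<in> A' \<Longrightarrow> b \<in> A'" "generated_upto 0 n A' r"
      "\<forall>\<^sub>F t in sequentially. of_nat (hilb_fun 0 n A' t) = poly p (of_nat t)"
      "\<And>m. r \<le> m \<Longrightarrow> deg_mons_in n m J' = {g \<in> A'. mdeg g = m}"
      "hilb_point n J' = supported_on A'" "supported_on A' \<in> (Hilb n p :: 'k mpol set set)"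
    by (rule S_set_obtains[OF assms(4,1)]) blast
  let ?D = "deg_mons_in n r J - deg_mons_in n r J'"
  let ?D' = "deg_mons_in n r J' - deg_mons_in n r J"
  have D: "?D = {g \<in> A - A'. mdeg g = r}" and D': "?D' = {g \<in> A' - A. mdeg g = r}"
    using A(5)[of r] A'(5)[of r] by auto
  obtain b b' \<E> where max: "is_borel_max n ?D b" "is_borel_max n ?D' b'"
    and \<E>: "\<E> \<subseteq> decr_compositions n"
    and images: "gen_mon ` ?D = (\<lambda>E. E (gen_mon b)) ` \<E>" "gen_mon ` ?D' = (\<lambda>E. E (gen_mon b')) ` \<E>"
    using assms(5) unfolding borel_adjacent_def Let_def by blast
  have b: "b = a" "b' = a'"
    using is_borel_max_unique[OF max(1) assms(6)] is_borel_max_unique[OF max(2) assms(7)] by simp_all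
  have aD: "a \<in> ?D" "a' \<in> ?D'" using assms(6,7) by (simp_all add: is_borel_max_def)
  interpret borel_pair n r A A' a a'
  proof (rule borel_pair.intro)
    show "\<forall>\<^sub>F t in sequentially. hilb_fun 0 n A t = hilb_fun 0 n A' t"
      using eventually_conj[OF A(4) A'(4)] by (rule eventually_mono) (metis of_nat_eq_iff)
    show "\<exists>g'\<in>A' - A. g' + a = g + a'" if "g \<in> A - A'" "mdeg g = r" for g
      using borel_adjacent_translate[OF images \<E>, of g] that unfolding b D D' by blast
    show "\<exists>g\<in>A - A'. g + a' = g' + a" if "g' \<in> A' - A" "mdeg g' = r" for g'
      using borel_adjacent_translate[OF images(2,1) \<E>, of g'] that unfolding b D D' by blast
    show "mdeg a = r" "mdeg a' = r" "a \<noteq> a'" using aD assms(9) unfolding D D' by auto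
  qed (fact A A')+
  have Hilb: "pencil s \<in> Hilb n p" for s :: 'k
    using A'(7) saturation_fam_Hilb[OF A(4), of "inverse s"] by (simp add: pencil_def)
  have "(shift g, g) \<in> \<Omega>" if "g \<in> A - A'" "mdeg g = r" for g
    using that shift[of g] A_mons
    by (intro term_order_translate[OF assms(2,8,9)]) auto
  then have "fam y \<in> groebner_stratum n r \<Omega> J" for y :: 'k
    using fam_in_stratum[of J \<Omega> y] A(5) by blast
  then have "pencil s \<in> hilb_point n ` groebner_stratum n r \<Omega> J" if "s \<noteq> 0" for s :: 'k
    using that by (auto simp: pencil_def hilb_point_def)
  then have "pencil 0 \<in> hilb_topology n p r closure_of (hilb_point n ` groebner_stratum n r \<Omega> J)"
    by (rule pencil_0_in_closure[OF Hilb])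
  then show ?thesis by (simp add: pencil_def A'(6))
qed

end
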